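(* Let $(\mathcal{N},G)$ be a Riemannian manifold with metric $G$ and norm $\|v\|:=\sqrt{G(v,v)}$, let $U\subset\mathcal{N}$ be a convex subset of $\mathcal{N}$, and let $f:U\to\mathbb{R}$ be a function possessing a Riemannian gradient $\mathrm{grad} f$ and a Riemannian Hessian $\mathrm{Hess} f$. Consider $x\in\mathcal{N}$ and $\Delta x\in T_x\mathcal{N}$ with $x,\exp_x(\Delta x)\in U$, and denote by $\mathcal{P}_{\alpha,\beta}:T_{\gamma(\alpha)}\mathcal{N}\to T_{\gamma(\beta)}\mathcal{N}$ the parallel transport along the geodesic $\gamma:[0,1]\to\mathcal{N}$, $\gamma(t):=\exp_x(t\Delta x)$. Assume that the Riemannian Hessian of $f$ has the following Lipschitz property at $x$: there is a constant $L<\infty$ with $$\|\mathcal{P}_{1,0}\,\mathrm{Hess} f(\exp_x(\Delta x))\,\mathcal{P}_{0,1}-\mathrm{Hess} f(x)\|\le L\|\Delta x\|\qquad\text{for all }\Delta x\text{ with }\exp_x(\Delta x)\in U .$$ Then $$\Big|f(\exp_x(\Delta x))-f(x)-G(\mathrm{grad} f(x),\Delta x)-\tfrac12 G(\mathrm{Hess} f(x)\Delta x,\Delta x)\Big|\le\frac{L}{6}\|\Delta x\|^3 .$$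
   Context: $\mathrm{Hess} f(x):T_x\mathcal{N}\to T_x\mathcal{N}$ is the Riemannian Hessian, $\mathrm{Hess} f(x)[v]:=\nabla_v\,\mathrm{grad} f$, where $\nabla$ is the Riemannian (Levi-Civita) connection of $G$ and $\mathrm{grad} f$ is the Riemannian gradient. The norm of a linear operator on a tangent space is the operator norm induced by $\|\cdot\|$. $\exp$ is the Riemannian exponential map. Convexity is meant in the geodesic sense: for $x,\exp_x(\Delta x)\in U$ the geodesic $t\mapsto\exp_x(t\Delta x)$, $t\in[0,1]$, lies in $U$. *)

theory Defs
  imports "HOL-Analysis.Analysis"
begin

text \<open>Intended for open \<open>S\<close>: the derivatives are taken at, not within.\<close>

primrec Ck_on :: "nat \<Rightarrow> 'b::real_normed_vector set \<Rightarrow> ('b \<Rightarrow> 'c::real_normed_vector) \<Rightarrow> bool" where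
  "Ck_on 0 S f \<longleftrightarrow> continuous_on S f"
| "Ck_on (Suc k) S f \<longleftrightarrow> (\<forall>x\<in>S. f differentiable (at x)) \<and>
     (\<forall>v. Ck_on k S (\<lambda>x. frechet_derivative f (at x) v))"

definition smooth_on :: "'b::real_normed_vector set \<Rightarrow> ('b \<Rightarrow> 'c::real_normed_vector) \<Rightarrow> bool" where
  "smooth_on S f \<longleftrightarrow> (\<forall>k. Ck_on k S f)"

text \<open>
  A chart is a pair of its domain and its coordinate map into the Euclidean model space \<open>'e\<close>.

  For each point \<open>p\<close> one chart around \<open>p\<close> is selected, the preferred chart. A tangent vector at
  \<open>p\<close> (usually an equivalence class of pairs of a chart and a component vector) is represented by
  its components in the preferred chart at \<open>p\<close>. Thus every tangent space is the vector space
  \<open>'e\<close>, and \<open>metric N p\<close> is an inner product on it; components in another chart are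
  obtained by applying the derivative of the coordinate change.
\<close>

type_synonym ('a, 'e) chart = "'a set \<times> ('a \<Rightarrow> 'e)"

record ('a, 'e) riem =
  topo :: "'a topology"
  atlas :: "('a, 'e) chart set"
  metric :: "'a \<Rightarrow> 'e \<Rightarrow> 'e \<Rightarrow> real"

abbreviation points :: "('a, 'e) riem \<Rightarrow> 'a set" where
  "points N \<equiv> topspace (topo N)"

definition chart_inv :: "('a, 'e) chart \<Rightarrow> 'e \<Rightarrow> 'a" where
  "chart_inv c = inv_into (fst c) (snd c)"

definition pref_chart :: "('a, 'e) riem \<Rightarrow> 'a \<Rightarrow> ('a, 'e) chart" where
  "pref_chart N p = (SOME c. c \<in> atlas N \<and> p \<in> fst c)"

text \<open>Turns the components, in chart \<open>c\<close>, of a tangent vector at \<open>p\<close> into those in chart \<open>d\<close>.\<close>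

definition tangent_change ::
    "('a, 'e::euclidean_space) chart \<Rightarrow> ('a, 'e) chart \<Rightarrow> 'a \<Rightarrow> 'e \<Rightarrow> 'e" where
  "tangent_change c d p = frechet_derivative (snd d \<circ> chart_inv c) (at (snd c p))"

definition components :: "('a, 'e::euclidean_space) riem \<Rightarrow> ('a, 'e) chart \<Rightarrow> 'a \<Rightarrow> 'e \<Rightarrow> 'e" where
  "components N c p v = tangent_change (pref_chart N p) c p v"

definition vector_of_components ::
    "('a, 'e::euclidean_space) riem \<Rightarrow> ('a, 'e) chart \<Rightarrow> 'a \<Rightarrow> 'e \<Rightarrow> 'e" where
  "vector_of_components N c p a = tangent_change c (pref_chart N p) p a"

definition smooth_manifold :: "('a, 'e::euclidean_space) riem \<Rightarrow> bool" where
  "smooth_manifold N \<longleftrightarrow>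
     Hausdorff_space (topo N) \<and> second_countable (topo N) \<and>
     points N = \<Union> (fst ` atlas N) \<and>
     (\<forall>(D, \<phi>)\<in>atlas N. openin (topo N) D \<and> open (\<phi> ` D) \<and>
        homeomorphic_map (subtopology (topo N) D) (top_of_set (\<phi> ` D)) \<phi>) \<and>
     (\<forall>c\<in>atlas N. \<forall>d\<in>atlas N.
        smooth_on (snd c ` (fst c \<inter> fst d)) (snd d \<circ> chart_inv c))"

definition metric_in_chart ::
    "('a, 'e::euclidean_space) riem \<Rightarrow> ('a, 'e) chart \<Rightarrow> 'e \<Rightarrow> 'e \<Rightarrow> 'e \<Rightarrow> real" where
  "metric_in_chart N c y a b =
     (let p = chart_inv c y
      in metric N p (vector_of_components N c p a) (vector_of_components N c p b))"

definition riemannian_manifold :: "('a, 'e::euclidean_space) riem \<Rightarrow> bool" where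
  "riemannian_manifold N \<longleftrightarrow> smooth_manifold N \<and>
     (\<forall>p\<in>points N. bilinear (metric N p) \<and>
        (\<forall>u v. metric N p u v = metric N p v u) \<and>
        (\<forall>v. v \<noteq> 0 \<longrightarrow> metric N p v v > 0)) \<and>
     (\<forall>c\<in>atlas N. \<forall>a b. smooth_on (snd c ` fst c) (\<lambda>y. metric_in_chart N c y a b))"

definition tnorm :: "('a, 'e::euclidean_space) riem \<Rightarrow> 'a \<Rightarrow> 'e \<Rightarrow> real" where
  "tnorm N p v = sqrt (metric N p v v)"

text \<open>As for \<^const>\<open>onorm\<close>, \<open>v = 0\<close> contributes the harmless value \<open>0\<close>.\<close>

definition opnorm :: "('a, 'e::euclidean_space) riem \<Rightarrow> 'a \<Rightarrow> ('e \<Rightarrow> 'e) \<Rightarrow> real" where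
  "opnorm N p T = (SUP v. tnorm N p (T v) / tnorm N p v)"

text \<open>
  In a chart a connection has the form \<open>\<nabla>\<^sub>a X = D X(a) + \<Gamma>(a, X)\<close>. The Levi-Civita connection is
  the one that is torsion free (second conjunct) and compatible with the metric, that is
  \<open>d (G(a, b)) = G(\<nabla>\<^sub>d a, b) + G(a, \<nabla>\<^sub>d b)\<close>, here for the coordinate fields with constant
  components \<open>a\<close>, \<open>b\<close> (third conjunct).
\<close>

definition christoffel ::
    "('a, 'e::euclidean_space) riem \<Rightarrow> ('a, 'e) chart \<Rightarrow> 'e \<Rightarrow> 'e \<Rightarrow> 'e \<Rightarrow> 'e" where
  "christoffel N c y = (THE \<Gamma>. bilinear \<Gamma> \<and>
     (\<forall>a b. \<Gamma> a b = \<Gamma> b a) \<and>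
     (\<forall>a b d. frechet_derivative (\<lambda>z. metric_in_chart N c z a b) (at y) d =
        metric_in_chart N c y (\<Gamma> d a) b + metric_in_chart N c y a (\<Gamma> d b)))"

text \<open>
  The covariant derivatives below are computed at \<open>p\<close> in the preferred chart at \<open>p\<close>, so that
  their values are already the representing components of a tangent vector at \<open>p\<close>.

  \<open>has_cov_deriv N S X T p\<close>: the vector field \<open>X\<close> on \<open>S\<close> has at \<open>p \<in> S\<close> the covariant
  derivative \<open>v \<mapsto> \<nabla>\<^sub>v X = T v\<close>. The derivative is taken within \<open>S\<close>; it is the ordinary one if \<open>S\<close>
  is a neighbourhood of \<open>p\<close>.
\<close>

definition has_cov_deriv ::
    "('a, 'e::euclidean_space) riem \<Rightarrow> 'a set \<Rightarrow> ('a \<Rightarrow> 'e) \<Rightarrow> ('e \<Rightarrow> 'e) \<Rightarrow> 'a \<Rightarrow> bool" where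
  "has_cov_deriv N S X T p \<longleftrightarrow>
     (let c = pref_chart N p in
      \<exists>X'. ((\<lambda>z. components N c (chart_inv c z) (X (chart_inv c z))) has_derivative X')
             (at (snd c p) within snd c ` (S \<inter> fst c)) \<and>
           T = (\<lambda>v. X' v + christoffel N c (snd c p) v (X p)))"

definition has_velocity ::
    "('a, 'e::euclidean_space) riem \<Rightarrow> real set \<Rightarrow> (real \<Rightarrow> 'a) \<Rightarrow> (real \<Rightarrow> 'e) \<Rightarrow> bool" where
  "has_velocity N I \<gamma> V \<longleftrightarrow> continuous_map (top_of_set I) (topo N) \<gamma> \<and>
     (\<forall>t\<in>I. ((snd (pref_chart N (\<gamma> t)) \<circ> \<gamma>) has_vector_derivative V t) (at t within I))"

text \<open>\<open>w\<close> is the covariant derivative at \<open>t\<close> of the vector field \<open>X\<close> along the curve \<open>\<gamma>\<close>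
  with velocity field \<open>V\<close>.\<close>

definition has_cov_deriv_along ::
    "('a, 'e::euclidean_space) riem \<Rightarrow> real set \<Rightarrow> (real \<Rightarrow> 'a) \<Rightarrow> (real \<Rightarrow> 'e) \<Rightarrow> (real \<Rightarrow> 'e) \<Rightarrow>
     'e \<Rightarrow> real \<Rightarrow> bool" where
  "has_cov_deriv_along N I \<gamma> V X w t \<longleftrightarrow>
     (let c = pref_chart N (\<gamma> t) in
      \<exists>X'. ((\<lambda>s. components N c (\<gamma> s) (X s)) has_vector_derivative X') (at t within I) \<and>
           w = X' + christoffel N c (snd c (\<gamma> t)) (V t) (X t))"

definition parallel_along ::
    "('a, 'e::euclidean_space) riem \<Rightarrow> real set \<Rightarrow> (real \<Rightarrow> 'a) \<Rightarrow> (real \<Rightarrow> 'e) \<Rightarrow> bool" where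
  "parallel_along N I \<gamma> X \<longleftrightarrow>
     (\<exists>V. has_velocity N I \<gamma> V \<and> (\<forall>t\<in>I. has_cov_deriv_along N I \<gamma> V X 0 t))"

definition geodesic_on ::
    "('a, 'e::euclidean_space) riem \<Rightarrow> real set \<Rightarrow> (real \<Rightarrow> 'a) \<Rightarrow> (real \<Rightarrow> 'e) \<Rightarrow> bool" where
  "geodesic_on N I \<gamma> V \<longleftrightarrow>
     has_velocity N I \<gamma> V \<and> (\<forall>t\<in>I. has_cov_deriv_along N I \<gamma> V V 0 t)"

text \<open>Completeness is not assumed: the exponential map at \<open>x\<close> is defined at those \<open>v\<close> whose
  geodesic exists up to time 1.\<close>

definition exp_dom :: "('a, 'e::euclidean_space) riem \<Rightarrow> 'a \<Rightarrow> 'e set" where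
  "exp_dom N x = {v. \<exists>\<gamma> V. geodesic_on N {0..1} \<gamma> V \<and> \<gamma> 0 = x \<and> V 0 = v}"

definition exp_map :: "('a, 'e::euclidean_space) riem \<Rightarrow> 'a \<Rightarrow> 'e \<Rightarrow> 'a" where
  "exp_map N x v = (THE y. \<exists>\<gamma> V. geodesic_on N {0..1} \<gamma> V \<and> \<gamma> 0 = x \<and> V 0 = v \<and> \<gamma> 1 = y)"

definition parallel_transport ::
    "('a, 'e::euclidean_space) riem \<Rightarrow> (real \<Rightarrow> 'a) \<Rightarrow> real \<Rightarrow> real \<Rightarrow> 'e \<Rightarrow> 'e" where
  "parallel_transport N \<gamma> \<alpha> \<beta> v =
     (THE w. \<exists>X. parallel_along N {0..1} \<gamma> X \<and> X \<alpha> = v \<and> X \<beta> = w)"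

definition geodesically_convex :: "('a, 'e::euclidean_space) riem \<Rightarrow> 'a set \<Rightarrow> bool" where
  "geodesically_convex N U \<longleftrightarrow> U \<subseteq> points N \<and>
     (\<forall>x\<in>U. \<forall>v\<in>exp_dom N x. exp_map N x v \<in> U \<longrightarrow>
        (\<forall>t\<in>{0..1}. exp_map N x (t *\<^sub>R v) \<in> U))"

text \<open>
  \<open>U\<close> need not be open, so derivatives are taken within \<open>U\<close>. If \<open>U\<close> is open, gradient
  and Hessian are determined by \<open>f\<close> on \<open>U\<close>; in general they are any fields with the
  defining properties.
\<close>

definition is_gradient_on ::
    "('a, 'e::euclidean_space) riem \<Rightarrow> 'a set \<Rightarrow> ('a \<Rightarrow> real) \<Rightarrow> ('a \<Rightarrow> 'e) \<Rightarrow> bool" where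
  "is_gradient_on N U f g \<longleftrightarrow> (\<forall>p\<in>U. let c = pref_chart N p in
     ((f \<circ> chart_inv c) has_derivative (\<lambda>v. metric N p (g p) v))
       (at (snd c p) within snd c ` (U \<inter> fst c)))"

definition is_hessian_on ::
    "('a, 'e::euclidean_space) riem \<Rightarrow> 'a set \<Rightarrow> ('a \<Rightarrow> 'e) \<Rightarrow> ('a \<Rightarrow> 'e \<Rightarrow> 'e) \<Rightarrow> bool" where
  "is_hessian_on N U g H \<longleftrightarrow> (\<forall>p\<in>U. has_cov_deriv N U g (H p) p)"

end

theory Submission
  imports Defs
begin

text \<open>
  Let \<open>\<gamma>\<close> be the geodesic from \<open>x\<close> with initial velocity \<open>\<Delta>x\<close>, with velocity field \<open>V\<close>, and put
  \<open>\<phi>(t) = f (\<gamma> t)\<close>. By convexity \<open>\<gamma>\<close> stays in \<open>U\<close>, so that the chain rule applies although \<open>U\<close> need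
  not be open: \<open>\<phi>' = G(grad f, V)\<close> (\<open>has_derivative_along_gradient\<close>). Since \<open>V\<close> is parallel and the
  covariant derivative of \<open>grad f\<close> along \<open>\<gamma>\<close> is \<open>Hess f V\<close> (\<open>cov_deriv_along_hessian\<close>),
  compatibility of the connection with the metric (\<open>has_derivative_metric_along\<close>) gives
  \<open>\<phi>'' = G(Hess f V, V)\<close>. Parallel transport along \<open>\<gamma>\<close> is an isometry carrying \<open>\<Delta>x\<close> to \<open>V s\<close>, whence
  \<open>\<phi>''(s) - \<phi>''(0) = G(T \<Delta>x, \<Delta>x)\<close>, where \<open>T\<close> is the transported Hessian at \<open>\<gamma> s\<close> minus the Hessian
  at \<open>x\<close>. The Lipschitz hypothesis for \<open>s \<Delta>x\<close> and the Cauchy-Schwarz inequality bound this by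
  \<open>L s \<parallel>\<Delta>x\<parallel>\<^sup>3\<close>. Integrating twice, by monotonicity arguments that do not require \<open>\<phi>''\<close> to be
  integrable (\<open>taylor2_lipschitz\<close>), yields the constant \<open>L / 6\<close>.

  Most of the work is to show that the descriptions in the definitions have a unique solution. The
  Christoffel symbols exist and are unique by the Koszul formula (\<open>levi_civita_exists\<close>,
  \<open>levi_civita_unique\<close>), and uniqueness also gives their transformation law
  (\<open>levi_civita_transform\<close>), by which covariant derivatives along a curve may be computed in any
  chart (\<open>cov_deriv_along_iff\<close>). The exponential map is determined because two geodesics with the
  same initial data agree (\<open>geodesic_unique\<close>): in a chart they solve an ordinary differential
  equation whose right-hand side is locally Lipschitz, and the local statement is propagated along the
  interval by bisection. Parallel fields with a given initial value exist on short intervals by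
  Picard's theorem and on the whole interval by gluing (\<open>parallel_exists_from_start\<close>). They are unique
  without any theory of differential equations, because the length of a parallel field is constant. So
  parallel transport is a linear isometry, \<open>T\<close> is linear, and the supremum that defines its operator
  norm is taken over a bounded set (\<open>tnorm_le_opnorm\<close>).
\<close>

section \<open>Differential calculus\<close>

lemma has_derivative_frechet:
  "f differentiable net \<Longrightarrow> (f has_derivative frechet_derivative f net) net"
  by (simp add: frechet_derivative_works)

lemma frechet_derivative_eqI:
  "(f has_derivative f') (at x) \<Longrightarrow> frechet_derivative f (at x) = f'"
  using frechet_derivative_at by metis

lemma has_vector_derivative_transform_eventually:
  assumes "(f has_vector_derivative f') (at x within s)"
    and "\<forall>\<^sub>F x' in at x within s. f x' = g x'" and "f x = g x" and "x \<in> s"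
  shows "(g has_vector_derivative f') (at x within s)"
  using assms unfolding has_vector_derivative_def by (rule has_derivative_transform_eventually)

lemma has_vector_derivative_compose:
  assumes "(g has_derivative g') (at (f t))" "(f has_vector_derivative v) (at t within I)"
  shows "((\<lambda>s. g (f s)) has_vector_derivative g' v) (at t within I)"
  using vector_derivative_diff_chain_within[OF assms(2) has_derivative_at_withinI[OF assms(1)]]
  by (simp add: o_def)

lemma has_vector_derivative_Un:
  assumes "(f has_vector_derivative f') (at x within S)" "(f has_vector_derivative f') (at x within T)"
  shows "(f has_vector_derivative f') (at x within S \<union> T)"
  using assms unfolding has_vector_derivative_def has_derivative_within
  by (auto intro: Lim_Un)

lemma has_vector_derivative_not_limit:
  assumes "x \<notin> S" "closed S"
  shows "(f has_vector_derivative f') (at x within S)"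
proof -
  have "at x within S = bot" using assms by (auto simp: trivial_limit_within closed_limpt)
  then show ?thesis
    unfolding has_vector_derivative_def has_derivative_within
    by (simp add: bounded_linear_scaleR_left)
qed

lemma linear_euclidean_expansion:
  fixes f :: "'e::euclidean_space \<Rightarrow> 'b::real_vector"
  assumes "linear f"
  shows "f x = (\<Sum>b\<in>Basis. (x \<bullet> b) *\<^sub>R f b)"
proof -
  have "f x = f (\<Sum>b\<in>Basis. (x \<bullet> b) *\<^sub>R b)" by (simp add: euclidean_representation)
  also have "\<dots> = (\<Sum>b\<in>Basis. (x \<bullet> b) *\<^sub>R f b)"
    using assms by (simp add: linear_sum linear_cmul)
  finally show ?thesis .
qed

lemma bilinear_euclidean_expansion:
  fixes h :: "'e::euclidean_space \<Rightarrow> 'e \<Rightarrow> 'b::real_vector"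
  assumes "bilinear h"
  shows "h x y = (\<Sum>i\<in>Basis. \<Sum>j\<in>Basis. ((x \<bullet> i) * (y \<bullet> j)) *\<^sub>R h i j)"
proof -
  have 1: "linear (\<lambda>x. h x y)" and 2: "linear (h i)" for i
    using assms by (auto simp: bilinear_def)
  have "h x y = (\<Sum>i\<in>Basis. (x \<bullet> i) *\<^sub>R h i y)" by (rule linear_euclidean_expansion[OF 1])
  also have "\<dots> = (\<Sum>i\<in>Basis. (x \<bullet> i) *\<^sub>R (\<Sum>j\<in>Basis. (y \<bullet> j) *\<^sub>R h i j))"
    by (rule sum.cong[OF refl]) (simp only: linear_euclidean_expansion[OF 2, of _ y])
  finally show ?thesis by (simp add: scaleR_sum_right)
qed

text \<open>The product rule for a time-dependent linear map applied to a time-dependent vector. Only the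
  values of the linear map on fixed vectors have to be differentiable.\<close>

lemma has_vector_derivative_linear_family:
  fixes F :: "real \<Rightarrow> 'e::euclidean_space \<Rightarrow> 'b::real_normed_vector"
  assumes ev: "\<forall>\<^sub>F s in at t within I. linear (F s)" and lin: "linear (F t)" and t: "t \<in> I"
    and F': "\<And>b. b \<in> Basis \<Longrightarrow> ((\<lambda>s. F s b) has_vector_derivative F' b) (at t within I)"
    and lin': "linear F'"
    and Z: "(Z has_vector_derivative Z') (at t within I)"
  shows "((\<lambda>s. F s (Z s)) has_vector_derivative (F' (Z t) + F t Z')) (at t within I)"
proof -
  have Zb: "((\<lambda>s. Z s \<bullet> b) has_real_derivative Z' \<bullet> b) (at t within I)" for b
    using bounded_linear.has_vector_derivative[OF bounded_linear_inner_left Z]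
    by (simp add: has_real_derivative_iff_has_vector_derivative)
  have "((\<lambda>s. \<Sum>b\<in>Basis. (Z s \<bullet> b) *\<^sub>R F s b) has_vector_derivative
      (\<Sum>b\<in>Basis. (Z t \<bullet> b) *\<^sub>R F' b + (Z' \<bullet> b) *\<^sub>R F t b)) (at t within I)"
    by (intro has_vector_derivative_sum has_vector_derivative_scaleR Zb F')
  moreover have "(\<Sum>b\<in>Basis. (Z t \<bullet> b) *\<^sub>R F' b + (Z' \<bullet> b) *\<^sub>R F t b) = F' (Z t) + F t Z'"
    by (simp add: sum.distrib linear_euclidean_expansion[OF lin', of "Z t"]
        linear_euclidean_expansion[OF lin, of Z'])
  ultimately have "((\<lambda>s. \<Sum>b\<in>Basis. (Z s \<bullet> b) *\<^sub>R F s b) has_vector_derivative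
      F' (Z t) + F t Z') (at t within I)" by simp
  then show ?thesis
  proof (rule has_vector_derivative_transform_eventually[OF _ _ _ t])
    show "\<forall>\<^sub>F s in at t within I. (\<Sum>b\<in>Basis. (Z s \<bullet> b) *\<^sub>R F s b) = F s (Z s)"
      using ev by eventually_elim (rule linear_euclidean_expansion[symmetric])
    show "(\<Sum>b\<in>Basis. (Z t \<bullet> b) *\<^sub>R F t b) = F t (Z t)"
      using lin by (rule linear_euclidean_expansion[symmetric])
  qed
qed

lemma linear_frechet_derivative_parameter:
  fixes F :: "'a::real_normed_vector \<Rightarrow> 'c::real_vector \<Rightarrow> 'b::real_normed_vector"
  assumes W: "open W" "y \<in> W"
    and lin: "\<And>z. z \<in> W \<Longrightarrow> linear (F z)"
    and diff: "\<And>a. (\<lambda>z. F z a) differentiable (at y)"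
  shows "linear (\<lambda>a. frechet_derivative (\<lambda>z. F z a) (at y) d)"
proof (rule linearI)
  fix a b
  have "((\<lambda>z. F z a + F z b) has_derivative
      (\<lambda>d. frechet_derivative (\<lambda>z. F z a) (at y) d + frechet_derivative (\<lambda>z. F z b) (at y) d)) (at y)"
    by (intro has_derivative_add has_derivative_frechet diff)
  then have "((\<lambda>z. F z (a + b)) has_derivative
      (\<lambda>d. frechet_derivative (\<lambda>z. F z a) (at y) d + frechet_derivative (\<lambda>z. F z b) (at y) d)) (at y)"
    by (rule has_derivative_transform_within_open[OF _ W]) (simp add: lin linear_add)
  from frechet_derivative_eqI[OF this]
  show "frechet_derivative (\<lambda>z. F z (a + b)) (at y) d =
      frechet_derivative (\<lambda>z. F z a) (at y) d + frechet_derivative (\<lambda>z. F z b) (at y) d" by simp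
next
  fix r a
  have "((\<lambda>z. r *\<^sub>R F z a) has_derivative
      (\<lambda>d. r *\<^sub>R frechet_derivative (\<lambda>z. F z a) (at y) d)) (at y)"
    by (intro has_derivative_scaleR_right has_derivative_frechet diff)
  then have "((\<lambda>z. F z (r *\<^sub>R a)) has_derivative
      (\<lambda>d. r *\<^sub>R frechet_derivative (\<lambda>z. F z a) (at y) d)) (at y)"
    by (rule has_derivative_transform_within_open[OF _ W]) (simp add: lin linear_cmul)
  from frechet_derivative_eqI[OF this]
  show "frechet_derivative (\<lambda>z. F z (r *\<^sub>R a)) (at y) d =
      r *\<^sub>R frechet_derivative (\<lambda>z. F z a) (at y) d" by simp
qed

lemma has_vector_derivative_linear_along:
  fixes F :: "'a::real_normed_vector \<Rightarrow> 'e::euclidean_space \<Rightarrow> 'b::real_normed_vector"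
  assumes W: "open W" "y t \<in> W" and t: "t \<in> I"
    and lin: "\<And>z. z \<in> W \<Longrightarrow> linear (F z)"
    and diff: "\<And>a. (\<lambda>z. F z a) differentiable (at (y t))"
    and y: "(y has_vector_derivative y') (at t within I)"
    and Z: "(Z has_vector_derivative Z') (at t within I)"
  shows "((\<lambda>s. F (y s) (Z s)) has_vector_derivative
      (frechet_derivative (\<lambda>z. F z (Z t)) (at (y t)) y' + F (y t) Z')) (at t within I)"
proof (rule has_vector_derivative_linear_family[where F="\<lambda>s. F (y s)"
      and F'="\<lambda>a. frechet_derivative (\<lambda>z. F z a) (at (y t)) y'", OF _ _ t _ _ Z])
  have "(y \<longlongrightarrow> y t) (at t within I)"
    using has_vector_derivative_continuous[OF y] by (simp add: continuous_within)
  then have "\<forall>\<^sub>F s in at t within I. y s \<in> W"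
    using W by (rule topological_tendstoD)
  then show "\<forall>\<^sub>F s in at t within I. linear (F (y s))"
    by eventually_elim (rule lin)
  show "linear (F (y t))" using W lin by blast
  show "linear (\<lambda>a. frechet_derivative (\<lambda>z. F z a) (at (y t)) y')"
    by (rule linear_frechet_derivative_parameter[OF W lin diff])
  show "((\<lambda>s. F (y s) b) has_vector_derivative
      frechet_derivative (\<lambda>z. F z b) (at (y t)) y') (at t within I)" for b
    by (rule has_vector_derivative_compose[OF has_derivative_frechet[OF diff] y])
qed

lemma has_vector_derivative_bilinear_along:
  fixes g :: "'a::real_normed_vector \<Rightarrow> 'e::euclidean_space \<Rightarrow> 'e \<Rightarrow> 'b::real_normed_vector"
  assumes W: "open W" "y t \<in> W" and t: "t \<in> I"
    and bil: "\<And>z. z \<in> W \<Longrightarrow> bilinear (g z)"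
    and diff: "\<And>a b. (\<lambda>z. g z a b) differentiable (at (y t))"
    and y: "(y has_vector_derivative y') (at t within I)"
    and Z: "(Z has_vector_derivative Z') (at t within I)"
    and X: "(X has_vector_derivative X') (at t within I)"
  shows "((\<lambda>s. g (y s) (Z s) (X s)) has_vector_derivative
      (frechet_derivative (\<lambda>z. g z (Z t) (X t)) (at (y t)) y'
        + g (y t) Z' (X t) + g (y t) (Z t) X')) (at t within I)"
proof -
  have lin1: "linear (\<lambda>a. g z a b)" and lin2: "linear (\<lambda>b. g z a b)" if "z \<in> W" for z a b
    using bil[OF that] by (auto simp: bilinear_def)
  have "(y \<longlongrightarrow> y t) (at t within I)"
    using has_vector_derivative_continuous[OF y] by (simp add: continuous_within)
  then have ev: "\<forall>\<^sub>F s in at t within I. y s \<in> W"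
    using W by (rule topological_tendstoD)
  define F' where "F' b = frechet_derivative (\<lambda>z. g z (Z t) b) (at (y t)) y' + g (y t) Z' b" for b
  have "((\<lambda>s. g (y s) (Z s) (X s)) has_vector_derivative (F' (X t) + g (y t) (Z t) X'))
      (at t within I)"
  proof (rule has_vector_derivative_linear_family[OF _ _ t _ _ X])
    show "\<forall>\<^sub>F s in at t within I. linear (g (y s) (Z s))"
      using ev by eventually_elim (simp add: lin2)
    show "linear (g (y t) (Z t))" using W lin2 by blast
    show "((\<lambda>s. g (y s) (Z s) b) has_vector_derivative F' b) (at t within I)" for b
      unfolding F'_def
      by (rule has_vector_derivative_linear_along[where F="\<lambda>z a. g z a b", OF W t _ diff y Z])
        (rule lin1)
    have "linear (\<lambda>b. frechet_derivative (\<lambda>z. g z (Z t) b) (at (y t)) y')"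
      by (rule linear_frechet_derivative_parameter[OF W lin2 diff])
    then show "linear F'"
      unfolding F'_def using lin2[OF W(2)] by (intro linear_compose_add)
  qed
  then show ?thesis by (simp add: F'_def)
qed

text \<open>Schwarz's theorem. The second difference quotient \<open>\<Delta>(h) / h\<^sup>2\<close> is symmetric in the two
  directions, and by two applications of the mean value theorem it tends to either of the
  iterated derivatives.\<close>

lemma second_difference_tendsto:
  fixes f :: "'a::real_normed_vector \<Rightarrow> 'b::real_inner"
  assumes S: "open S" "y \<in> S"
    and d1: "\<And>x. x \<in> S \<Longrightarrow> f differentiable (at x)"
    and d2: "\<And>x. x \<in> S \<Longrightarrow> (\<lambda>x. frechet_derivative f (at x) u) differentiable (at x)"
    and cont: "continuous_on S
      (\<lambda>x. frechet_derivative (\<lambda>x. frechet_derivative f (at x) u) (at x) v)"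
  shows "((\<lambda>h. ((f (y + h *\<^sub>R u + h *\<^sub>R v) - f (y + h *\<^sub>R u) - f (y + h *\<^sub>R v) + f y) \<bullet> c) / h\<^sup>2)
    \<longlongrightarrow> frechet_derivative (\<lambda>x. frechet_derivative f (at x) u) (at y) v \<bullet> c) (at_right 0)"
proof (rule tendstoI)
  fix e :: real assume "e > 0"
  define D where "D x = frechet_derivative (\<lambda>x. frechet_derivative f (at x) u) (at x) v \<bullet> c" for x
  have line: "((\<lambda>s. k (p + s *\<^sub>R w) \<bullet> c) has_real_derivative
      (frechet_derivative k (at (p + s *\<^sub>R w)) w \<bullet> c)) (at s)"
    if "k differentiable (at (p + s *\<^sub>R w))" for k :: "'a \<Rightarrow> 'b" and p w s
  proof -
    have "((\<lambda>s. p + s *\<^sub>R w) has_vector_derivative w) (at s)"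
      by (auto intro!: derivative_eq_intros)
    from has_vector_derivative_compose[OF has_derivative_frechet[OF that] this]
    have "((\<lambda>s. k (p + s *\<^sub>R w)) has_vector_derivative frechet_derivative k (at (p + s *\<^sub>R w)) w) (at s)" .
    from bounded_linear.has_vector_derivative[OF bounded_linear_inner_left this]
    show ?thesis by (simp add: has_real_derivative_iff_has_vector_derivative)
  qed
  have "continuous_on S D" unfolding D_def by (intro continuous_intros cont)
  then have "(D \<longlongrightarrow> D y) (at y)"
    using S by (simp add: continuous_on_eq_continuous_at continuous_at)
  then have "\<forall>\<^sub>F x in nhds y. x \<in> S \<and> dist (D x) (D y) < e"
    using \<open>e > 0\<close> S by (intro eventually_conj eventually_nhds_in_open)
      (auto simp: tendsto_iff eventually_nhds_conv_at)
  then obtain r where r: "r > 0" "\<And>x. dist x y < r \<Longrightarrow> x \<in> S \<and> dist (D x) (D y) < e"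
    by (auto simp: eventually_nhds_metric)
  define \<delta> where "\<delta> = r / (norm u + norm v + 1)"
  have \<delta>: "\<delta> > 0" using r(1) by (auto simp: \<delta>_def intro!: divide_pos_pos add_nonneg_pos)
  have near: "dist (y + s *\<^sub>R u + t *\<^sub>R v) y < r" if "0 \<le> s" "s < \<delta>" "0 \<le> t" "t < \<delta>" for s t
  proof -
    have "dist (y + s *\<^sub>R u + t *\<^sub>R v) y = norm (s *\<^sub>R u + t *\<^sub>R v)" by (simp add: dist_norm)
    also have "\<dots> \<le> s * norm u + t * norm v"
      using that norm_triangle_ineq[of "s *\<^sub>R u" "t *\<^sub>R v"] by simp
    also have "\<dots> \<le> \<delta> * norm u + \<delta> * norm v"
      using that by (intro add_mono mult_right_mono) auto
    also have "\<dots> < \<delta> * (norm u + norm v + 1)" using \<delta> by (simp add: algebra_simps)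
    also have "\<dots> = r"
      unfolding \<delta>_def using norm_ge_zero[of u] norm_ge_zero[of v] by (simp add: add_nonneg_eq_0_iff)
    finally show ?thesis .
  qed
  have "dist (((f (y + h *\<^sub>R u + h *\<^sub>R v) - f (y + h *\<^sub>R u) - f (y + h *\<^sub>R v) + f y) \<bullet> c) / h\<^sup>2) (D y) < e"
    if h: "0 < h" "h < \<delta>" for h
  proof -
    let ?\<psi> = "\<lambda>s. f ((y + h *\<^sub>R v) + s *\<^sub>R u) \<bullet> c - f (y + s *\<^sub>R u) \<bullet> c"
    let ?\<psi>' = "\<lambda>s. frechet_derivative f (at ((y + h *\<^sub>R v) + s *\<^sub>R u)) u \<bullet> c
        - frechet_derivative f (at (y + s *\<^sub>R u)) u \<bullet> c"
    have "DERIV ?\<psi> s :> ?\<psi>' s" if "0 \<le> s" "s \<le> h" for s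
    proof (intro DERIV_diff line d1)
      show "(y + h *\<^sub>R v) + s *\<^sub>R u \<in> S" using near[of s h] r h that by (simp add: algebra_simps)
      show "y + s *\<^sub>R u \<in> S" using near[of s 0] r h that by simp
    qed
    from MVT2[OF h(1) this] obtain s where s: "0 < s" "s < h" "?\<psi> h - ?\<psi> 0 = h * ?\<psi>' s"
      by auto
    let ?\<chi> = "\<lambda>t. frechet_derivative f (at ((y + s *\<^sub>R u) + t *\<^sub>R v)) u \<bullet> c"
    have "DERIV ?\<chi> t :> D ((y + s *\<^sub>R u) + t *\<^sub>R v)" if "0 \<le> t" "t \<le> h" for t
      unfolding D_def
    proof (rule line[of "\<lambda>x. frechet_derivative f (at x) u"], rule d2)
      show "(y + s *\<^sub>R u) + t *\<^sub>R v \<in> S" using near[of s t] r h s that by simp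
    qed
    from MVT2[OF h(1) this] obtain t where t: "0 < t" "t < h"
      "?\<chi> h - ?\<chi> 0 = h * D ((y + s *\<^sub>R u) + t *\<^sub>R v)" by auto
    have "?\<psi>' s = ?\<chi> h - ?\<chi> 0" by (simp add: algebra_simps)
    with s t have "?\<psi> h - ?\<psi> 0 = h\<^sup>2 * D (y + s *\<^sub>R u + t *\<^sub>R v)"
      by (simp add: power2_eq_square)
    moreover have "?\<psi> h - ?\<psi> 0 = (f (y + h *\<^sub>R u + h *\<^sub>R v) - f (y + h *\<^sub>R u) - f (y + h *\<^sub>R v) + f y) \<bullet> c"
      by (simp add: algebra_simps inner_diff_left inner_add_left)
    ultimately have "((f (y + h *\<^sub>R u + h *\<^sub>R v) - f (y + h *\<^sub>R u) - f (y + h *\<^sub>R v) + f y) \<bullet> c) / h\<^sup>2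
        = D (y + s *\<^sub>R u + t *\<^sub>R v)"
      using h by (metis nonzero_mult_div_cancel_left power_not_zero less_irrefl)
    then show ?thesis using r(2)[OF near[of s t]] s t h by simp
  qed
  then show "\<forall>\<^sub>F h in at_right 0. dist (((f (y + h *\<^sub>R u + h *\<^sub>R v) - f (y + h *\<^sub>R u) - f (y + h *\<^sub>R v) + f y) \<bullet> c) / h\<^sup>2)
      (frechet_derivative (\<lambda>x. frechet_derivative f (at x) u) (at y) v \<bullet> c) < e"
    unfolding D_def[symmetric] eventually_at_right_field using \<delta> by (intro exI[of _ \<delta>]) simp
qed

lemma frechet_derivative_commute:
  fixes f :: "'a::real_normed_vector \<Rightarrow> 'b::real_inner"
  assumes S: "open S" "y \<in> S" and C2: "Ck_on (Suc (Suc 0)) S f"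
  shows "frechet_derivative (\<lambda>x. frechet_derivative f (at x) u) (at y) v
       = frechet_derivative (\<lambda>x. frechet_derivative f (at x) v) (at y) u"
proof -
  let ?D = "\<lambda>u v. frechet_derivative (\<lambda>x. frechet_derivative f (at x) u) (at y) v"
  let ?q = "\<lambda>u v c h. ((f (y + h *\<^sub>R u + h *\<^sub>R v) - f (y + h *\<^sub>R u) - f (y + h *\<^sub>R v) + f y) \<bullet> c) / h\<^sup>2"
  have lim: "(?q u v c \<longlongrightarrow> ?D u v \<bullet> c) (at_right 0)" for u v c
    using C2 by (intro second_difference_tendsto[OF S]) simp_all
  have "?q v u c = ?q u v c" for c
  proof
    show "?q v u c h = ?q u v c h" for h
      by (simp only: add.assoc add.commute[of "h *\<^sub>R v"] diff_diff_eq add.commute[of "f (y + h *\<^sub>R v)"])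
  qed
  then have "(?q u v c \<longlongrightarrow> ?D v u \<bullet> c) (at_right 0)" for c
    using lim[where u=v and v=u and c=c] by (simp only:)
  then have "?D u v \<bullet> c = ?D v u \<bullet> c" for c
    by (rule tendsto_unique[OF trivial_limit_at_right_real lim])
  then show ?thesis by (metis vector_eq_rdot)
qed

section \<open>Local Lipschitz continuity\<close>

text \<open>\<open>f\<close> is Lipschitz continuous on some neighbourhood of \<open>y0\<close>. The filter formulation spares the
  choice of radii when several such functions are combined.\<close>

definition lipschitz_near :: "('a::real_normed_vector \<Rightarrow> 'b::real_normed_vector) \<Rightarrow> 'a \<Rightarrow> bool" where
  "lipschitz_near f y0 \<longleftrightarrow>
    (\<exists>K. \<forall>\<^sub>F (y, z) in nhds y0 \<times>\<^sub>F nhds y0. norm (f y - f z) \<le> K * norm (y - z))"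

lemma lipschitz_nearE:
  assumes "lipschitz_near f y0"
  obtains K where "K \<ge> 0" "\<forall>\<^sub>F (y, z) in nhds y0 \<times>\<^sub>F nhds y0. norm (f y - f z) \<le> K * norm (y - z)"
proof -
  obtain K where K: "\<forall>\<^sub>F (y, z) in nhds y0 \<times>\<^sub>F nhds y0. norm (f y - f z) \<le> K * norm (y - z)"
    using assms unfolding lipschitz_near_def by blast
  have "\<forall>\<^sub>F (y, z) in nhds y0 \<times>\<^sub>F nhds y0. norm (f y - f z) \<le> \<bar>K\<bar> * norm (y - z)"
    using K
  proof (rule eventually_mono, clarify)
    fix y z assume "norm (f y - f z) \<le> K * norm (y - z)"
    also have "\<dots> \<le> \<bar>K\<bar> * norm (y - z)" by (intro mult_right_mono) auto
    finally show "norm (f y - f z) \<le> \<bar>K\<bar> * norm (y - z)" .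
  qed
  then show thesis using that abs_ge_zero by blast
qed

lemma lipschitz_near_nhdE:
  assumes "lipschitz_near f y0"
  obtains K Q where "eventually Q (nhds y0)"
    "\<And>y z. Q y \<Longrightarrow> Q z \<Longrightarrow> norm (f y - f z) \<le> K * norm (y - z)"
  using assms unfolding lipschitz_near_def eventually_prod_same by auto

lemma lipschitz_near_tendsto:
  assumes "lipschitz_near f y0"
  shows "(f \<longlongrightarrow> f y0) (nhds y0)"
proof -
  obtain K Q where K: "eventually Q (nhds y0)"
    "\<And>y z. Q y \<Longrightarrow> Q z \<Longrightarrow> norm (f y - f z) \<le> K * norm (y - z)"
    using assms unfolding lipschitz_near_def eventually_prod_same by auto
  have "Q y0" using K(1) by (rule eventually_nhds_x_imp_x)
  have "((\<lambda>y. K * norm (y - y0)) \<longlongrightarrow> K * norm (y0 - y0)) (nhds y0)"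
    by (intro tendsto_intros filterlim_ident)
  then have lim: "((\<lambda>y. K * norm (y - y0)) \<longlongrightarrow> 0) (nhds y0)" by simp
  have "\<forall>\<^sub>F y in nhds y0. norm (f y - f y0) \<le> K * norm (y - y0)"
    using K(1) by eventually_elim (auto intro: K(2) \<open>Q y0\<close>)
  then have "((\<lambda>y. f y - f y0) \<longlongrightarrow> 0) (nhds y0)"
    by (rule Lim_null_comparison[OF _ lim])
  then show ?thesis by (simp add: LIM_zero_iff)
qed

lemma lipschitz_near_bounded:
  assumes "lipschitz_near f y0"
  shows "\<forall>\<^sub>F y in nhds y0. norm (f y) \<le> norm (f y0) + 1"
proof -
  have "\<forall>\<^sub>F y in nhds y0. dist (f y) (f y0) < 1"
    using lipschitz_near_tendsto[OF assms] by (rule tendstoD) simp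
  then show ?thesis
  proof eventually_elim
    case (elim y)
    then show ?case using norm_triangle_sub[of "f y" "f y0"] by (simp add: dist_norm)
  qed
qed

lemma eventually_prod_both:
  assumes "eventually P F"
  shows "eventually (\<lambda>(x, y). P x \<and> P y) (F \<times>\<^sub>F F)"
  using assms unfolding eventually_prod_same by auto

lemma lipschitz_near_cong:
  assumes "lipschitz_near f y0" "\<forall>\<^sub>F y in nhds y0. f y = g y"
  shows "lipschitz_near g y0"
proof -
  obtain K where K: "\<forall>\<^sub>F (y, z) in nhds y0 \<times>\<^sub>F nhds y0. norm (f y - f z) \<le> K * norm (y - z)"
    using assms unfolding lipschitz_near_def by blast
  with eventually_prod_both[OF assms(2)]
  have "\<forall>\<^sub>F (y, z) in nhds y0 \<times>\<^sub>F nhds y0. norm (g y - g z) \<le> K * norm (y - z)"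
    by eventually_elim auto
  then show ?thesis unfolding lipschitz_near_def by blast
qed

lemma lipschitz_near_bounded_linear:
  assumes "bounded_linear f"
  shows "lipschitz_near f y0"
proof -
  interpret bounded_linear f by fact
  obtain K where "\<And>x. norm (f x) \<le> norm x * K" using bounded by blast
  then show ?thesis
    unfolding lipschitz_near_def
    by (intro exI[of _ K] always_eventually) (auto simp: diff[symmetric] mult.commute)
qed

lemma lipschitz_near_const: "lipschitz_near (\<lambda>y. c) y0"
  unfolding lipschitz_near_def by (intro exI[of _ 0] always_eventually) auto

lemma lipschitz_near_add:
  assumes "lipschitz_near f y0" "lipschitz_near g y0"
  shows "lipschitz_near (\<lambda>y. f y + g y) y0"
proof -
  obtain K L where
    "\<forall>\<^sub>F (y, z) in nhds y0 \<times>\<^sub>F nhds y0. norm (f y - f z) \<le> K * norm (y - z)"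
    "\<forall>\<^sub>F (y, z) in nhds y0 \<times>\<^sub>F nhds y0. norm (g y - g z) \<le> L * norm (y - z)"
    using assms unfolding lipschitz_near_def by blast
  then have "\<forall>\<^sub>F (y, z) in nhds y0 \<times>\<^sub>F nhds y0. norm (f y + g y - (f z + g z)) \<le> (K + L) * norm (y - z)"
  proof eventually_elim
    case (elim p)
    then show ?case
      using norm_triangle_ineq[of "f (fst p) - f (snd p)" "g (fst p) - g (snd p)"]
      by (auto simp: distrib_right add_diff_add split: prod.splits)
  qed
  then show ?thesis unfolding lipschitz_near_def by blast
qed

lemma lipschitz_near_sum:
  assumes "\<And>i. i \<in> A \<Longrightarrow> lipschitz_near (f i) y0"
  shows "lipschitz_near (\<lambda>y. \<Sum>i\<in>A. f i y) y0"
proof (cases "finite A")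
  case True
  then show ?thesis using assms
    by (induction A rule: finite_induct) (auto intro: lipschitz_near_const lipschitz_near_add)
qed (simp add: lipschitz_near_const)

lemma lipschitz_near_scaleR:
  fixes f :: "'a::real_normed_vector \<Rightarrow> real"
  assumes f: "lipschitz_near f y0" and g: "lipschitz_near g y0"
  shows "lipschitz_near (\<lambda>y. f y *\<^sub>R g y) y0"
proof -
  from f obtain K where K: "K \<ge> 0"
    "\<forall>\<^sub>F (y, z) in nhds y0 \<times>\<^sub>F nhds y0. norm (f y - f z) \<le> K * norm (y - z)" by (rule lipschitz_nearE)
  from g obtain L where L: "L \<ge> 0"
    "\<forall>\<^sub>F (y, z) in nhds y0 \<times>\<^sub>F nhds y0. norm (g y - g z) \<le> L * norm (y - z)" by (rule lipschitz_nearE)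
  define C where "C = (norm (f y0) + 1) * L + K * (norm (g y0) + 1)"
  have "\<forall>\<^sub>F (y, z) in nhds y0 \<times>\<^sub>F nhds y0. norm (f y *\<^sub>R g y - f z *\<^sub>R g z) \<le> C * norm (y - z)"
    using K(2) L(2) eventually_prod_both[OF lipschitz_near_bounded[OF f]]
      eventually_prod_both[OF lipschitz_near_bounded[OF g]]
  proof eventually_elim
    case (elim p)
    obtain y z where p: "p = (y, z)" by fastforce
    have "norm (f y *\<^sub>R g y - f z *\<^sub>R g z) = norm (f y *\<^sub>R (g y - g z) + (f y - f z) *\<^sub>R g z)"
      by (simp add: algebra_simps)
    also have "\<dots> \<le> norm (f y) * norm (g y - g z) + norm (f y - f z) * norm (g z)"
      using norm_triangle_ineq[of "f y *\<^sub>R (g y - g z)" "(f y - f z) *\<^sub>R g z"] by simp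
    also have "\<dots> \<le> (norm (f y0) + 1) * (L * norm (y - z)) + (K * norm (y - z)) * (norm (g y0) + 1)"
      using elim K(1) L(1) by (intro add_mono mult_mono) (auto simp: p)
    also have "\<dots> = C * norm (y - z)" by (simp add: C_def algebra_simps)
    finally show ?case by (simp add: p)
  qed
  then show ?thesis unfolding lipschitz_near_def by blast
qed

lemma lipschitz_near_compose:
  assumes f: "lipschitz_near f y0" and g: "lipschitz_near g (f y0)"
  shows "lipschitz_near (\<lambda>y. g (f y)) y0"
proof -
  from f obtain K where K: "K \<ge> 0"
    "\<forall>\<^sub>F (y, z) in nhds y0 \<times>\<^sub>F nhds y0. norm (f y - f z) \<le> K * norm (y - z)" by (rule lipschitz_nearE)
  from g obtain L where L: "L \<ge> 0"
    "\<forall>\<^sub>F (y, z) in nhds (f y0) \<times>\<^sub>F nhds (f y0). norm (g y - g z) \<le> L * norm (y - z)"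
    by (rule lipschitz_nearE)
  from L(2) obtain Q where Q: "eventually Q (nhds (f y0))"
    "\<And>y z. Q y \<Longrightarrow> Q z \<Longrightarrow> norm (g y - g z) \<le> L * norm (y - z)"
    unfolding eventually_prod_same by auto
  have "\<forall>\<^sub>F y in nhds y0. Q (f y)"
    using lipschitz_near_tendsto[OF f] Q(1) by (simp add: filterlim_iff)
  from K(2) eventually_prod_both[OF this]
  have "\<forall>\<^sub>F (y, z) in nhds y0 \<times>\<^sub>F nhds y0. norm (g (f y) - g (f z)) \<le> (L * K) * norm (y - z)"
  proof eventually_elim
    case (elim p)
    obtain y z where p: "p = (y, z)" by fastforce
    have "norm (g (f y) - g (f z)) \<le> L * norm (f y - f z)" using elim Q(2) by (auto simp: p)
    also have "\<dots> \<le> L * (K * norm (y - z))" using elim L(1) by (intro mult_left_mono) (auto simp: p)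
    finally show ?case by (simp add: p mult.assoc)
  qed
  then show ?thesis unfolding lipschitz_near_def by blast
qed

lemma lipschitz_near_Pair:
  assumes "lipschitz_near f y0" "lipschitz_near g y0"
  shows "lipschitz_near (\<lambda>y. (f y, g y)) y0"
proof -
  have "bounded_linear (\<lambda>u::'b. (u, 0::'c))" "bounded_linear (\<lambda>u::'c. (0::'b, u))"
    by (auto intro!: bounded_linear_Pair bounded_linear_ident bounded_linear_zero)
  then have "lipschitz_near (\<lambda>y. (f y, 0::'c) + (0::'b, g y)) y0"
    by (intro lipschitz_near_add lipschitz_near_compose[OF assms(1)] lipschitz_near_compose[OF assms(2)]
        lipschitz_near_bounded_linear)
  then show ?thesis by simp
qed

lemma lipschitz_near_C1:
  fixes f :: "'e::euclidean_space \<Rightarrow> 'b::real_normed_vector"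
  assumes S: "open S" "y0 \<in> S" and C1: "Ck_on (Suc 0) S f"
  shows "lipschitz_near f y0"
proof -
  from S obtain r where r: "r > 0" "cball y0 r \<subseteq> S" by (meson open_contains_cball)
  have diff: "(f has_derivative frechet_derivative f (at x)) (at x)" if "x \<in> S" for x
    using C1 that by (simp add: has_derivative_frechet)
  have "continuous_on (cball y0 r) (\<lambda>x. \<Sum>b\<in>Basis. norm (frechet_derivative f (at x) b))"
    using C1 r(2) by (intro continuous_intros) (auto intro: continuous_on_subset)
  then have "bounded ((\<lambda>x. \<Sum>b\<in>Basis. norm (frechet_derivative f (at x) b)) ` cball y0 r)"
    by (intro compact_imp_bounded compact_continuous_image) auto
  then obtain B where B: "\<And>x. x \<in> cball y0 r \<Longrightarrow> (\<Sum>b\<in>Basis. norm (frechet_derivative f (at x) b)) \<le> B"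
    unfolding bounded_iff by (metis abs_le_D1 image_eqI real_norm_def)
  have lip: "norm (f y - f z) \<le> B * norm (y - z)" if "y \<in> ball y0 r" "z \<in> ball y0 r" for y z
  proof (rule differentiable_bound[of "ball y0 r" f "\<lambda>x. frechet_derivative f (at x)"])
    fix x assume x: "x \<in> ball y0 r"
    then have "x \<in> S" using r(2) by auto
    then show "(f has_derivative frechet_derivative f (at x)) (at x within ball y0 r)"
      using diff by (blast intro: has_derivative_at_withinI)
    show "onorm (frechet_derivative f (at x)) \<le> B"
      using onorm_componentwise[OF has_derivative_bounded_linear[OF diff[OF \<open>x \<in> S\<close>]]] B[of x] x
      by simp
  qed (use that in auto)
  have "\<forall>\<^sub>F y in nhds y0. y \<in> ball y0 r" using r(1) by (intro eventually_nhds_in_open) auto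
  from eventually_prod_both[OF this]
  have "\<forall>\<^sub>F (y, z) in nhds y0 \<times>\<^sub>F nhds y0. norm (f y - f z) \<le> B * norm (y - z)"
    by eventually_elim (use lip in auto)
  then show ?thesis unfolding lipschitz_near_def by blast
qed

text \<open>The solution of a linear system is Lipschitz in the coefficients and the right-hand side,
  near any point at which the system is nonsingular.\<close>

lemma lipschitz_near_linear_solution:
  fixes S :: "'a::real_normed_vector \<Rightarrow> 'e::euclidean_space \<Rightarrow> 'e"
  assumes lin: "\<forall>\<^sub>F y in nhds y0. linear (S y)" and inj: "inj (S y0)"
    and S: "\<And>b. lipschitz_near (\<lambda>y. S y b) y0" and k: "lipschitz_near k y0"
    and x: "\<forall>\<^sub>F y in nhds y0. S y (x y) = k y"
  shows "lipschitz_near x y0"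
proof -
  have lin0: "linear (S y0)" using lin by (rule eventually_nhds_x_imp_x)
  obtain m where m: "m > 0" "\<And>u. m * norm u \<le> norm (S y0 u)"
    using linear_inj_bounded_below_pos[OF lin0 inj] by blast
  have "((\<lambda>y. \<Sum>b\<in>Basis. norm (S y b - S y0 b)) \<longlongrightarrow> (\<Sum>b\<in>Basis. norm (S y0 b - S y0 b))) (nhds y0)"
    by (intro tendsto_intros lipschitz_near_tendsto S)
  then have "\<forall>\<^sub>F y in nhds y0. (\<Sum>b\<in>Basis. norm (S y b - S y0 b)) < m / 2"
    by (rule order_tendstoD) (use m in simp)
  with lin have below: "\<forall>\<^sub>F y in nhds y0. \<forall>u. m / 2 * norm u \<le> norm (S y u)"
  proof eventually_elim
    case (elim y)
    show ?case
    proof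
      fix u
      have lin': "linear (\<lambda>u. S y u - S y0 u)" using elim(1) lin0 by (rule linear_compose_sub)
      have "norm (S y u - S y0 u) = norm (\<Sum>b\<in>Basis. (u \<bullet> b) *\<^sub>R (S y b - S y0 b))"
        by (subst linear_euclidean_expansion[OF lin', of u]) simp
      also have "\<dots> \<le> (\<Sum>b\<in>Basis. norm u * norm (S y b - S y0 b))"
        by (rule order_trans[OF norm_sum sum_mono]) (simp add: Basis_le_norm mult_right_mono)
      also have "\<dots> = norm u * (\<Sum>b\<in>Basis. norm (S y b - S y0 b))" by (simp add: sum_distrib_left)
      also have "\<dots> \<le> norm u * (m / 2)" using elim(2) by (intro mult_left_mono) auto
      finally have "norm (S y u - S y0 u) \<le> norm u * (m / 2)" .
      moreover have "norm (S y0 u) \<le> norm (S y u) + norm (S y u - S y0 u)"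
        by (metis norm_minus_commute norm_triangle_sub)
      ultimately show "m / 2 * norm u \<le> norm (S y u)" using m(2)[of u] by (simp add: field_simps)
    qed
  qed
  define B where "B = (norm (k y0) + 1) / (m / 2)"
  have B0: "B \<ge> 0" using m by (simp add: B_def)
  have xB: "\<forall>\<^sub>F y in nhds y0. norm (x y) \<le> B"
    using below x lipschitz_near_bounded[OF k]
  proof eventually_elim
    case (elim y)
    then have "m / 2 * norm (x y) \<le> norm (k y0) + 1" by (metis order_trans)
    then show ?case using m by (simp add: B_def field_simps)
  qed
  obtain K where K: "K \<ge> 0"
    "\<forall>\<^sub>F (y, z) in nhds y0 \<times>\<^sub>F nhds y0. norm (k y - k z) \<le> K * norm (y - z)"
    using k by (rule lipschitz_nearE)
  have "\<forall>b. \<exists>L\<ge>0. \<forall>\<^sub>F (y, z) in nhds y0 \<times>\<^sub>F nhds y0. norm (S y b - S z b) \<le> L * norm (y - z)"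
  proof
    show "\<exists>L\<ge>0. \<forall>\<^sub>F (y, z) in nhds y0 \<times>\<^sub>F nhds y0. norm (S y b - S z b) \<le> L * norm (y - z)" for b
      using S[of b] by (rule lipschitz_nearE) blast
  qed
  from choice[OF this] obtain L where
    "\<forall>b. L b \<ge> 0 \<and> (\<forall>\<^sub>F (y, z) in nhds y0 \<times>\<^sub>F nhds y0. norm (S y b - S z b) \<le> L b * norm (y - z))"
    by (rule exE)
  then have L: "L b \<ge> 0"
    "\<forall>\<^sub>F (y, z) in nhds y0 \<times>\<^sub>F nhds y0. norm (S y b - S z b) \<le> L b * norm (y - z)" for b
    by simp_all
  have "\<forall>\<^sub>F p in nhds y0 \<times>\<^sub>F nhds y0. \<forall>b\<in>Basis. norm (S (fst p) b - S (snd p) b) \<le> L b * norm (fst p - snd p)"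
    using L(2) by (intro eventually_ball_finite) (simp_all add: case_prod_beta')
  with K(2) eventually_prod_both[OF below] eventually_prod_both[OF xB] eventually_prod_both[OF x]
    eventually_prod_both[OF lin]
  have "\<forall>\<^sub>F (y, z) in nhds y0 \<times>\<^sub>F nhds y0.
      norm (x y - x z) \<le> ((K + (\<Sum>b\<in>(Basis::'e set). B * L b)) / (m / 2)) * norm (y - z)"
  proof eventually_elim
    case (elim p)
    obtain y z where p: "p = (y, z)" by fastforce
    have ly: "linear (S y)" and lz: "linear (S z)" using elim(5) p by auto
    have lin': "linear (\<lambda>u. S y u - S z u)" using ly lz by (rule linear_compose_sub)
    have "S y (x y - x z) = k y - k z - (S y (x z) - S z (x z))"
      using elim(4) p ly by (simp add: linear_diff)
    also have "norm \<dots> \<le> norm (k y - k z) + norm (S y (x z) - S z (x z))" by (rule norm_triangle_ineq4)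
    also have "S y (x z) - S z (x z) = (\<Sum>b\<in>Basis. (x z \<bullet> b) *\<^sub>R (S y b - S z b))"
      by (rule linear_euclidean_expansion[OF lin'])
    also have "norm \<dots> \<le> (\<Sum>b\<in>Basis. B * (L b * norm (y - z)))"
    proof (rule order_trans[OF norm_sum sum_mono])
      fix b :: 'e assume b: "b \<in> Basis"
      have "\<bar>x z \<bullet> b\<bar> \<le> B" using elim(3) p Basis_le_norm[OF b, of "x z"] by auto
      moreover have "norm (S y b - S z b) \<le> L b * norm (y - z)" using elim(6) p b by auto
      ultimately show "norm ((x z \<bullet> b) *\<^sub>R (S y b - S z b)) \<le> B * (L b * norm (y - z))"
        using B0 by (auto intro!: mult_mono)
    qed
    also have "\<dots> = (\<Sum>b\<in>(Basis::'e set). B * L b) * norm (y - z)"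
      by (simp add: sum_distrib_right mult.assoc)
    finally have "norm (S y (x y - x z)) \<le> K * norm (y - z) + (\<Sum>b\<in>(Basis::'e set). B * L b) * norm (y - z)"
      using elim(1) p by auto
    moreover have "m / 2 * norm (x y - x z) \<le> norm (S y (x y - x z))" using elim(2) p by auto
    ultimately have "m / 2 * norm (x y - x z) \<le> (K + (\<Sum>b\<in>(Basis::'e set). B * L b)) * norm (y - z)"
      by (simp add: distrib_right)
    then show ?case using m by (simp add: p field_simps)
  qed
  then show ?thesis unfolding lipschitz_near_def by blast
qed

section \<open>Ordinary differential equations\<close>

lemma DERIV_within_Icc_nonpos_imp_le:
  fixes f :: "real \<Rightarrow> real"
  assumes "a \<le> b"
    and der: "\<And>x. x \<in> {a..b} \<Longrightarrow> (f has_real_derivative f' x) (at x within {a..b})"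
    and neg: "\<And>x. x \<in> {a..b} \<Longrightarrow> f' x \<le> 0"
  shows "f b \<le> f a"
proof (rule DERIV_nonpos_imp_decreasing_open[OF assms(1)])
  show "continuous_on {a..b} f"
    using der by (rule DERIV_continuous_on)
  fix x assume "a < x" "x < b"
  then have "(f has_real_derivative f' x) (at x)"
    using der[of x] by (simp add: at_within_Icc_at)
  then show "\<exists>y. (f has_real_derivative y) (at x) \<and> y \<le> 0"
    using neg[of x] \<open>a < x\<close> \<open>x < b\<close> by auto
qed

text \<open>Gronwall's inequality: \<open>u(s) exp(- C s)\<close> is nonincreasing.\<close>

lemma gronwall_nonpos:
  fixes u :: "real \<Rightarrow> real"
  assumes "a \<le> b"
    and der: "\<And>s. s \<in> {a..b} \<Longrightarrow> (u has_real_derivative u' s) (at s within {a..b})"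
    and le: "\<And>s. s \<in> {a..b} \<Longrightarrow> u' s \<le> C * u s"
    and init: "u a \<le> 0"
  shows "u b \<le> 0"
proof -
  have "u b * exp (- (C * b)) \<le> u a * exp (- (C * a))"
  proof (rule DERIV_within_Icc_nonpos_imp_le[OF assms(1)])
    fix s assume s: "s \<in> {a..b}"
    show "((\<lambda>s. u s * exp (- (C * s))) has_real_derivative
        (u' s - C * u s) * exp (- (C * s))) (at s within {a..b})"
      by (rule derivative_eq_intros der[OF s] | simp add: algebra_simps)+
    show "(u' s - C * u s) * exp (- (C * s)) \<le> 0"
      using le[OF s] by (simp add: mult_nonpos_nonneg)
  qed
  also have "\<dots> \<le> 0" using init by (simp add: mult_nonpos_nonneg)
  finally show ?thesis by (simp add: mult_le_0_iff)
qed

lemma ode_solution_unique: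
  fixes z w :: "real \<Rightarrow> 'b::real_inner"
  assumes "a \<le> b"
    and z: "\<And>s. s \<in> {a..b} \<Longrightarrow> (z has_vector_derivative F (z s)) (at s within {a..b})"
    and w: "\<And>s. s \<in> {a..b} \<Longrightarrow> (w has_vector_derivative F (w s)) (at s within {a..b})"
    and lip: "\<And>s. s \<in> {a..b} \<Longrightarrow> norm (F (z s) - F (w s)) \<le> K * norm (z s - w s)"
    and init: "z a = w a"
  shows "z b = w b"
proof -
  let ?u = "\<lambda>s. (z s - w s) \<bullet> (z s - w s)"
  have "?u b \<le> 0"
  proof (rule gronwall_nonpos[OF assms(1)])
    fix s assume s: "s \<in> {a..b}"
    have "((\<lambda>s. z s - w s) has_vector_derivative (F (z s) - F (w s))) (at s within {a..b})"
      using z[OF s] w[OF s] by (rule has_vector_derivative_diff)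
    from bounded_bilinear.has_vector_derivative[OF bounded_bilinear_inner this this]
    show "(?u has_real_derivative 2 * ((z s - w s) \<bullet> (F (z s) - F (w s)))) (at s within {a..b})"
      by (simp add: has_real_derivative_iff_has_vector_derivative inner_commute)
    have "(z s - w s) \<bullet> (F (z s) - F (w s)) \<le> norm (z s - w s) * norm (F (z s) - F (w s))"
      by (rule norm_cauchy_schwarz)
    also have "\<dots> \<le> norm (z s - w s) * (K * norm (z s - w s))"
      using lip[OF s] by (intro mult_left_mono) auto
    also have "\<dots> = K * ?u s" by (simp add: dot_square_norm power2_eq_square)
    finally show "2 * ((z s - w s) \<bullet> (F (z s) - F (w s))) \<le> (2 * K) * ?u s" by simp
  qed (simp add: init)
  then have "?u b = 0" by (intro antisym) auto
  then show ?thesis by simp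
qed

text \<open>A linear equation with continuous coefficients is solved on any interval so short that the
  Picard operator is a contraction. The functions on the interval are extended by constants beyond
  its endpoints, in order to apply the fixed point theorem in the Banach space of bounded continuous
  functions on the line.\<close>

lemma linear_ode_short_interval:
  fixes A :: "real \<Rightarrow> 'e::euclidean_space \<Rightarrow> 'e"
  assumes ab: "a \<le> b"
    and lin: "\<And>s. s \<in> {a..b} \<Longrightarrow> linear (A s)"
    and cont: "\<And>v. continuous_on {a..b} (\<lambda>s. A s v)"
    and M: "\<And>s v. s \<in> {a..b} \<Longrightarrow> norm (A s v) \<le> M * norm v" "0 \<le> M" "M * (b - a) \<le> 1 / 2"
  shows "\<exists>X. X a = w \<and> (\<forall>s\<in>{a..b}. (X has_vector_derivative A s (X s)) (at s within {a..b}))"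
proof -
  have cA: "continuous_on {a..b} (\<lambda>s. A s (f s))" if f: "continuous_on {a..b} f" for f
  proof -
    have "continuous_on {a..b} (\<lambda>s. \<Sum>i\<in>Basis. (f s \<bullet> i) *\<^sub>R A s i)"
      by (intro continuous_intros f cont)
    then show ?thesis
      by (rule continuous_on_eq) (rule linear_euclidean_expansion[OF lin, symmetric])
  qed
  define P where "P f t = w + integral {a..t} (\<lambda>s. A s (f s))" for f :: "real \<Rightarrow> 'e" and t
  have cP: "continuous_on {a..b} (P f)" if f: "continuous_on {a..b} f" for f
    unfolding P_def
    by (intro continuous_intros indefinite_integral_continuous_1 integrable_continuous_real cA f)
  have fC: "continuous_on {a..b} (apply_bcontfun f)" for f :: "real \<Rightarrow>\<^sub>C 'e" by simp
  have "\<exists>h::real \<Rightarrow>\<^sub>C 'e. \<forall>t. apply_bcontfun h t = P (apply_bcontfun f) (clamp a b t)" for f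
  proof -
    have "continuous_on (cbox a b) (P (apply_bcontfun f))" using cP[OF fC] by simp
    then show ?thesis
    proof (rule continuous_on_cbox_bcontfunE)
      fix h :: "real \<Rightarrow>\<^sub>C 'e"
      assume "\<And>x. apply_bcontfun h x = P (apply_bcontfun f) (clamp a b x)"
      then show ?thesis by (intro exI[of _ h] allI)
    qed
  qed
  from choice[OF allI[OF this]] obtain T :: "(real \<Rightarrow>\<^sub>C 'e) \<Rightarrow> (real \<Rightarrow>\<^sub>C 'e)" where
    "\<forall>f t. apply_bcontfun (T f) t = P (apply_bcontfun f) (clamp a b t)" by (rule exE)
  then have T: "apply_bcontfun (T f) t = P (apply_bcontfun f) (clamp a b t)" for f t by simp
  have "dist (T f) (T g) \<le> 1 / 2 * dist f g" for f g
  proof (rule dist_bound)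
    fix t
    define c where "c = clamp a b t"
    have c: "c \<in> {a..b}" using clamp_in_interval[of a b t] ab by (simp add: c_def)
    have int: "(\<lambda>s. A s (apply_bcontfun f s)) integrable_on {a..c}" for f :: "real \<Rightarrow>\<^sub>C 'e"
      using c by (intro integrable_continuous_real continuous_on_subset[OF cA[OF fC]]) auto
    have "P (apply_bcontfun f) c - P (apply_bcontfun g) c
        = integral {a..c} (\<lambda>s. A s (apply_bcontfun f s) - A s (apply_bcontfun g s))"
      by (simp add: P_def integral_diff[OF int int])
    also have "norm \<dots> \<le> (M * dist f g) * (c - a)"
    proof (rule integral_bound)
      show "continuous_on {a..c} (\<lambda>s. A s (apply_bcontfun f s) - A s (apply_bcontfun g s))"
        using c by (intro continuous_on_subset[OF continuous_on_diff[OF cA[OF fC] cA[OF fC]]]) auto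
      fix s assume "s \<in> {a..c}"
      then have s: "s \<in> {a..b}" using c by auto
      have "norm (A s (apply_bcontfun f s) - A s (apply_bcontfun g s))
          = norm (A s (apply_bcontfun f s - apply_bcontfun g s))"
        by (simp add: linear_diff[OF lin[OF s]])
      also have "\<dots> \<le> M * norm (apply_bcontfun f s - apply_bcontfun g s)" using M(1)[OF s] .
      also have "\<dots> \<le> M * dist f g"
        using dist_bounded[of f s g] M(2) by (intro mult_left_mono) (auto simp: dist_norm)
      finally show "norm (A s (apply_bcontfun f s) - A s (apply_bcontfun g s)) \<le> M * dist f g" .
    qed (use c in auto)
    also have "\<dots> \<le> (M * dist f g) * (b - a)" using c M(2) by (intro mult_left_mono) auto
    also have "\<dots> = (M * (b - a)) * dist f g" by (simp add: mult_ac)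
    also have "\<dots> \<le> 1 / 2 * dist f g" using M(3) by (intro mult_right_mono) auto
    finally show "dist (apply_bcontfun (T f) t) (apply_bcontfun (T g) t) \<le> 1 / 2 * dist f g"
      by (simp add: T c_def dist_norm)
  qed
  then have "\<exists>!f. T f = f" by (intro banach_fix_type[of "1/2"]) auto
  then obtain f where f: "T f = f" by blast
  have fP: "apply_bcontfun f t = P (apply_bcontfun f) t" if "t \<in> {a..b}" for t
    using T[of f t] that f by simp
  show ?thesis
  proof (intro exI[of _ "apply_bcontfun f"] conjI ballI)
    show "apply_bcontfun f a = w" using fP[of a] ab by (simp add: P_def)
    fix s assume s: "s \<in> {a..b}"
    have "((\<lambda>t. integral {a..t} (\<lambda>s. A s (apply_bcontfun f s))) has_vector_derivative
        A s (apply_bcontfun f s)) (at s within {a..b})"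
      by (rule integral_has_vector_derivative[OF cA[OF fC] s])
    then have "(P (apply_bcontfun f) has_vector_derivative A s (apply_bcontfun f s)) (at s within {a..b})"
      unfolding P_def by (auto intro!: derivative_eq_intros)
    then show "(apply_bcontfun f has_vector_derivative A s (apply_bcontfun f s)) (at s within {a..b})"
      by (rule has_vector_derivative_transform[OF s, rotated]) (simp add: fP)
  qed
qed

section \<open>Taylor's formula with Lipschitz second derivative\<close>

text \<open>The derivative of the second-order remainder minus \<open>K t\<^sup>3 / 6\<close> is nonpositive, by the
  same argument one order lower.\<close>

lemma taylor2_lipschitz_upper:
  fixes \<phi> :: "real \<Rightarrow> real"
  assumes d1: "\<And>t. t \<in> {0..1} \<Longrightarrow> (\<phi> has_real_derivative \<phi>' t) (at t within {0..1})"
    and d2: "\<And>t. t \<in> {0..1} \<Longrightarrow> (\<phi>' has_real_derivative \<phi>'' t) (at t within {0..1})"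
    and le: "\<And>t. t \<in> {0..1} \<Longrightarrow> \<phi>'' t - \<phi>'' 0 \<le> K * t"
  shows "\<phi> 1 - \<phi> 0 - \<phi>' 0 - 1 / 2 * \<phi>'' 0 \<le> K / 6"
proof -
  let ?h = "\<lambda>t. \<phi>' t - \<phi>' 0 - \<phi>'' 0 * t - K / 2 * t\<^sup>2"
  have h: "?h s \<le> 0" if s: "s \<in> {0..1}" for s
  proof -
    have "?h s \<le> ?h 0"
    proof (rule DERIV_within_Icc_nonpos_imp_le[where f="?h" and f'="\<lambda>t. \<phi>'' t - \<phi>'' 0 - K * t"])
      fix t assume "t \<in> {0..s}"
      then have t: "t \<in> {0..1}" using s by auto
      have "(\<phi>' has_real_derivative \<phi>'' t) (at t within {0..s})"
        by (rule has_field_derivative_subset[OF d2[OF t]]) (use s in auto)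
      then show "(?h has_real_derivative \<phi>'' t - \<phi>'' 0 - K * t) (at t within {0..s})"
        by (auto intro!: derivative_eq_intros)
      show "\<phi>'' t - \<phi>'' 0 - K * t \<le> 0" using le[OF t] by simp
    qed (use s in auto)
    then show ?thesis by simp
  qed
  let ?k = "\<lambda>t. \<phi> t - \<phi> 0 - \<phi>' 0 * t - \<phi>'' 0 / 2 * t\<^sup>2 - K / 6 * t ^ 3"
  have "?k 1 \<le> ?k 0"
  proof (rule DERIV_within_Icc_nonpos_imp_le[where f="?k" and f'="?h"])
    fix t :: real assume t: "t \<in> {0..1}"
    show "(?k has_real_derivative ?h t) (at t within {0..1})"
      by (auto intro!: derivative_eq_intros d1[OF t] simp: power2_eq_square)
    show "?h t \<le> 0" by (rule h[OF t])
  qed simp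
  then show ?thesis by simp
qed

lemma taylor2_lipschitz:
  fixes \<phi> :: "real \<Rightarrow> real"
  assumes d1: "\<And>t. t \<in> {0..1} \<Longrightarrow> (\<phi> has_real_derivative \<phi>' t) (at t within {0..1})"
    and d2: "\<And>t. t \<in> {0..1} \<Longrightarrow> (\<phi>' has_real_derivative \<phi>'' t) (at t within {0..1})"
    and le: "\<And>t. t \<in> {0..1} \<Longrightarrow> \<bar>\<phi>'' t - \<phi>'' 0\<bar> \<le> K * t"
  shows "\<bar>\<phi> 1 - \<phi> 0 - \<phi>' 0 - 1 / 2 * \<phi>'' 0\<bar> \<le> K / 6"
proof -
  have "\<phi> 1 - \<phi> 0 - \<phi>' 0 - 1 / 2 * \<phi>'' 0 \<le> K / 6"
    using le by (intro taylor2_lipschitz_upper[OF d1 d2]) (auto simp: abs_le_iff)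
  moreover have "- \<phi> 1 - - \<phi> 0 - - \<phi>' 0 - 1 / 2 * - \<phi>'' 0 \<le> K / 6"
    using le by (intro taylor2_lipschitz_upper[of "\<lambda>t. - \<phi> t" "\<lambda>t. - \<phi>' t" "\<lambda>t. - \<phi>'' t"]
        DERIV_minus d1 d2) (auto simp: abs_le_iff)
  ultimately show ?thesis by linarith
qed

section \<open>The Levi-Civita connection in a chart\<close>

lemma smooth_on_differentiable: "smooth_on S f \<Longrightarrow> x \<in> S \<Longrightarrow> f differentiable (at x)"
  unfolding smooth_on_def by (metis Ck_on.simps(2))

lemma smooth_on_frechet_derivative:
  "smooth_on S f \<Longrightarrow> smooth_on S (\<lambda>x. frechet_derivative f (at x) v)"
  unfolding smooth_on_def by (metis Ck_on.simps(2))

lemma smooth_on_lipschitz_near: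
  fixes f :: "'e::euclidean_space \<Rightarrow> 'b::real_normed_vector"
  shows "smooth_on S f \<Longrightarrow> open S \<Longrightarrow> x \<in> S \<Longrightarrow> lipschitz_near f x"
  unfolding smooth_on_def by (blast intro: lipschitz_near_C1)

text \<open>\<open>\<Gamma>\<close> consists of the Christoffel symbols at \<open>y\<close> of the metric \<open>g\<close>, a field of bilinear forms on
  an open subset of the model space.\<close>

definition is_levi_civita ::
    "('e::euclidean_space \<Rightarrow> 'e \<Rightarrow> 'e \<Rightarrow> real) \<Rightarrow> 'e \<Rightarrow> ('e \<Rightarrow> 'e \<Rightarrow> 'e) \<Rightarrow> bool" where
  "is_levi_civita g y \<Gamma> \<longleftrightarrow> bilinear \<Gamma> \<and> (\<forall>a b. \<Gamma> a b = \<Gamma> b a) \<and>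
     (\<forall>a b d. frechet_derivative (\<lambda>z. g z a b) (at y) d = g y (\<Gamma> d a) b + g y a (\<Gamma> d b))"

text \<open>A Riemannian metric on an open subset \<open>W\<close> of the model space, as seen in a chart.\<close>

locale metric_field =
  fixes W :: "'e::euclidean_space set" and g :: "'e \<Rightarrow> 'e \<Rightarrow> 'e \<Rightarrow> real"
  assumes open_W: "open W"
    and bil: "y \<in> W \<Longrightarrow> bilinear (g y)"
    and sym: "y \<in> W \<Longrightarrow> g y a b = g y b a"
    and pos: "y \<in> W \<Longrightarrow> a \<noteq> 0 \<Longrightarrow> 0 < g y a a"
    and smooth: "smooth_on W (\<lambda>y. g y a b)"
begin

lemma lin1: "y \<in> W \<Longrightarrow> linear (\<lambda>a. g y a b)" and lin2: "y \<in> W \<Longrightarrow> linear (g y a)"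
  using bil by (auto simp: bilinear_def)

lemma differentiable: "y \<in> W \<Longrightarrow> (\<lambda>z. g z a b) differentiable (at y)"
  by (rule smooth_on_differentiable[OF smooth])

lemma nondegenerate:
  assumes "y \<in> W" "\<And>e. g y u e = g y v e"
  shows "u = v"
proof (rule ccontr)
  assume "u \<noteq> v"
  then have "0 < g y (u - v) (u - v)" using pos[OF assms(1)] by simp
  moreover have "g y (u - v) (u - v) = 0"
    using linear_diff[OF lin1[OF assms(1)], of u v "u - v"] assms(2) by simp
  ultimately show False by simp
qed

text \<open>The derivative of \<open>g(a, b)\<close> at \<open>y\<close> in direction \<open>d\<close>.\<close>

definition D :: "'e \<Rightarrow> 'e \<Rightarrow> 'e \<Rightarrow> 'e \<Rightarrow> real" where
  "D y d a b = frechet_derivative (\<lambda>z. g z a b) (at y) d"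

lemma linear_D:
  assumes "y \<in> W"
  shows "linear (\<lambda>d. D y d a b)" "linear (\<lambda>a. D y d a b)" "linear (\<lambda>b. D y d a b)"
  unfolding D_def
  using linear_frechet_derivative[OF differentiable[OF assms]]
    linear_frechet_derivative_parameter[OF open_W assms lin1 differentiable[OF assms], of b d]
    linear_frechet_derivative_parameter[OF open_W assms lin2 differentiable[OF assms], of a d]
  by simp_all

lemma D_sym:
  assumes "y \<in> W"
  shows "D y d a b = D y d b a"
proof -
  have "((\<lambda>z. g z a b) has_derivative frechet_derivative (\<lambda>z. g z b a) (at y)) (at y)"
    by (rule has_derivative_transform_within_open
        [OF has_derivative_frechet[OF differentiable[OF assms]] open_W assms]) (rule sym)
  from frechet_derivative_eqI[OF this] show ?thesis by (simp add: D_def)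
qed

text \<open>The right-hand side of the Koszul formula.\<close>

definition koszul :: "'e \<Rightarrow> 'e \<Rightarrow> 'e \<Rightarrow> 'e \<Rightarrow> real" where
  "koszul y a b e = (D y a b e + D y b a e - D y e a b) / 2"

lemma linear_koszul:
  assumes "y \<in> W"
  shows "linear (\<lambda>a. koszul y a b e)" "linear (\<lambda>b. koszul y a b e)" "linear (\<lambda>e. koszul y a b e)"
proof -
  note l = linear_D[OF assms]
  have "linear (\<lambda>x. (f x + h x - k x) / 2)" if "linear f" "linear h" "linear k"
    for f h k :: "'e \<Rightarrow> real"
    using that by (intro linearI) (simp_all add: linear_add linear_cmul field_simps)
  note * = this
  show "linear (\<lambda>a. koszul y a b e)" "linear (\<lambda>b. koszul y a b e)" "linear (\<lambda>e. koszul y a b e)"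
    unfolding koszul_def by (rule *; rule l)+
qed

lemma is_levi_civita_iff_koszul:
  assumes "y \<in> W" "bilinear \<Gamma>" "\<And>a b. \<Gamma> a b = \<Gamma> b a"
  shows "is_levi_civita g y \<Gamma> \<longleftrightarrow> (\<forall>a b e. g y (\<Gamma> a b) e = koszul y a b e)"
proof
  assume "is_levi_civita g y \<Gamma>"
  then have D: "D y d a b = g y (\<Gamma> d a) b + g y a (\<Gamma> d b)" for a b d
    by (simp add: is_levi_civita_def D_def)
  show "\<forall>a b e. g y (\<Gamma> a b) e = koszul y a b e"
  proof (intro allI)
    show "g y (\<Gamma> a b) e = koszul y a b e" for a b e
      using assms(3)[of b a] assms(3)[of e a] assms(3)[of e b] sym[OF assms(1), of b "\<Gamma> a e"]
      by (simp add: koszul_def D)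
  qed
next
  assume *: "\<forall>a b e. g y (\<Gamma> a b) e = koszul y a b e"
  have "D y d a b = g y (\<Gamma> d a) b + g y a (\<Gamma> d b)" for a b d
  proof -
    have "g y (\<Gamma> d a) b + g y a (\<Gamma> d b) = koszul y d a b + koszul y d b a"
      using * sym[OF assms(1), of a] by simp
    also have "\<dots> = D y d a b"
      using D_sym[OF assms(1), of d a b] D_sym[OF assms(1), of a d b] D_sym[OF assms(1), of b a d]
      unfolding koszul_def by (simp add: field_simps)
    finally show ?thesis by simp
  qed
  then show "is_levi_civita g y \<Gamma>"
    using assms by (simp add: is_levi_civita_def D_def)
qed

lemma levi_civita_koszul: "y \<in> W \<Longrightarrow> is_levi_civita g y \<Gamma> \<Longrightarrow> g y (\<Gamma> a b) e = koszul y a b e"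
  using is_levi_civita_iff_koszul[of y \<Gamma>] by (simp add: is_levi_civita_def)

lemma levi_civita_unique:
  assumes "y \<in> W" "is_levi_civita g y \<Gamma>" "is_levi_civita g y \<Gamma>'"
  shows "\<Gamma> = \<Gamma>'"
  using assms by (intro ext nondegenerate[OF assms(1)]) (simp add: levi_civita_koszul)

text \<open>The Gram matrix of the metric at \<open>y\<close>, as a linear map.\<close>

definition gram :: "'e \<Rightarrow> 'e \<Rightarrow> 'e" where
  "gram y u = (\<Sum>i\<in>Basis. g y u i *\<^sub>R i)"

lemma linear_gram: "y \<in> W \<Longrightarrow> linear (gram y)"
  unfolding gram_def
  by (intro linearI) (simp_all add: linear_add[OF lin1] linear_cmul[OF lin1] scaleR_left_distrib
      sum.distrib scaleR_sum_right)

lemma gram_eq_iff: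
  assumes "y \<in> W" "linear k"
  shows "gram y u = (\<Sum>i\<in>Basis. k i *\<^sub>R i) \<longleftrightarrow> (\<forall>e. g y u e = k e)"
proof
  assume *: "gram y u = (\<Sum>i\<in>Basis. k i *\<^sub>R i)"
  have "g y u i = k i" if "i \<in> Basis" for i
    using arg_cong[OF *, of "\<lambda>v. v \<bullet> i"] that by (simp add: gram_def)
  then show "\<forall>e. g y u e = k e"
    using linear_eq_stdbasis[OF lin2[OF assms(1)] assms(2)] by metis
qed (simp add: gram_def)

lemma inj_gram:
  assumes "y \<in> W"
  shows "inj (gram y)"
proof (rule injI)
  fix u v assume "gram y u = gram y v"
  then have "gram y u = (\<Sum>i\<in>Basis. g y v i *\<^sub>R i)" by (simp add: gram_def)
  then have "\<forall>e. g y u e = g y v e" by (simp add: gram_eq_iff[OF assms lin2[OF assms]])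
  then show "u = v" using nondegenerate[OF assms] by blast
qed

lemma levi_civita_exists:
  assumes y: "y \<in> W"
  shows "\<exists>\<Gamma>. is_levi_civita g y \<Gamma>"
proof -
  have "surj (gram y)"
    using linear_injective_imp_surjective[OF linear_gram[OF y] inj_gram[OF y]] by simp
  then have "\<forall>a b. \<exists>u. gram y u = (\<Sum>i\<in>Basis. koszul y a b i *\<^sub>R i)" by (metis surjD)
  then have "\<forall>a b. \<exists>u. \<forall>e. g y u e = koszul y a b e"
    using gram_eq_iff[OF y linear_koszul(3)[OF y]] by simp
  then obtain \<Gamma> where \<Gamma>: "\<And>a b e. g y (\<Gamma> a b) e = koszul y a b e" by metis
  have "bilinear \<Gamma>"
    unfolding bilinear_def
  proof (intro conjI allI linearI)
    note l = linear_koszul[OF y] and l1 = lin1[OF y]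
    show "\<Gamma> a (b + b') = \<Gamma> a b + \<Gamma> a b'" for a b b'
      by (rule nondegenerate[OF y]) (simp add: \<Gamma> linear_add[OF l1] linear_add[OF l(2)])
    show "\<Gamma> (a + a') b = \<Gamma> a b + \<Gamma> a' b" for a a' b
      by (rule nondegenerate[OF y]) (simp add: \<Gamma> linear_add[OF l1] linear_add[OF l(1)])
    show "\<Gamma> a (r *\<^sub>R b) = r *\<^sub>R \<Gamma> a b" for a b r
      by (rule nondegenerate[OF y]) (simp add: \<Gamma> linear_cmul[OF l1] linear_cmul[OF l(2)])
    show "\<Gamma> (r *\<^sub>R a) b = r *\<^sub>R \<Gamma> a b" for a b r
      by (rule nondegenerate[OF y]) (simp add: \<Gamma> linear_cmul[OF l1] linear_cmul[OF l(1)])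
  qed
  moreover have "\<Gamma> a b = \<Gamma> b a" for a b
    by (rule nondegenerate[OF y]) (simp add: \<Gamma> koszul_def D_sym[OF y, of _ a b])
  ultimately show ?thesis using is_levi_civita_iff_koszul[OF y] \<Gamma> by blast
qed

lemma lipschitz_near_levi_civita:
  assumes y: "y \<in> W" and \<Gamma>: "\<And>z. z \<in> W \<Longrightarrow> is_levi_civita g z (\<Gamma> z)"
  shows "lipschitz_near (\<lambda>z. \<Gamma> z a b) y"
proof (rule lipschitz_near_linear_solution[where S=gram
      and k="\<lambda>z. \<Sum>i\<in>Basis. koszul z a b i *\<^sub>R i"])
  have ev: "\<forall>\<^sub>F z in nhds y. z \<in> W" using open_W y by (rule eventually_nhds_in_open)
  then show "\<forall>\<^sub>F z in nhds y. linear (gram z)" by eventually_elim (rule linear_gram)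
  show "inj (gram y)" using y by (rule inj_gram)
  show "lipschitz_near (\<lambda>z. gram z u) y" for u
    unfolding gram_def
    by (intro lipschitz_near_sum lipschitz_near_scaleR lipschitz_near_const
        smooth_on_lipschitz_near[OF smooth open_W y])
  have D: "lipschitz_near (\<lambda>z. D z d u v) y" for d u v
    unfolding D_def
    by (rule smooth_on_lipschitz_near[OF smooth_on_frechet_derivative[OF smooth] open_W y])
  have "lipschitz_near (\<lambda>z. (1 / 2) *\<^sub>R (D z d u v + D z d' u' v' + (- 1) *\<^sub>R D z d'' u'' v'')) y"
    for d u v d' u' v' d'' u'' v''
    by (intro lipschitz_near_scaleR lipschitz_near_const lipschitz_near_add D)
  then have "lipschitz_near (\<lambda>z. koszul z u v e) y" for u v e
    by (simp add: koszul_def)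
  then show "lipschitz_near (\<lambda>z. \<Sum>i\<in>Basis. koszul z a b i *\<^sub>R i) y"
    by (intro lipschitz_near_sum lipschitz_near_scaleR lipschitz_near_const)
  show "\<forall>\<^sub>F z in nhds y. gram z (\<Gamma> z a b) = (\<Sum>i\<in>Basis. koszul z a b i *\<^sub>R i)"
    using ev
  proof eventually_elim
    case (elim z)
    show ?case
      using levi_civita_koszul[OF elim \<Gamma>[OF elim]] gram_eq_iff[OF elim linear_koszul(3)[OF elim]]
      by blast
  qed
qed

end

text \<open>The transformation law of the Christoffel symbols. The law defines symbols in the first chart
  that are symmetric and compatible with the metric, so that it follows from uniqueness.\<close>

lemma levi_civita_transform:
  fixes \<tau> :: "'e::euclidean_space \<Rightarrow> 'e"
  assumes W: "metric_field W g" and W': "metric_field W' g'"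
    and V: "open V" "V \<subseteq> W" "\<tau> ` V \<subseteq> W'" and \<tau>: "smooth_on V \<tau>"
    and iso: "\<And>z a b. z \<in> V \<Longrightarrow>
      g z a b = g' (\<tau> z) (frechet_derivative \<tau> (at z) a) (frechet_derivative \<tau> (at z) b)"
    and y: "y \<in> V"
    and \<Gamma>: "is_levi_civita g y \<Gamma>" and \<Gamma>': "is_levi_civita g' (\<tau> y) \<Gamma>'"
  shows "frechet_derivative \<tau> (at y) (\<Gamma> a b) =
      \<Gamma>' (frechet_derivative \<tau> (at y) a) (frechet_derivative \<tau> (at y) b) +
      frechet_derivative (\<lambda>z. frechet_derivative \<tau> (at z) b) (at y) a"
proof -
  interpret g: metric_field W g by (rule W)
  interpret g': metric_field W' g' by (rule W')
  define T where "T z = frechet_derivative \<tau> (at z)" for z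
  define H where "H a b = frechet_derivative (\<lambda>z. T z b) (at y) a" for a b
  have dT: "(\<lambda>z. T z b) differentiable (at z)" if "z \<in> V" for b z
    unfolding T_def by (rule smooth_on_differentiable[OF smooth_on_frechet_derivative[OF \<tau>] that])
  have linT: "linear (T z)" if "z \<in> V" for z
    unfolding T_def by (rule linear_frechet_derivative[OF smooth_on_differentiable[OF \<tau> that]])
  have yW: "y \<in> W" "\<tau> y \<in> W'" using V y by auto
  have injT: "inj (T y)"
  proof (subst linear_injective_0[OF linT[OF y]], intro allI impI)
    fix a assume "T y a = 0"
    then have "g y a a = 0"
      using iso[OF y, of a a] linear_0[OF g'.lin2[OF yW(2)]] by (simp add: T_def)
    then show "a = 0" using g.pos[OF yW(1), of a] by fastforce
  qed
  \<comment> \<open>The inverse \<open>R\<close> of the derivative serves to solve the transformation law for the symbols in the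
    first chart, which are called \<open>\<Delta>\<close> below.\<close>
  then obtain R where R: "linear R" "\<And>v. R (T y v) = v" "\<And>v. T y (R v) = v"
    using linear_injective_isomorphism[OF linT[OF y]] by blast
  have bil\<Gamma>': "bilinear \<Gamma>'" "\<And>a b. \<Gamma>' a b = \<Gamma>' b a" using \<Gamma>' by (auto simp: is_levi_civita_def)
  have linH: "linear (\<lambda>b. H a b)" "linear (\<lambda>a. H a b)" for a b
    unfolding H_def
    by (rule linear_frechet_derivative_parameter[OF V(1) y linT dT[OF y]],
        assumption, rule linear_frechet_derivative[OF dT[OF y]])
  have symH: "H a b = H b a" for a b
    unfolding H_def T_def
    using \<tau> by (intro frechet_derivative_commute[OF V(1) y]) (simp add: smooth_on_def)
  define \<Delta> where "\<Delta> a b = R (\<Gamma>' (T y a) (T y b) + H a b)" for a b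
  have "bilinear \<Delta>"
    unfolding bilinear_def
  proof (intro conjI allI)
    fix a b
    have "linear (\<lambda>b. \<Gamma>' (T y a) (T y b))" "linear (\<lambda>a. \<Gamma>' (T y a) (T y b))"
      using linear_compose[OF linT[OF y], of "\<Gamma>' (T y a)"]
        linear_compose[OF linT[OF y], of "\<lambda>u. \<Gamma>' u (T y b)"] bil\<Gamma>'(1)
      by (auto simp: bilinear_def o_def)
    from linear_compose[OF linear_compose_add[OF this(1) linH(1)] R(1)]
      linear_compose[OF linear_compose_add[OF this(2) linH(2)] R(1)]
    show "linear (\<Delta> a)" "linear (\<lambda>a. \<Delta> a b)"
      unfolding \<Delta>_def by (simp_all add: o_def)
  qed
  moreover have "\<Delta> a b = \<Delta> b a" for a b
    unfolding \<Delta>_def using bil\<Gamma>'(2) symH by metis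
  moreover have "frechet_derivative (\<lambda>z. g z a b) (at y) d = g y (\<Delta> d a) b + g y a (\<Delta> d b)" for a b d
  proof -
    have line: "((\<lambda>s. y + s *\<^sub>R d) has_vector_derivative d) (at 0)"
      by (auto intro!: derivative_eq_intros)
    have "((\<lambda>s. g (y + s *\<^sub>R d) a b) has_vector_derivative
        frechet_derivative (\<lambda>z. g z a b) (at y) d) (at 0)"
      using has_vector_derivative_compose[OF _ line, where g="\<lambda>z. g z a b"]
        has_derivative_frechet[OF g.differentiable[OF yW(1)]] by simp
    moreover have "((\<lambda>s. g (y + s *\<^sub>R d) a b) has_vector_derivative
        (g'.D (\<tau> y) (T y d) (T y a) (T y b) + g' (\<tau> y) (H d a) (T y b) + g' (\<tau> y) (T y a) (H d b))) (at 0)"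
    proof -
      have d\<tau>: "((\<lambda>s. \<tau> (y + s *\<^sub>R d)) has_vector_derivative T y d) (at 0)"
        using has_vector_derivative_compose[OF _ line, where g=\<tau>]
          has_derivative_frechet[OF smooth_on_differentiable[OF \<tau> y]] by (simp add: T_def)
      have dTs: "((\<lambda>s. T (y + s *\<^sub>R d) b) has_vector_derivative H d b) (at 0)" for b
        using has_vector_derivative_compose[OF _ line, where g="\<lambda>z. T z b"]
          has_derivative_frechet[OF dT[OF y]] by (simp add: H_def)
      have "((\<lambda>s. g' (\<tau> (y + s *\<^sub>R d)) (T (y + s *\<^sub>R d) a) (T (y + s *\<^sub>R d) b)) has_vector_derivative
        (g'.D (\<tau> y) (T y d) (T y a) (T y b) + g' (\<tau> y) (H d a) (T y b) + g' (\<tau> y) (T y a) (H d b))) (at 0)"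
        using has_vector_derivative_bilinear_along[where g=g', OF g'.open_W _ _ g'.bil _ d\<tau> dTs[of a] dTs[of b]]
          yW(2) g'.differentiable[OF yW(2)] by (simp add: g'.D_def)
      then show ?thesis
      proof (rule has_vector_derivative_transform_eventually)
        have "((\<lambda>s. y + s *\<^sub>R d) \<longlongrightarrow> y + 0 *\<^sub>R d) (at 0)" by (intro tendsto_intros)
        then have "\<forall>\<^sub>F s in at 0. y + s *\<^sub>R d \<in> V"
          using V(1) y by (intro topological_tendstoD) auto
        then show "\<forall>\<^sub>F s in at 0. g' (\<tau> (y + s *\<^sub>R d)) (T (y + s *\<^sub>R d) a) (T (y + s *\<^sub>R d) b) = g (y + s *\<^sub>R d) a b"
          by eventually_elim (simp add: iso T_def)
      qed (use y in \<open>auto simp: iso T_def\<close>)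
    qed
    ultimately have "frechet_derivative (\<lambda>z. g z a b) (at y) d =
        g'.D (\<tau> y) (T y d) (T y a) (T y b) + g' (\<tau> y) (H d a) (T y b) + g' (\<tau> y) (T y a) (H d b)"
      by (rule vector_derivative_unique_at)
    also have "g'.D (\<tau> y) (T y d) (T y a) (T y b) =
        g' (\<tau> y) (\<Gamma>' (T y d) (T y a)) (T y b) + g' (\<tau> y) (T y a) (\<Gamma>' (T y d) (T y b))"
      using \<Gamma>' by (simp add: is_levi_civita_def g'.D_def)
    finally have "frechet_derivative (\<lambda>z. g z a b) (at y) d =
        g' (\<tau> y) (\<Gamma>' (T y d) (T y a) + H d a) (T y b) + g' (\<tau> y) (T y a) (\<Gamma>' (T y d) (T y b) + H d b)"
      by (simp add: linear_add[OF g'.lin1[OF yW(2)]] linear_add[OF g'.lin2[OF yW(2)]])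
    also have "\<dots> = g y (\<Delta> d a) b + g y a (\<Delta> d b)"
      using iso[OF y] by (simp add: \<Delta>_def R T_def[symmetric])
    finally show ?thesis .
  qed
  ultimately have "is_levi_civita g y \<Delta>" by (simp add: is_levi_civita_def)
  with \<Gamma> have "\<Gamma> = \<Delta>" by (rule g.levi_civita_unique[OF yW(1)])
  then show ?thesis by (simp add: \<Delta>_def R H_def T_def[symmetric])
qed

section \<open>Charts and tangent vectors\<close>

text \<open>A fixed Riemannian manifold.\<close>

locale riemannian =
  fixes N :: "('a, 'e::euclidean_space) riem"
  assumes riemannian: "riemannian_manifold N"
begin

lemma smooth_manifold: "smooth_manifold N"
  using riemannian by (simp add: riemannian_manifold_def)

lemma Hausdorff: "Hausdorff_space (topo N)"
  using smooth_manifold by (simp add: smooth_manifold_def)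

lemma metric_bilinear: "p \<in> points N \<Longrightarrow> bilinear (metric N p)"
  and metric_sym: "p \<in> points N \<Longrightarrow> metric N p u v = metric N p v u"
  and metric_pos: "p \<in> points N \<Longrightarrow> v \<noteq> 0 \<Longrightarrow> 0 < metric N p v v"
  using riemannian by (auto simp: riemannian_manifold_def)

lemma chart:
  assumes "c \<in> atlas N"
  shows openin_chart: "openin (topo N) (fst c)" and open_chart_image: "open (snd c ` fst c)"
    and homeomorphic_chart:
      "homeomorphic_map (subtopology (topo N) (fst c)) (top_of_set (snd c ` fst c)) (snd c)"
  using smooth_manifold assms by (auto simp: smooth_manifold_def case_prod_beta)

lemma chart_subset: "c \<in> atlas N \<Longrightarrow> fst c \<subseteq> points N"
  using openin_chart openin_subset by blast

lemma inj_on_chart: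
  assumes "c \<in> atlas N"
  shows "inj_on (snd c) (fst c)"
  using homeomorphic_imp_injective_map[OF homeomorphic_chart[OF assms]] chart_subset[OF assms]
  by (simp add: Int_absorb1)

lemma chart_inv_chart [simp]: "c \<in> atlas N \<Longrightarrow> p \<in> fst c \<Longrightarrow> chart_inv c (snd c p) = p"
  unfolding chart_inv_def by (simp add: inj_on_chart)

lemma open_chart_image_of:
  assumes c: "c \<in> atlas N" and S: "openin (topo N) S" "S \<subseteq> fst c"
  shows "open (snd c ` S)"
proof -
  have "openin (subtopology (topo N) (fst c)) S"
    using S by (auto simp: openin_subtopology)
  then have "openin (top_of_set (snd c ` fst c)) (snd c ` S)"
    using homeomorphic_imp_open_map[OF homeomorphic_chart[OF c]] by (simp add: open_map_def)
  then show ?thesis using open_chart_image[OF c] by (simp add: openin_open_eq)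
qed

text \<open>The change of coordinates from chart \<open>c\<close> to chart \<open>d\<close>.\<close>

abbreviation transition :: "('a, 'e) chart \<Rightarrow> ('a, 'e) chart \<Rightarrow> 'e \<Rightarrow> 'e" where
  "transition c d \<equiv> snd d \<circ> chart_inv c"

text \<open>The image in chart \<open>c\<close> of the common domain of \<open>c\<close> and \<open>d\<close>, on which the transition
  map is smooth.\<close>

abbreviation overlap :: "('a, 'e) chart \<Rightarrow> ('a, 'e) chart \<Rightarrow> 'e set" where
  "overlap c d \<equiv> snd c ` (fst c \<inter> fst d)"

lemma open_overlap: "c \<in> atlas N \<Longrightarrow> d \<in> atlas N \<Longrightarrow> open (overlap c d)"
  by (intro open_chart_image_of openin_Int openin_chart) auto

lemma smooth_transition: "c \<in> atlas N \<Longrightarrow> d \<in> atlas N \<Longrightarrow> smooth_on (overlap c d) (transition c d)"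
  using smooth_manifold by (auto simp: smooth_manifold_def)

lemma transition_has_derivative:
  assumes "c \<in> atlas N" "d \<in> atlas N" "p \<in> fst c" "p \<in> fst d"
  shows "(transition c d has_derivative tangent_change c d p) (at (snd c p))"
  unfolding tangent_change_def
  by (rule has_derivative_frechet smooth_on_differentiable smooth_transition)+ (use assms in auto)

lemma linear_tangent_change:
  "c \<in> atlas N \<Longrightarrow> d \<in> atlas N \<Longrightarrow> p \<in> fst c \<Longrightarrow> p \<in> fst d \<Longrightarrow> linear (tangent_change c d p)"
  by (rule has_derivative_linear[OF transition_has_derivative])

text \<open>The chain rule for transition maps.\<close>

lemma tangent_change_compose:
  assumes "c \<in> atlas N" "d \<in> atlas N" "e \<in> atlas N" "p \<in> fst c" "p \<in> fst d" "p \<in> fst e"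
  shows "tangent_change d e p (tangent_change c d p v) = tangent_change c e p v"
proof -
  have "((\<lambda>y. transition d e (transition c d y)) has_derivative
      (\<lambda>v. tangent_change d e p (tangent_change c d p v))) (at (snd c p))"
    using has_derivative_compose[OF transition_has_derivative[of c d p], of "transition d e"]
      transition_has_derivative[of d e p] assms by simp
  then have "(transition c e has_derivative
      (\<lambda>v. tangent_change d e p (tangent_change c d p v))) (at (snd c p))"
  proof (rule has_derivative_transform_within_open)
    show "open (snd c ` (fst c \<inter> (fst d \<inter> fst e)))"
      using assms by (intro open_chart_image_of openin_Int openin_chart) auto
  qed (use assms in auto)
  from frechet_derivative_eqI[OF this] show ?thesis by (simp add: tangent_change_def)
qed

lemma tangent_change_self:
  assumes "c \<in> atlas N" "p \<in> fst c"
  shows "tangent_change c c p v = v"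
proof -
  have "((\<lambda>y. y) has_derivative (\<lambda>v. v)) (at (snd c p))" by (rule has_derivative_ident)
  then have "(transition c c has_derivative (\<lambda>v. v)) (at (snd c p))"
    by (rule has_derivative_transform_within_open[OF _ open_chart_image[OF assms(1)]])
      (use assms in auto)
  from frechet_derivative_eqI[OF this] show ?thesis by (simp add: tangent_change_def)
qed

lemma pref_chart:
  assumes "p \<in> points N"
  shows "pref_chart N p \<in> atlas N" "p \<in> fst (pref_chart N p)"
proof -
  have "\<exists>c. c \<in> atlas N \<and> p \<in> fst c"
    using smooth_manifold assms by (auto simp: smooth_manifold_def)
  from someI_ex[OF this] show "pref_chart N p \<in> atlas N" "p \<in> fst (pref_chart N p)"
    by (simp_all add: pref_chart_def)
qed

lemma pref_chart_near:
  assumes "c \<in> atlas N" "p \<in> fst c"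
  shows "pref_chart N p \<in> atlas N" "p \<in> fst (pref_chart N p)"
  using assms chart_subset pref_chart by blast+

lemma linear_components: "c \<in> atlas N \<Longrightarrow> p \<in> fst c \<Longrightarrow> linear (components N c p)"
  unfolding components_def[abs_def]
  by (intro linear_tangent_change pref_chart_near)

lemma components_change:
  "c \<in> atlas N \<Longrightarrow> d \<in> atlas N \<Longrightarrow> p \<in> fst c \<Longrightarrow> p \<in> fst d \<Longrightarrow>
    tangent_change c d p (components N c p v) = components N d p v"
  unfolding components_def by (intro tangent_change_compose pref_chart_near)

lemma components_pref_chart: "p \<in> points N \<Longrightarrow> components N (pref_chart N p) p v = v"
  unfolding components_def using pref_chart by (intro tangent_change_self)

lemma vector_of_components_change:
  "c \<in> atlas N \<Longrightarrow> d \<in> atlas N \<Longrightarrow> p \<in> fst c \<Longrightarrow> p \<in> fst d \<Longrightarrow>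
    vector_of_components N d p (tangent_change c d p v) = vector_of_components N c p v"
  unfolding vector_of_components_def by (intro tangent_change_compose pref_chart_near)

lemma vector_of_components_components:
  assumes "c \<in> atlas N" "p \<in> fst c"
  shows "vector_of_components N c p (components N c p v) = v"
  using assms pref_chart_near[OF assms]
  by (simp add: components_def vector_of_components_def tangent_change_compose tangent_change_self)

lemma components_vector_of_components:
  assumes "c \<in> atlas N" "p \<in> fst c"
  shows "components N c p (vector_of_components N c p v) = v"
  using assms pref_chart_near[OF assms]
  by (simp add: components_def vector_of_components_def tangent_change_compose tangent_change_self)

lemma components_eq_iff:
  "c \<in> atlas N \<Longrightarrow> p \<in> fst c \<Longrightarrow> components N c p u = components N c p v \<longleftrightarrow> u = v"
  using vector_of_components_components by metis

lemma metric_in_chart_components: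
  "c \<in> atlas N \<Longrightarrow> p \<in> fst c \<Longrightarrow>
    metric_in_chart N c (snd c p) (components N c p u) (components N c p v) = metric N p u v"
  by (simp add: metric_in_chart_def vector_of_components_components)

lemma metric_in_chart_change:
  assumes "c \<in> atlas N" "d \<in> atlas N" "y \<in> overlap c d"
  shows "metric_in_chart N c y a b = metric_in_chart N d (transition c d y)
      (frechet_derivative (transition c d) (at y) a) (frechet_derivative (transition c d) (at y) b)"
proof -
  obtain p where p: "p \<in> fst c" "p \<in> fst d" "y = snd c p" using assms(3) by auto
  have "frechet_derivative (transition c d) (at y) = tangent_change c d p"
    by (simp add: tangent_change_def p)
  then show ?thesis
    using assms p by (simp add: metric_in_chart_def vector_of_components_change)
qed

lemma metric_field_chart:
  assumes c: "c \<in> atlas N"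
  shows "metric_field (snd c ` fst c) (metric_in_chart N c)"
proof
  show "open (snd c ` fst c)" using c by (rule open_chart_image)
  show "smooth_on (snd c ` fst c) (\<lambda>y. metric_in_chart N c y a b)" for a b
    using riemannian c by (auto simp: riemannian_manifold_def)
  fix y assume "y \<in> snd c ` fst c"
  then obtain p where p: "p \<in> fst c" "y = snd c p" by auto
  have pN: "p \<in> points N" using p c chart_subset by blast
  have eq: "metric_in_chart N c y a b =
      metric N p (vector_of_components N c p a) (vector_of_components N c p b)" for a b
    using c p by (simp add: metric_in_chart_def)
  have lin: "linear (vector_of_components N c p)"
    unfolding vector_of_components_def[abs_def]
    using c p pref_chart[OF pN] by (intro linear_tangent_change) auto
  show "bilinear (metric_in_chart N c y)"
    using metric_bilinear[OF pN] unfolding eq bilinear_def[of "metric_in_chart N c y"]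
    by (auto intro!: linearI simp: eq linear_add[OF lin] linear_cmul[OF lin]
        bilinear_ladd bilinear_radd bilinear_lmul bilinear_rmul)
  show "metric_in_chart N c y a b = metric_in_chart N c y b a" for a b
    unfolding eq using metric_sym[OF pN] .
  show "0 < metric_in_chart N c y a a" if "a \<noteq> 0" for a
  proof -
    have "vector_of_components N c p a \<noteq> 0"
      using components_vector_of_components[OF c p(1), of a] linear_0[OF linear_components[OF c p(1)]] that
      by metis
    then show ?thesis unfolding eq using metric_pos[OF pN] by blast
  qed
qed

lemma levi_civita_christoffel:
  assumes c: "c \<in> atlas N" and y: "y \<in> snd c ` fst c"
  shows "is_levi_civita (metric_in_chart N c) y (christoffel N c y)"
proof -
  interpret metric_field "snd c ` fst c" "metric_in_chart N c" using c by (rule metric_field_chart)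
  have "christoffel N c y = (THE \<Gamma>. is_levi_civita (metric_in_chart N c) y \<Gamma>)"
    by (simp add: christoffel_def is_levi_civita_def)
  moreover have "\<exists>!\<Gamma>. is_levi_civita (metric_in_chart N c) y \<Gamma>"
    using levi_civita_exists[OF y] levi_civita_unique[OF y] by blast
  ultimately show ?thesis using theI' by metis
qed

lemma bilinear_christoffel: "c \<in> atlas N \<Longrightarrow> y \<in> snd c ` fst c \<Longrightarrow> bilinear (christoffel N c y)"
  using levi_civita_christoffel by (auto simp: is_levi_civita_def)

lemma metric_in_chart_derivative:
  "c \<in> atlas N \<Longrightarrow> y \<in> snd c ` fst c \<Longrightarrow>
    frechet_derivative (\<lambda>z. metric_in_chart N c z a b) (at y) d =
      metric_in_chart N c y (christoffel N c y d a) b + metric_in_chart N c y a (christoffel N c y d b)"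
  using levi_civita_christoffel by (auto simp: is_levi_civita_def)

lemma christoffel_lipschitz_near:
  assumes "c \<in> atlas N" "y \<in> snd c ` fst c"
  shows "lipschitz_near (\<lambda>z. christoffel N c z a b) y"
  by (rule metric_field.lipschitz_near_levi_civita
      [OF metric_field_chart[OF assms(1)] assms(2) levi_civita_christoffel[OF assms(1)]])

text \<open>The last summand is the second derivative of the transition map.\<close>

lemma christoffel_change:
  assumes c: "c \<in> atlas N" and d: "d \<in> atlas N" and p: "p \<in> fst c" "p \<in> fst d"
  shows "tangent_change c d p (christoffel N c (snd c p) a b) =
      christoffel N d (snd d p) (tangent_change c d p a) (tangent_change c d p b) +
      frechet_derivative (\<lambda>z. frechet_derivative (transition c d) (at z) b) (at (snd c p)) a"
proof -
  have eq: "transition c d (snd c p) = snd d p" using c p by simp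
  have "is_levi_civita (metric_in_chart N d) (transition c d (snd c p)) (christoffel N d (snd d p))"
    unfolding eq using d p by (intro levi_civita_christoffel) auto
  then show ?thesis
    unfolding tangent_change_def
    by (rule levi_civita_transform[OF metric_field_chart[OF c] metric_field_chart[OF d]
          open_overlap[OF c d] _ _ smooth_transition[OF c d] metric_in_chart_change[OF c d], rotated -1])
      (use c p levi_civita_christoffel[OF c] in auto)
qed

section \<open>Covariant derivatives along curves\<close>

lemma eventually_curve_in_open:
  assumes "continuous_map (top_of_set I) (topo N) \<gamma>" "openin (topo N) S" "t \<in> I" "\<gamma> t \<in> S"
  shows "\<forall>\<^sub>F s in at t within I. \<gamma> s \<in> S"
proof -
  have "openin (top_of_set I) {s \<in> I. \<gamma> s \<in> S}"
    using assms openin_continuous_map_preimage[of "top_of_set I" "topo N" \<gamma> S] by simp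
  then obtain T where "open T" "{s \<in> I. \<gamma> s \<in> S} = I \<inter> T" by (auto simp: openin_open)
  then show ?thesis
    unfolding eventually_at_topological using assms by (intro exI[of _ T]) auto
qed

lemma curve_in_points:
  "continuous_map (top_of_set I) (topo N) \<gamma> \<Longrightarrow> t \<in> I \<Longrightarrow> \<gamma> t \<in> points N"
  using continuous_map_image_subset_topspace by fastforce

lemma velocityD:
  assumes "has_velocity N I \<gamma> V"
  shows velocity_continuous: "continuous_map (top_of_set I) (topo N) \<gamma>"
    and velocity_points: "t \<in> I \<Longrightarrow> \<gamma> t \<in> points N"
  using assms curve_in_points by (auto simp: has_velocity_def)

lemma velocity_in_chart:
  assumes V: "has_velocity N I \<gamma> V" and t: "t \<in> I" and d: "d \<in> atlas N" "\<gamma> t \<in> fst d"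
  shows "((\<lambda>s. snd d (\<gamma> s)) has_vector_derivative components N d (\<gamma> t) (V t)) (at t within I)"
proof -
  let ?c = "pref_chart N (\<gamma> t)"
  note c = pref_chart[OF velocity_points[OF V t]]
  have "((\<lambda>s. snd ?c (\<gamma> s)) has_vector_derivative V t) (at t within I)"
    using V t by (auto simp: has_velocity_def o_def)
  from has_vector_derivative_compose[OF transition_has_derivative[OF c(1) d(1) c(2) d(2)] this]
  have "((\<lambda>s. transition ?c d (snd ?c (\<gamma> s))) has_vector_derivative components N d (\<gamma> t) (V t))
      (at t within I)" by (simp add: components_def)
  then show ?thesis
  proof (rule has_vector_derivative_transform_eventually[OF _ _ _ t])
    show "\<forall>\<^sub>F s in at t within I. transition ?c d (snd ?c (\<gamma> s)) = snd d (\<gamma> s)"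
      using eventually_curve_in_open[OF velocity_continuous[OF V] openin_chart[OF c(1)] t c(2)]
      by eventually_elim (simp add: c)
  qed (simp add: c)
qed

text \<open>\<open>w\<close> is the covariant derivative at \<open>t\<close> of \<open>X\<close> along \<open>\<gamma>\<close>, expressed in an arbitrary chart
  \<open>c\<close> and solved for the derivative of the components of \<open>X\<close>.\<close>

definition cov_deriv_in_chart ::
    "('a, 'e) chart \<Rightarrow> real set \<Rightarrow> (real \<Rightarrow> 'a) \<Rightarrow> (real \<Rightarrow> 'e) \<Rightarrow> (real \<Rightarrow> 'e) \<Rightarrow> 'e \<Rightarrow> real \<Rightarrow> bool" where
  "cov_deriv_in_chart c I \<gamma> V X w t \<longleftrightarrow>
    ((\<lambda>s. components N c (\<gamma> s) (X s)) has_vector_derivative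
       (components N c (\<gamma> t) w - christoffel N c (snd c (\<gamma> t))
          (components N c (\<gamma> t) (V t)) (components N c (\<gamma> t) (X t)))) (at t within I)"

text \<open>The second derivatives of the transition map from the product rule cancel those from
  the transformation law of the Christoffel symbols.\<close>

lemma cov_deriv_change_chart:
  assumes V: "has_velocity N I \<gamma> V" and t: "t \<in> I"
    and c: "c \<in> atlas N" "\<gamma> t \<in> fst c" and d: "d \<in> atlas N" "\<gamma> t \<in> fst d"
    and X: "cov_deriv_in_chart c I \<gamma> V X w t"
  shows "cov_deriv_in_chart d I \<gamma> V X w t"
proof -
  define y where "y s = snd c (\<gamma> s)" for s
  define Z where "Z s = components N c (\<gamma> s) (X s)" for s
  define T where "T z = frechet_derivative (transition c d) (at z)" for z
  let ?v = "components N c (\<gamma> t) (V t)" and ?w = "components N c (\<gamma> t) w"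
  let ?H = "frechet_derivative (\<lambda>z. T z (Z t)) (at (y t)) ?v"
  have Tt: "T (snd c p) = tangent_change c d p" for p by (simp add: T_def tangent_change_def)
  have yt: "y t \<in> overlap c d" using c d by (auto simp: y_def)
  have "((\<lambda>s. T (y s) (Z s)) has_vector_derivative
      (?H + T (y t) (?w - christoffel N c (y t) ?v (Z t)))) (at t within I)"
  proof (rule has_vector_derivative_linear_along[where W="overlap c d" and F=T and y=y and Z=Z, OF open_overlap[OF c(1) d(1)] yt t])
    show "linear (T z)" if "z \<in> overlap c d" for z
      unfolding T_def
      by (rule linear_frechet_derivative[OF smooth_on_differentiable[OF smooth_transition[OF c(1) d(1)] that]])
    show "(\<lambda>z. T z a) differentiable (at (y t))" for a
      unfolding T_def using smooth_on_differentiable[OF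
          smooth_on_frechet_derivative[OF smooth_transition[OF c(1) d(1)]] yt] .
    show "(y has_vector_derivative ?v) (at t within I)"
      unfolding y_def by (rule velocity_in_chart[OF V t c])
    show "(Z has_vector_derivative ?w - christoffel N c (y t) ?v (Z t)) (at t within I)"
      using X by (simp add: cov_deriv_in_chart_def Z_def[abs_def] y_def)
  qed
  moreover have "?H + T (y t) (?w - christoffel N c (y t) ?v (Z t)) =
      components N d (\<gamma> t) w - christoffel N d (snd d (\<gamma> t))
        (components N d (\<gamma> t) (V t)) (components N d (\<gamma> t) (X t))"
  proof -
    have "T (y t) (?w - christoffel N c (y t) ?v (Z t)) =
        components N d (\<gamma> t) w - tangent_change c d (\<gamma> t) (christoffel N c (y t) ?v (Z t))"
      using linear_diff[OF linear_tangent_change[OF c(1) d(1) c(2) d(2)]]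
        components_change[OF c(1) d(1) c(2) d(2)] by (simp add: y_def Tt)
    moreover have "tangent_change c d (\<gamma> t) (christoffel N c (y t) ?v (Z t)) =
      christoffel N d (snd d (\<gamma> t)) (components N d (\<gamma> t) (V t)) (components N d (\<gamma> t) (X t)) + ?H"
      using christoffel_change[OF c(1) d(1) c(2) d(2), of ?v "Z t"]
        components_change[OF c(1) d(1) c(2) d(2)] by (simp add: y_def Z_def T_def)
    ultimately show ?thesis by simp
  qed
  ultimately have *: "((\<lambda>s. T (y s) (Z s)) has_vector_derivative
      components N d (\<gamma> t) w - christoffel N d (snd d (\<gamma> t))
        (components N d (\<gamma> t) (V t)) (components N d (\<gamma> t) (X t))) (at t within I)" by simp
  show ?thesis
    unfolding cov_deriv_in_chart_def
  proof (rule has_vector_derivative_transform_eventually[OF * _ _ t])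
    have "\<forall>\<^sub>F s in at t within I. \<gamma> s \<in> fst c \<inter> fst d"
      using c d by (intro eventually_curve_in_open[OF velocity_continuous[OF V]] openin_Int openin_chart t) auto
    then show "\<forall>\<^sub>F s in at t within I. T (y s) (Z s) = components N d (\<gamma> s) (X s)"
      by eventually_elim (use c d in \<open>simp add: y_def Z_def Tt components_change\<close>)
    show "T (y t) (Z t) = components N d (\<gamma> t) (X t)"
      using c d by (simp add: y_def Z_def Tt components_change)
  qed
qed

lemma cov_deriv_along_iff:
  assumes V: "has_velocity N I \<gamma> V" and t: "t \<in> I" and c: "c \<in> atlas N" "\<gamma> t \<in> fst c"
  shows "has_cov_deriv_along N I \<gamma> V X w t \<longleftrightarrow> cov_deriv_in_chart c I \<gamma> V X w t"
proof -
  note p = velocity_points[OF V t]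
  note d = pref_chart[OF p]
  have "has_cov_deriv_along N I \<gamma> V X w t \<longleftrightarrow> cov_deriv_in_chart (pref_chart N (\<gamma> t)) I \<gamma> V X w t"
    unfolding has_cov_deriv_along_def cov_deriv_in_chart_def Let_def
    by (auto simp: components_pref_chart[OF p])
  also have "\<dots> \<longleftrightarrow> cov_deriv_in_chart c I \<gamma> V X w t"
    using cov_deriv_change_chart[OF V t] c d by blast
  finally show ?thesis .
qed

text \<open>Compatibility of the connection with the metric.\<close>

lemma has_derivative_metric_along:
  assumes V: "has_velocity N I \<gamma> V" and t: "t \<in> I"
    and X: "has_cov_deriv_along N I \<gamma> V X w t" and Y: "has_cov_deriv_along N I \<gamma> V Y w' t"
  shows "((\<lambda>s. metric N (\<gamma> s) (X s) (Y s)) has_real_derivative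
      metric N (\<gamma> t) w (Y t) + metric N (\<gamma> t) (X t) w') (at t within I)"
proof -
  note p = velocity_points[OF V t]
  let ?c = "pref_chart N (\<gamma> t)"
  note c = pref_chart[OF p]
  interpret metric_field "snd ?c ` fst ?c" "metric_in_chart N ?c" by (rule metric_field_chart[OF c(1)])
  let ?y = "snd ?c (\<gamma> t)" and ?g = "metric_in_chart N ?c"
  let ?X = "\<lambda>s. components N ?c (\<gamma> s) (X s)" and ?Y = "\<lambda>s. components N ?c (\<gamma> s) (Y s)"
  have y: "?y \<in> snd ?c ` fst ?c" using c by auto
  note comp = components_pref_chart[OF p]
  have g: "?g ?y a b = metric N (\<gamma> t) a b" for a b
    using metric_in_chart_components[OF c, of a b] by (simp add: comp)
  let ?\<Gamma> = "christoffel N ?c ?y (V t)"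
  have "((\<lambda>s. ?g (snd ?c (\<gamma> s)) (?X s) (?Y s)) has_vector_derivative
      (frechet_derivative (\<lambda>z. ?g z (?X t) (?Y t)) (at ?y) (V t)
        + ?g ?y (w - ?\<Gamma> (X t)) (?Y t) + ?g ?y (?X t) (w' - ?\<Gamma> (Y t)))) (at t within I)"
  proof (rule has_vector_derivative_bilinear_along[where g="?g" and y="\<lambda>s. snd ?c (\<gamma> s)",
        OF open_W y t bil differentiable[OF y]])
    show "((\<lambda>s. snd ?c (\<gamma> s)) has_vector_derivative V t) (at t within I)"
      using velocity_in_chart[OF V t c] by (simp add: comp)
    show "(?X has_vector_derivative w - ?\<Gamma> (X t)) (at t within I)"
      "(?Y has_vector_derivative w' - ?\<Gamma> (Y t)) (at t within I)"
      using X Y unfolding cov_deriv_along_iff[OF V t c] cov_deriv_in_chart_def by (simp_all add: comp)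
  qed
  moreover have "frechet_derivative (\<lambda>z. ?g z (?X t) (?Y t)) (at ?y) (V t)
        + ?g ?y (w - ?\<Gamma> (X t)) (?Y t) + ?g ?y (?X t) (w' - ?\<Gamma> (Y t)) =
      metric N (\<gamma> t) w (Y t) + metric N (\<gamma> t) (X t) w'"
    unfolding metric_in_chart_derivative[OF c(1) y]
    by (simp add: comp linear_diff[OF lin1[OF y]] linear_diff[OF lin2[OF y]])
      (simp add: g)
  ultimately have *: "((\<lambda>s. ?g (snd ?c (\<gamma> s)) (?X s) (?Y s)) has_vector_derivative
      metric N (\<gamma> t) w (Y t) + metric N (\<gamma> t) (X t) w') (at t within I)" by simp
  show ?thesis
    unfolding has_real_derivative_iff_has_vector_derivative
  proof (rule has_vector_derivative_transform_eventually[OF * _ _ t])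
    show "\<forall>\<^sub>F s in at t within I. ?g (snd ?c (\<gamma> s)) (?X s) (?Y s) = metric N (\<gamma> s) (X s) (Y s)"
      using eventually_curve_in_open[OF velocity_continuous[OF V] openin_chart[OF c(1)] t c(2)]
      by eventually_elim (simp add: metric_in_chart_components c)
    show "?g ?y (?X t) (?Y t) = metric N (\<gamma> t) (X t) (Y t)"
      by (simp add: metric_in_chart_components c)
  qed
qed

lemma cov_deriv_along_tendsto:
  assumes V: "has_velocity N I \<gamma> V" and t: "t \<in> I" and c: "c \<in> atlas N" "\<gamma> t \<in> fst c"
    and X: "has_cov_deriv_along N I \<gamma> V X w t"
  shows "((\<lambda>s. components N c (\<gamma> s) (X s)) \<longlongrightarrow> components N c (\<gamma> t) (X t)) (at t within I)"
  using X has_vector_derivative_continuous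
  unfolding cov_deriv_along_iff[OF V t c] cov_deriv_in_chart_def continuous_within by blast

lemma cov_deriv_along_linear:
  assumes V: "has_velocity N I \<gamma> V" and t: "t \<in> I"
    and X: "has_cov_deriv_along N I \<gamma> V X w t" and Y: "has_cov_deriv_along N I \<gamma> V Y w' t"
  shows "has_cov_deriv_along N I \<gamma> V (\<lambda>s. r *\<^sub>R X s + k *\<^sub>R Y s) (r *\<^sub>R w + k *\<^sub>R w') t"
proof -
  let ?c = "pref_chart N (\<gamma> t)"
  note c = pref_chart[OF velocity_points[OF V t]]
  let ?C = "components N ?c"
  let ?\<Gamma> = "christoffel N ?c (snd ?c (\<gamma> t)) (?C (\<gamma> t) (V t))"
  have lin: "linear (?C p)" if "p \<in> fst ?c" for p using linear_components[OF c(1) that] .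
  have lin\<Gamma>: "linear ?\<Gamma>" using bilinear_christoffel[OF c(1)] c(2) by (auto simp: bilinear_def)
  have "((\<lambda>s. r *\<^sub>R ?C (\<gamma> s) (X s) + k *\<^sub>R ?C (\<gamma> s) (Y s)) has_vector_derivative
      (r *\<^sub>R (?C (\<gamma> t) w - ?\<Gamma> (?C (\<gamma> t) (X t))) + k *\<^sub>R (?C (\<gamma> t) w' - ?\<Gamma> (?C (\<gamma> t) (Y t)))))
      (at t within I)"
    using X Y unfolding cov_deriv_along_iff[OF V t c] cov_deriv_in_chart_def
    by (intro has_vector_derivative_add bounded_linear.has_vector_derivative[OF bounded_linear_scaleR_right])
  moreover have "r *\<^sub>R (?C (\<gamma> t) w - ?\<Gamma> (?C (\<gamma> t) (X t))) + k *\<^sub>R (?C (\<gamma> t) w' - ?\<Gamma> (?C (\<gamma> t) (Y t))) =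
      ?C (\<gamma> t) (r *\<^sub>R w + k *\<^sub>R w') - ?\<Gamma> (?C (\<gamma> t) (r *\<^sub>R X t + k *\<^sub>R Y t))"
    using lin[OF c(2)] lin\<Gamma> by (simp add: linear_add linear_cmul algebra_simps)
  ultimately have *: "((\<lambda>s. r *\<^sub>R ?C (\<gamma> s) (X s) + k *\<^sub>R ?C (\<gamma> s) (Y s)) has_vector_derivative
      ?C (\<gamma> t) (r *\<^sub>R w + k *\<^sub>R w') - ?\<Gamma> (?C (\<gamma> t) (r *\<^sub>R X t + k *\<^sub>R Y t))) (at t within I)" by simp
  show ?thesis
    unfolding cov_deriv_along_iff[OF V t c] cov_deriv_in_chart_def
  proof (rule has_vector_derivative_transform_eventually[OF * _ _ t])
    show "\<forall>\<^sub>F s in at t within I. r *\<^sub>R ?C (\<gamma> s) (X s) + k *\<^sub>R ?C (\<gamma> s) (Y s) = ?C (\<gamma> s) (r *\<^sub>R X s + k *\<^sub>R Y s)"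
      using eventually_curve_in_open[OF velocity_continuous[OF V] openin_chart[OF c(1)] t c(2)]
      by eventually_elim (simp add: linear_add[OF lin] linear_cmul[OF lin])
  qed (simp add: linear_add[OF lin[OF c(2)]] linear_cmul[OF lin[OF c(2)]])
qed

lemma has_velocity_subset:
  assumes "has_velocity N I \<gamma> V" "J \<subseteq> I"
  shows "has_velocity N J \<gamma> V"
  using assms unfolding has_velocity_def
  by (auto intro: continuous_map_from_subtopology_mono has_vector_derivative_within_subset)

lemma cov_deriv_along_cong:
  assumes "t \<in> I" "has_cov_deriv_along N I \<gamma> V X w t"
    and "\<And>s. s \<in> I \<Longrightarrow> \<gamma> s = \<gamma>' s" "V t = V' t" "\<And>s. s \<in> I \<Longrightarrow> X s = X' s"
  shows "has_cov_deriv_along N I \<gamma>' V' X' w t"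
proof -
  let ?c = "pref_chart N (\<gamma>' t)"
  have "((\<lambda>s. components N ?c (\<gamma>' s) (X' s)) has_vector_derivative D) (at t within I)"
    if "((\<lambda>s. components N ?c (\<gamma> s) (X s)) has_vector_derivative D) (at t within I)" for D
    using that by (rule has_vector_derivative_transform[OF assms(1), rotated]) (simp add: assms)
  then show ?thesis
    using assms(2) assms(3)[OF assms(1)] assms(4) assms(5)[OF assms(1)]
    unfolding has_cov_deriv_along_def Let_def by auto
qed

lemma geodesic_on_cong:
  assumes "geodesic_on N I \<gamma> V" "\<And>s. s \<in> I \<Longrightarrow> \<gamma> s = \<gamma>' s"
  shows "geodesic_on N I \<gamma>' V"
proof -
  have "has_velocity N I \<gamma>' V"
    unfolding has_velocity_def
  proof (intro conjI ballI)
    show "continuous_map (top_of_set I) (topo N) \<gamma>'"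
      by (rule continuous_map_eq[of _ _ \<gamma>])
        (use assms in \<open>auto simp: geodesic_on_def has_velocity_def\<close>)
    fix t assume t: "t \<in> I"
    then have "((snd (pref_chart N (\<gamma>' t)) \<circ> \<gamma>) has_vector_derivative V t) (at t within I)"
      using assms by (auto simp: geodesic_on_def has_velocity_def)
    then show "((snd (pref_chart N (\<gamma>' t)) \<circ> \<gamma>') has_vector_derivative V t) (at t within I)"
      by (rule has_vector_derivative_transform[OF t, rotated]) (simp add: assms)
  qed
  then show ?thesis
    using assms unfolding geodesic_on_def by (auto intro: cov_deriv_along_cong)
qed

section \<open>Norms on a tangent space\<close>

lemma tnorm_nonneg: "p \<in> points N \<Longrightarrow> 0 \<le> tnorm N p v"
  using metric_pos[of p v] bilinear_lzero[OF metric_bilinear[of p]]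
  by (cases "v = 0") (auto simp: tnorm_def)

lemma metric_nonneg: "p \<in> points N \<Longrightarrow> 0 \<le> metric N p v v"
  using metric_pos[of p v] bilinear_lzero[OF metric_bilinear[of p]] by (cases "v = 0") auto

lemma tnorm_scaleR:
  assumes "p \<in> points N"
  shows "tnorm N p (r *\<^sub>R v) = \<bar>r\<bar> * tnorm N p v"
  using bilinear_lmul[OF metric_bilinear[OF assms]] bilinear_rmul[OF metric_bilinear[OF assms]]
  by (simp add: tnorm_def real_sqrt_mult mult.assoc[symmetric] flip: power2_eq_square)

lemma metric_cauchy_schwarz:
  assumes p: "p \<in> points N"
  shows "\<bar>metric N p u v\<bar> \<le> tnorm N p u * tnorm N p v"
proof (cases "v = 0")
  case True
  then show ?thesis using bilinear_rzero[OF metric_bilinear[OF p]] by (simp add: tnorm_def)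
next
  case False
  note b = metric_bilinear[OF p]
  let ?G = "metric N p"
  have pos: "0 < ?G v v" using metric_pos[OF p False] .
  define k where "k = ?G u v / ?G v v"
  have "0 \<le> ?G (u - k *\<^sub>R v) (u - k *\<^sub>R v)" by (rule metric_nonneg[OF p])
  also have "\<dots> = ?G u u - 2 * k * ?G u v + k\<^sup>2 * ?G v v"
    using metric_sym[OF p, of v u]
    by (simp add: bilinear_lsub[OF b] bilinear_rsub[OF b] bilinear_lmul[OF b] bilinear_rmul[OF b]
        power2_eq_square algebra_simps)
  also have "\<dots> = ?G u u - (?G u v)\<^sup>2 / ?G v v"
    using pos by (simp add: k_def power2_eq_square field_simps)
  finally have "(?G u v)\<^sup>2 \<le> ?G u u * ?G v v" using pos by (simp add: field_simps)
  then have "sqrt ((?G u v)\<^sup>2) \<le> sqrt (?G u u * ?G v v)" by (rule real_sqrt_le_mono)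
  then show ?thesis by (simp add: tnorm_def real_sqrt_mult)
qed

lemma tnorm_equivalent_norm:
  assumes p: "p \<in> points N"
  obtains m M where "m > 0" "\<And>v. m * norm v \<le> tnorm N p v" "\<And>v. tnorm N p v \<le> M * norm v"
proof -
  note b = metric_bilinear[OF p]
  have cont: "continuous_on S (\<lambda>v. tnorm N p v)" for S
    unfolding tnorm_def
    by (intro continuous_on_real_sqrt bounded_bilinear.continuous_on
        [OF b[unfolded bilinear_conv_bounded_bilinear]] continuous_on_id)
  have comp: "compact (sphere (0::'e) 1)" and ne: "sphere (0::'e) 1 \<noteq> {}" by auto
  obtain u where u: "u \<in> sphere (0::'e) 1" "\<And>v. v \<in> sphere 0 1 \<Longrightarrow> tnorm N p u \<le> tnorm N p v"
    using continuous_attains_inf[OF comp ne cont] by blast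
  obtain u' where u': "\<And>v. v \<in> sphere 0 1 \<Longrightarrow> tnorm N p v \<le> tnorm N p u'"
    using continuous_attains_sup[OF comp ne cont] by blast
  have scale: "tnorm N p v = norm v * tnorm N p (v /\<^sub>R norm v)" if "v \<noteq> 0" for v
    using that by (simp add: tnorm_scaleR[OF p])
  have S: "v /\<^sub>R norm v \<in> sphere 0 1" if "v \<noteq> 0" for v :: 'e using that by simp
  have zero: "tnorm N p 0 = 0" by (simp add: tnorm_def bilinear_lzero[OF b])
  show thesis
  proof (rule that[of "tnorm N p u" "tnorm N p u'"])
    show "tnorm N p u > 0" using u(1) metric_pos[OF p, of u] by (fastforce simp: tnorm_def)
    show "tnorm N p u * norm v \<le> tnorm N p v" for v
      using scale[of v] u(2)[OF S] zero
      by (cases "v = 0") (auto simp: mult.commute[of _ "norm v"] intro: mult_left_mono)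
    show "tnorm N p v \<le> tnorm N p u' * norm v" for v
      using scale[of v] u'[OF S] zero
      by (cases "v = 0") (auto simp: mult.commute[of _ "norm v"] intro: mult_left_mono)
  qed
qed

text \<open>A real supremum bounds its terms only if they are bounded above. Here they are, since \<open>T\<close> is
  linear on a finite-dimensional space.\<close>

lemma tnorm_le_opnorm:
  assumes p: "p \<in> points N" and T: "linear T"
  shows "tnorm N p (T w) \<le> opnorm N p T * tnorm N p w"
proof (cases "w = 0")
  case True
  then show ?thesis
    using linear_0[OF T] by (simp add: tnorm_def bilinear_lzero[OF metric_bilinear[OF p]])
next
  case False
  obtain m M where m: "m > 0" "\<And>v. m * norm v \<le> tnorm N p v" and M: "\<And>v. tnorm N p v \<le> M * norm v"
    using tnorm_equivalent_norm[OF p] by blast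
  obtain B where B: "B > 0" "\<And>v. norm (T v) \<le> B * norm v"
    using linear_bounded_pos[OF T] by blast
  have "0 \<le> M"
    using M[of w] tnorm_nonneg[OF p, of w] False by (smt (verit) mult_neg_pos zero_less_norm_iff)
  have "tnorm N p (T v) / tnorm N p v \<le> M * B / m" for v
  proof (cases "v = 0")
    case True
    then show ?thesis using \<open>0 \<le> M\<close> B m(1)
      by (simp add: tnorm_def bilinear_lzero[OF metric_bilinear[OF p]])
  next
    case False
    have "tnorm N p (T v) \<le> M * (B * norm v)"
      using M[of "T v"] mult_left_mono[OF B(2)[of v] \<open>0 \<le> M\<close>] by linarith
    then have "tnorm N p (T v) / tnorm N p v \<le> M * (B * norm v) / (m * norm v)"
      using m False \<open>0 \<le> M\<close> B(1) by (intro frac_le) auto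
    then show ?thesis using False by simp
  qed
  then have "bdd_above (range (\<lambda>v. tnorm N p (T v) / tnorm N p v))" by (intro bdd_aboveI2)
  then have "tnorm N p (T w) / tnorm N p w \<le> opnorm N p T"
    unfolding opnorm_def by (rule cSUP_upper[OF UNIV_I])
  moreover have "tnorm N p w > 0" using metric_pos[OF p False] by (simp add: tnorm_def)
  ultimately show ?thesis by (simp add: pos_divide_le_eq)
qed

section \<open>Gradient and Hessian along curves\<close>

text \<open>The chain rule for a curve in \<open>U\<close> and a function that is differentiable only within the image
  of \<open>U\<close> in a chart.\<close>

lemma has_vector_derivative_along_curve_in:
  assumes V: "has_velocity N I \<gamma> V" and t: "t \<in> I" and c: "c \<in> atlas N" "\<gamma> t \<in> fst c"
    and U: "\<gamma> ` I \<subseteq> U"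
    and h: "(h has_derivative h') (at (snd c (\<gamma> t)) within snd c ` (U \<inter> fst c))"
  shows "((\<lambda>s. h (snd c (\<gamma> s))) has_vector_derivative h' (components N c (\<gamma> t) (V t))) (at t within I)"
proof -
  have "openin (top_of_set I) {s \<in> I. \<gamma> s \<in> fst c}"
    using openin_continuous_map_preimage[OF velocity_continuous[OF V] openin_chart[OF c(1)]] by simp
  then obtain T where T: "open T" "{s \<in> I. \<gamma> s \<in> fst c} = I \<inter> T" by (auto simp: openin_open)
  have tT: "t \<in> T" using T(2) t c(2) by blast
  have J: "at t within (I \<inter> T) = at t within I" by (rule at_within_nhd[OF tT T(1)]) auto
  have "((\<lambda>s. snd c (\<gamma> s)) has_vector_derivative components N c (\<gamma> t) (V t)) (at t within I \<inter> T)"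
    unfolding J by (rule velocity_in_chart[OF V t c])
  moreover have "(\<lambda>s. snd c (\<gamma> s)) ` (I \<inter> T) \<subseteq> snd c ` (U \<inter> fst c)"
    using U T(2) by blast
  ultimately have "((h \<circ> (\<lambda>s. snd c (\<gamma> s))) has_vector_derivative h' (components N c (\<gamma> t) (V t))) (at t within I \<inter> T)"
    by (intro vector_derivative_diff_chain_within has_derivative_subset[OF h])
  then show ?thesis unfolding J by (simp add: o_def)
qed

lemma has_derivative_along_gradient:
  assumes V: "has_velocity N I \<gamma> V" and t: "t \<in> I" and U: "\<gamma> ` I \<subseteq> U"
    and grad: "is_gradient_on N U f g"
  shows "((\<lambda>s. f (\<gamma> s)) has_real_derivative metric N (\<gamma> t) (g (\<gamma> t)) (V t)) (at t within I)"
proof -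
  note p = velocity_points[OF V t]
  let ?c = "pref_chart N (\<gamma> t)"
  note c = pref_chart[OF p]
  have "((f \<circ> chart_inv ?c) has_derivative metric N (\<gamma> t) (g (\<gamma> t)))
      (at (snd ?c (\<gamma> t)) within snd ?c ` (U \<inter> fst ?c))"
    using grad U t unfolding is_gradient_on_def Let_def by blast
  from has_vector_derivative_along_curve_in[OF V t c U this]
  have "((\<lambda>s. f (chart_inv ?c (snd ?c (\<gamma> s)))) has_vector_derivative metric N (\<gamma> t) (g (\<gamma> t)) (V t)) (at t within I)"
    by (simp add: components_pref_chart[OF p])
  then show ?thesis
    unfolding has_real_derivative_iff_has_vector_derivative
  proof (rule has_vector_derivative_transform_eventually[OF _ _ _ t])
    show "\<forall>\<^sub>F s in at t within I. f (chart_inv ?c (snd ?c (\<gamma> s))) = f (\<gamma> s)"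
      using eventually_curve_in_open[OF velocity_continuous[OF V] openin_chart[OF c(1)] t c(2)]
      by eventually_elim (simp add: c)
  qed (simp add: c)
qed

lemma cov_deriv_along_hessian:
  assumes V: "has_velocity N I \<gamma> V" and t: "t \<in> I" and U: "\<gamma> ` I \<subseteq> U"
    and hess: "is_hessian_on N U g H"
  shows "has_cov_deriv_along N I \<gamma> V (\<lambda>s. g (\<gamma> s)) (H (\<gamma> t) (V t)) t"
proof -
  note p = velocity_points[OF V t]
  let ?c = "pref_chart N (\<gamma> t)"
  note c = pref_chart[OF p]
  let ?h = "\<lambda>z. components N ?c (chart_inv ?c z) (g (chart_inv ?c z))"
  have "has_cov_deriv N U g (H (\<gamma> t)) (\<gamma> t)"
    using hess U t unfolding is_hessian_on_def by blast
  then obtain h' where h': "(?h has_derivative h') (at (snd ?c (\<gamma> t)) within snd ?c ` (U \<inter> fst ?c))"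
    and H: "H (\<gamma> t) = (\<lambda>v. h' v + christoffel N ?c (snd ?c (\<gamma> t)) v (g (\<gamma> t)))"
    unfolding has_cov_deriv_def Let_def by blast
  from has_vector_derivative_along_curve_in[OF V t c U h']
  have "((\<lambda>s. ?h (snd ?c (\<gamma> s))) has_vector_derivative h' (V t)) (at t within I)"
    by (simp add: components_pref_chart[OF p])
  then have "((\<lambda>s. components N ?c (\<gamma> s) (g (\<gamma> s))) has_vector_derivative h' (V t)) (at t within I)"
  proof (rule has_vector_derivative_transform_eventually[OF _ _ _ t])
    show "\<forall>\<^sub>F s in at t within I. ?h (snd ?c (\<gamma> s)) = components N ?c (\<gamma> s) (g (\<gamma> s))"
      using eventually_curve_in_open[OF velocity_continuous[OF V] openin_chart[OF c(1)] t c(2)]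
      by eventually_elim (simp add: c)
  qed (simp add: c)
  then show ?thesis
    unfolding has_cov_deriv_along_def Let_def H by blast
qed

lemma linear_hessian:
  assumes hess: "is_hessian_on N U g H" and p: "p \<in> U" "p \<in> points N"
  shows "linear (H p)"
proof -
  let ?c = "pref_chart N p"
  note c = pref_chart[OF p(2)]
  have "has_cov_deriv N U g (H p) p"
    using hess p(1) unfolding is_hessian_on_def by blast
  then obtain h' D where "(D has_derivative h') (at (snd ?c p) within snd ?c ` (U \<inter> fst ?c))"
    and H: "H p = (\<lambda>v. h' v + christoffel N ?c (snd ?c p) v (g p))"
    unfolding has_cov_deriv_def Let_def by blast
  then have "linear h'" by (intro has_derivative_linear)
  moreover have "linear (\<lambda>v. christoffel N ?c (snd ?c p) v (g p))"
    using bilinear_christoffel[OF c(1)] c(2) by (auto simp: bilinear_def)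
  ultimately show ?thesis unfolding H by (rule linear_compose_add)
qed

section \<open>Uniqueness of geodesics\<close>

text \<open>The topology is Hausdorff, so the set of times at which two geodesics differ in position or
  velocity is open.\<close>

lemma geodesics_disagree_open:
  assumes G: "geodesic_on N I \<gamma> V" "geodesic_on N I \<gamma>' V'" and x: "x \<in> I"
    and ne: "\<not> (\<gamma> x = \<gamma>' x \<and> V x = V' x)"
  shows "\<forall>\<^sub>F s in at x within I. \<not> (\<gamma> s = \<gamma>' s \<and> V s = V' s)"
proof -
  have V: "has_velocity N I \<gamma> V" "has_velocity N I \<gamma>' V'"
    and cov: "has_cov_deriv_along N I \<gamma> V V 0 x" "has_cov_deriv_along N I \<gamma>' V' V' 0 x"
    using G x by (auto simp: geodesic_on_def)
  note p = velocity_points[OF V(1) x] velocity_points[OF V(2) x]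
  show ?thesis
  proof (cases "\<gamma> x = \<gamma>' x")
    case False
    then obtain A B where AB: "openin (topo N) A" "openin (topo N) B" "\<gamma> x \<in> A" "\<gamma>' x \<in> B" "disjnt A B"
      using Hausdorff p unfolding Hausdorff_space_def by metis
    have "\<forall>\<^sub>F s in at x within I. \<gamma> s \<in> A" "\<forall>\<^sub>F s in at x within I. \<gamma>' s \<in> B"
      using AB x velocity_continuous[OF V(1)] velocity_continuous[OF V(2)]
      by (auto intro: eventually_curve_in_open)
    then show ?thesis by eventually_elim (use AB in \<open>auto simp: disjnt_iff\<close>)
  next
    case True
    let ?c = "pref_chart N (\<gamma> x)"
    have c: "?c \<in> atlas N" "\<gamma> x \<in> fst ?c" "\<gamma>' x \<in> fst ?c" using pref_chart p True by auto
    have "((\<lambda>s. components N ?c (\<gamma> s) (V s) - components N ?c (\<gamma>' s) (V' s)) \<longlongrightarrow>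
        components N ?c (\<gamma> x) (V x) - components N ?c (\<gamma>' x) (V' x)) (at x within I)"
      using cov V c x by (intro tendsto_diff cov_deriv_along_tendsto)
    moreover have "components N ?c (\<gamma> x) (V x) - components N ?c (\<gamma>' x) (V' x) \<noteq> 0"
      using True ne c components_eq_iff[OF c(1)] by auto
    ultimately have "\<forall>\<^sub>F s in at x within I. components N ?c (\<gamma> s) (V s) - components N ?c (\<gamma>' s) (V' s) \<noteq> 0"
      by (rule tendsto_imp_eventually_ne)
    then show ?thesis by eventually_elim auto
  qed
qed

text \<open>In a chart \<open>c\<close>, the pair of position and velocity of a geodesic is an integral curve of this
  vector field.\<close>

definition geodesic_field :: "('a, 'e) chart \<Rightarrow> 'e \<times> 'e \<Rightarrow> 'e \<times> 'e" where
  "geodesic_field c z = (snd z, - christoffel N c (fst z) (snd z) (snd z))"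

lemma lipschitz_near_geodesic_field:
  assumes c: "c \<in> atlas N" and z: "fst z \<in> snd c ` fst c"
  shows "lipschitz_near (geodesic_field c) z"
proof -
  let ?F = "\<lambda>z::'e \<times> 'e. (snd z, \<Sum>i\<in>Basis. \<Sum>j\<in>Basis.
      (snd z \<bullet> i) *\<^sub>R (snd z \<bullet> j) *\<^sub>R (- 1) *\<^sub>R christoffel N c (fst z) i j)"
  have inner: "lipschitz_near (\<lambda>z::'e \<times> 'e. snd z \<bullet> i) z" for i
    by (intro lipschitz_near_bounded_linear bounded_linear_inner_left_comp bounded_linear_snd)
  have "lipschitz_near (\<lambda>z. christoffel N c (fst z) i j) z" for i j
    by (rule lipschitz_near_compose[OF lipschitz_near_bounded_linear[OF bounded_linear_fst]
          christoffel_lipschitz_near[OF c z]])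
  then have "lipschitz_near ?F z"
    by (intro lipschitz_near_Pair lipschitz_near_sum lipschitz_near_scaleR lipschitz_near_const inner)
      (auto intro: lipschitz_near_bounded_linear bounded_linear_snd)
  moreover have "\<forall>\<^sub>F z in nhds z. ?F z = geodesic_field c z"
  proof -
    have "\<forall>\<^sub>F z in nhds z. z \<in> fst -` (snd c ` fst c)"
      using z open_chart_image[OF c] by (intro eventually_nhds_in_open open_vimage_fst) auto
    then show ?thesis
    proof eventually_elim
      case (elim z)
      show ?case
        using bilinear_euclidean_expansion[OF bilinear_christoffel[OF c], of "fst z" "snd z" "snd z"] elim
        by (simp add: geodesic_field_def sum_negf)
    qed
  qed
  ultimately show ?thesis by (rule lipschitz_near_cong)
qed

lemma geodesic_in_chart:
  assumes G: "geodesic_on N I \<gamma> V" and t: "t \<in> I" and c: "c \<in> atlas N" "\<gamma> t \<in> fst c"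
  shows "((\<lambda>s. (snd c (\<gamma> s), components N c (\<gamma> s) (V s))) has_vector_derivative
      geodesic_field c (snd c (\<gamma> t), components N c (\<gamma> t) (V t))) (at t within I)"
proof -
  have V: "has_velocity N I \<gamma> V" and cov: "has_cov_deriv_along N I \<gamma> V V 0 t"
    using G t by (auto simp: geodesic_on_def)
  show ?thesis
    using cov linear_0[OF linear_components[OF c]]
    unfolding geodesic_field_def cov_deriv_along_iff[OF V t c] cov_deriv_in_chart_def
    by (auto intro!: has_vector_derivative_Pair velocity_in_chart[OF V t c])
qed

text \<open>Agreement at \<open>x\<close> is needed only to find one chart and one Lipschitz constant for both geodesics
  near \<open>x\<close>; agreement at \<open>a\<close> is then carried over to \<open>b\<close>.\<close>

lemma geodesics_agree_locally:
  assumes G: "geodesic_on N I \<gamma> V" "geodesic_on N I \<gamma>' V'" and x: "x \<in> I"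
    and eq: "\<gamma> x = \<gamma>' x" "V x = V' x"
  shows "\<exists>d>0. \<forall>a b. a \<le> x \<and> x \<le> b \<and> b - a < d \<and> {a..b} \<subseteq> I \<and> \<gamma> a = \<gamma>' a \<and> V a = V' a
    \<longrightarrow> \<gamma> b = \<gamma>' b \<and> V b = V' b"
proof -
  have V: "has_velocity N I \<gamma> V" "has_velocity N I \<gamma>' V'"
    using G by (auto simp: geodesic_on_def)
  let ?c = "pref_chart N (\<gamma> x)"
  have c: "?c \<in> atlas N" "\<gamma> x \<in> fst ?c" "\<gamma>' x \<in> fst ?c" 
    using pref_chart velocity_points[OF V(1) x] eq by auto
  define z where "z s = (snd ?c (\<gamma> s), components N ?c (\<gamma> s) (V s))" for s
  define z' where "z' s = (snd ?c (\<gamma>' s), components N ?c (\<gamma>' s) (V' s))" for s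
  have z: "(z has_vector_derivative geodesic_field ?c (z s)) (at s within I)"
    if "s \<in> I" "\<gamma> s \<in> fst ?c" for s
    unfolding z_def using geodesic_in_chart[OF G(1) that(1) c(1) that(2)] by simp
  have z': "(z' has_vector_derivative geodesic_field ?c (z' s)) (at s within I)"
    if "s \<in> I" "\<gamma>' s \<in> fst ?c" for s
    unfolding z'_def using geodesic_in_chart[OF G(2) that(1) c(1) that(2)] by simp
  have zx: "z x = z' x" by (simp add: z_def z'_def eq)
  have "lipschitz_near (geodesic_field ?c) (z x)"
    using c by (intro lipschitz_near_geodesic_field) (auto simp: z_def)
  then obtain K Q where Q: "eventually Q (nhds (z x))"
    and K: "\<And>u v. Q u \<Longrightarrow> Q v \<Longrightarrow> norm (geodesic_field ?c u - geodesic_field ?c v) \<le> K * norm (u - v)"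
    by (rule lipschitz_near_nhdE) (rule that, assumption+)
  have "(z \<longlongrightarrow> z x) (at x within I)" "(z' \<longlongrightarrow> z x) (at x within I)"
    using z[OF x c(2)] z'[OF x c(3)] has_vector_derivative_continuous zx
    unfolding continuous_within by metis+
  with Q have "\<forall>\<^sub>F s in at x within I. Q (z s)" "\<forall>\<^sub>F s in at x within I. Q (z' s)"
    by (auto simp: filterlim_iff)
  moreover have "\<forall>\<^sub>F s in at x within I. \<gamma> s \<in> fst ?c" "\<forall>\<^sub>F s in at x within I. \<gamma>' s \<in> fst ?c"
    using c x velocity_continuous[OF V(1)] velocity_continuous[OF V(2)]
    by (auto intro: eventually_curve_in_open openin_chart)
  ultimately have "\<forall>\<^sub>F s in at x within I. Q (z s) \<and> Q (z' s) \<and> \<gamma> s \<in> fst ?c \<and> \<gamma>' s \<in> fst ?c"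
    by eventually_elim simp
  then obtain d where d: "d > 0" and near0:
    "\<forall>s\<in>I. s \<noteq> x \<and> dist s x < d \<longrightarrow> Q (z s) \<and> Q (z' s) \<and> \<gamma> s \<in> fst ?c \<and> \<gamma>' s \<in> fst ?c"
    unfolding eventually_at by (elim exE conjE)
  have "Q (z x)" using Q by (rule eventually_nhds_x_imp_x)
  with near0 zx c have near: "Q (z s) \<and> Q (z' s) \<and> \<gamma> s \<in> fst ?c \<and> \<gamma>' s \<in> fst ?c"
    if "s \<in> I" "dist s x < d" for s
    using that by (cases "s = x") auto
  have "\<gamma> b = \<gamma>' b \<and> V b = V' b"
    if ab: "a \<le> x" "x \<le> b" "b - a < d" "{a..b} \<subseteq> I" and init: "\<gamma> a = \<gamma>' a" "V a = V' a" for a b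
  proof -
    have ns: "s \<in> I" "Q (z s)" "Q (z' s)" "\<gamma> s \<in> fst ?c" "\<gamma>' s \<in> fst ?c" if "s \<in> {a..b}" for s
      using near[of s] ab that by (auto simp: dist_real_def)
    have "z b = z' b"
    proof (rule ode_solution_unique[where F="geodesic_field ?c" and K=K and a=a])
      fix s assume s: "s \<in> {a..b}"
      show "(z has_vector_derivative geodesic_field ?c (z s)) (at s within {a..b})"
        using z[OF ns(1,4)[OF s]] ab(4) by (rule has_vector_derivative_within_subset)
      show "(z' has_vector_derivative geodesic_field ?c (z' s)) (at s within {a..b})"
        using z'[OF ns(1,5)[OF s]] ab(4) by (rule has_vector_derivative_within_subset)
      show "norm (geodesic_field ?c (z s) - geodesic_field ?c (z' s)) \<le> K * norm (z s - z' s)"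
        using ns[OF s] by (intro K)
    qed (use ab init in \<open>auto simp: z_def z'_def\<close>)
    moreover have b: "b \<in> {a..b}" using ab by auto
    ultimately have "\<gamma> b = \<gamma>' b"
      using inj_onD[OF inj_on_chart[OF c(1)] _ ns(4)[OF b] ns(5)[OF b]] by (simp add: z_def z'_def)
    then show ?thesis
      using \<open>z b = z' b\<close> components_eq_iff[OF c(1) ns(4)[OF b]] by (simp add: z_def z'_def)
  qed
  note * = this
  show ?thesis by (intro exI[of _ d] conjI[OF d] allI impI, elim conjE, rule *)
qed

lemma geodesic_unique:
  assumes G: "geodesic_on N {0..1} \<gamma> V" "geodesic_on N {0..1} \<gamma>' V'"
    and init: "\<gamma> 0 = \<gamma>' 0" "V 0 = V' 0" and t: "t \<in> {0..1}"
  shows "\<gamma> t = \<gamma>' t" "V t = V' t"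
proof -
  \<comment> \<open>By bisection it suffices to carry agreement across short intervals around each point. Around a
    point of disagreement this is vacuous.\<close>
  let ?agree = "\<lambda>s. \<gamma> s = \<gamma>' s \<and> V s = V' s"
  let ?P = "\<lambda>a b. {a..b} \<subseteq> {0..1} \<longrightarrow> ?agree a \<longrightarrow> ?agree b"
  have "?P 0 t"
  proof (rule Bolzano[of 0 t ?P])
    fix a b c assume "?P a b" "?P b c" "a \<le> b" "b \<le> c"
    then show "?P a c" by auto
  next
    fix x assume x: "0 \<le> x" "x \<le> t"
    then have xI: "x \<in> {0..1}" using t by auto
    show "\<exists>d>0. \<forall>a b. a \<le> x \<and> x \<le> b \<and> b - a < d \<longrightarrow> ?P a b"
    proof (cases "?agree x")
      case True
      then obtain d where d: "d > 0" "\<And>a b. a \<le> x \<and> x \<le> b \<and> b - a < d \<and> {a..b} \<subseteq> {0..1} \<and>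
          \<gamma> a = \<gamma>' a \<and> V a = V' a \<Longrightarrow> \<gamma> b = \<gamma>' b \<and> V b = V' b"
        using geodesics_agree_locally[OF G xI] by (elim conjE) metis
      show ?thesis
      proof (intro exI[of _ d] conjI[OF d(1)] allI)
        show "a \<le> x \<and> x \<le> b \<and> b - a < d \<longrightarrow> ?P a b" for a b using d(2)[of a b] by simp
      qed
    next
      case False
      obtain d where "d > 0" "\<forall>s\<in>{0..1}. s \<noteq> x \<and> dist s x < d \<longrightarrow> \<not> ?agree s"
        using geodesics_disagree_open[OF G xI False] unfolding eventually_at by (elim exE conjE)
      then have d: "\<not> ?agree s" if "s \<in> {0..1}" "dist s x < d" for s
        using that False by (cases "s = x") auto
      have "?P a b" if "a \<le> x \<and> x \<le> b \<and> b - a < d" for a b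
        using d[of a] that by (auto simp: dist_real_def)
      then show ?thesis by (intro exI[of _ d] conjI[OF \<open>d > 0\<close>] allI) (rule impI)
    qed
  qed (use t in auto)
  then show "\<gamma> t = \<gamma>' t" "V t = V' t" using init t by auto
qed

section \<open>The exponential map\<close>

lemma cov_deriv_along_reparametrize:
  assumes V: "has_velocity N {0..1} \<gamma> V" and s: "s \<in> {0..1}" and t: "t \<in> {0..1}"
    and X: "has_cov_deriv_along N {0..1} \<gamma> V X w (s * t)"
  shows "has_cov_deriv_along N {0..1} (\<lambda>t. \<gamma> (s * t)) (\<lambda>t. s *\<^sub>R V (s * t)) (\<lambda>t. X (s * t)) (s *\<^sub>R w) t"
proof -
  have st: "s * t \<in> {0..1}" using s t by (auto intro: mult_le_one)
  let ?c = "pref_chart N (\<gamma> (s * t))"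
  note c = pref_chart[OF velocity_points[OF V st]]
  have img: "(*) s ` {0..1} \<subseteq> {0..1}" using s by (auto intro: mult_le_one)
  from X obtain X' where X':
    "((\<lambda>r. components N ?c (\<gamma> r) (X r)) has_vector_derivative X') (at (s * t) within {0..1})"
    "w = X' + christoffel N ?c (snd ?c (\<gamma> (s * t))) (V (s * t)) (X (s * t))"
    unfolding has_cov_deriv_along_def Let_def by blast
  have "((*) s has_vector_derivative s) (at t within {0..1})"
    by (auto intro!: derivative_eq_intros simp: has_real_derivative_iff_has_vector_derivative[symmetric])
  from vector_diff_chain_within[OF this has_vector_derivative_within_subset[OF X'(1) img]]
  have "((\<lambda>t. components N ?c (\<gamma> (s * t)) (X (s * t))) has_vector_derivative s *\<^sub>R X') (at t within {0..1})"
    by (simp add: o_def)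
  moreover have "s *\<^sub>R w = s *\<^sub>R X' + christoffel N ?c (snd ?c (\<gamma> (s * t))) (s *\<^sub>R V (s * t)) (X (s * t))"
    using X'(2) bilinear_lmul[OF bilinear_christoffel[OF c(1)]] c(2) by (simp add: scaleR_add_right)
  ultimately show ?thesis unfolding has_cov_deriv_along_def Let_def by blast
qed

lemma has_velocity_reparametrize:
  assumes V: "has_velocity N {0..1} \<gamma> V" and s: "s \<in> {0..1}"
  shows "has_velocity N {0..1} (\<lambda>t. \<gamma> (s * t)) (\<lambda>t. s *\<^sub>R V (s * t))"
  unfolding has_velocity_def
proof (intro conjI ballI)
  have img: "(*) s ` {0..1} \<subseteq> {0..1}" using s by (auto intro: mult_le_one)
  have "continuous_map (top_of_set {0..1}) (top_of_set {0..1}) ((*) s)"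
    using img by (auto simp: continuous_map_in_subtopology intro!: continuous_intros)
  from continuous_map_compose[OF this velocity_continuous[OF V]]
  show "continuous_map (top_of_set {0..1}) (topo N) (\<lambda>t. \<gamma> (s * t))" by (simp add: o_def)
  fix t :: real assume t: "t \<in> {0..1}"
  have st: "s * t \<in> {0..1}" using s t by (auto intro: mult_le_one)
  let ?c = "pref_chart N (\<gamma> (s * t))"
  have "((*) s has_vector_derivative s) (at t within {0..1})"
    by (auto intro!: derivative_eq_intros simp: has_real_derivative_iff_has_vector_derivative[symmetric])
  moreover have "((snd ?c \<circ> \<gamma>) has_vector_derivative V (s * t)) (at (s * t) within {0..1})"
    using V st by (auto simp: has_velocity_def)
  ultimately have "((snd ?c \<circ> \<gamma> \<circ> (*) s) has_vector_derivative s *\<^sub>R V (s * t)) (at t within {0..1})"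
    by (rule vector_diff_chain_within[OF _ has_vector_derivative_within_subset[OF _ img]])
  then show "((snd ?c \<circ> (\<lambda>t. \<gamma> (s * t))) has_vector_derivative s *\<^sub>R V (s * t)) (at t within {0..1})"
    by (simp add: o_def)
qed

lemma geodesic_reparametrize:
  assumes G: "geodesic_on N {0..1} \<gamma> V" and s: "s \<in> {0..1}"
  shows "geodesic_on N {0..1} (\<lambda>t. \<gamma> (s * t)) (\<lambda>t. s *\<^sub>R V (s * t))"
proof -
  have V: "has_velocity N {0..1} \<gamma> V" using G by (simp add: geodesic_on_def)
  note V' = has_velocity_reparametrize[OF V s]
  have "has_cov_deriv_along N {0..1} (\<lambda>t. \<gamma> (s * t)) (\<lambda>t. s *\<^sub>R V (s * t)) (\<lambda>t. s *\<^sub>R V (s * t)) 0 t"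
    if t: "t \<in> {0..1}" for t
  proof -
    have "s * t \<in> {0..1}" using s t by (auto intro: mult_le_one)
    then have "has_cov_deriv_along N {0..1} \<gamma> V V 0 (s * t)" using G by (simp add: geodesic_on_def)
    from cov_deriv_along_reparametrize[OF V s t this]
    have "has_cov_deriv_along N {0..1} (\<lambda>t. \<gamma> (s * t)) (\<lambda>t. s *\<^sub>R V (s * t)) (\<lambda>t. V (s * t)) 0 t" by simp
    from cov_deriv_along_linear[OF V' t this this, of s 0] show ?thesis by simp
  qed
  with V' show ?thesis by (simp add: geodesic_on_def)
qed

lemma exp_map_geodesic:
  assumes G: "geodesic_on N {0..1} \<gamma> V" and s: "s \<in> {0..1}"
  shows "exp_map N (\<gamma> 0) (s *\<^sub>R V 0) = \<gamma> s" "s *\<^sub>R V 0 \<in> exp_dom N (\<gamma> 0)"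
proof -
  note G' = geodesic_reparametrize[OF G s]
  show "s *\<^sub>R V 0 \<in> exp_dom N (\<gamma> 0)"
    unfolding exp_dom_def using G' by force
  show "exp_map N (\<gamma> 0) (s *\<^sub>R V 0) = \<gamma> s"
    unfolding exp_map_def
  proof (rule the_equality)
    show "\<exists>\<delta> W. geodesic_on N {0..1} \<delta> W \<and> \<delta> 0 = \<gamma> 0 \<and> W 0 = s *\<^sub>R V 0 \<and> \<delta> 1 = \<gamma> s"
      using G' by force
    fix y assume "\<exists>\<delta> W. geodesic_on N {0..1} \<delta> W \<and> \<delta> 0 = \<gamma> 0 \<and> W 0 = s *\<^sub>R V 0 \<and> \<delta> 1 = y"
    then obtain \<delta> W where "geodesic_on N {0..1} \<delta> W" "\<delta> 0 = \<gamma> 0" "W 0 = s *\<^sub>R V 0" "\<delta> 1 = y" by blast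
    with geodesic_unique(1)[OF this(1) G', of 1] show "y = \<gamma> s" by simp
  qed
qed

section \<open>Parallel transport\<close>

text \<open>Covariant derivatives on two adjacent closed intervals are glued. Outside one of the sets the
  derivative within that set imposes no condition.\<close>

lemma cov_deriv_along_Un:
  assumes V: "has_velocity N (S \<union> T) \<gamma> V" and t: "t \<in> S \<union> T" and cl: "closed S" "closed T"
    and S: "t \<in> S \<Longrightarrow> has_cov_deriv_along N S \<gamma> V X 0 t"
    and T: "t \<in> T \<Longrightarrow> has_cov_deriv_along N T \<gamma> V X 0 t"
  shows "has_cov_deriv_along N (S \<union> T) \<gamma> V X 0 t"
proof -
  let ?c = "pref_chart N (\<gamma> t)"
  note c = pref_chart[OF velocity_points[OF V t]]
  let ?D = "components N ?c (\<gamma> t) 0 - christoffel N ?c (snd ?c (\<gamma> t))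
      (components N ?c (\<gamma> t) (V t)) (components N ?c (\<gamma> t) (X t))"
  have "((\<lambda>s. components N ?c (\<gamma> s) (X s)) has_vector_derivative ?D) (at t within S)"
  proof (cases "t \<in> S")
    case True
    then show ?thesis
      using S cov_deriv_along_iff[OF has_velocity_subset[OF V] True c, of X 0]
      by (simp add: cov_deriv_in_chart_def)
  qed (rule has_vector_derivative_not_limit[OF _ cl(1)])
  moreover have "((\<lambda>s. components N ?c (\<gamma> s) (X s)) has_vector_derivative ?D) (at t within T)"
  proof (cases "t \<in> T")
    case True
    then show ?thesis
      using T cov_deriv_along_iff[OF has_velocity_subset[OF V] True c, of X 0]
      by (simp add: cov_deriv_in_chart_def)
  qed (rule has_vector_derivative_not_limit[OF _ cl(2)])
  ultimately show ?thesis
    unfolding cov_deriv_along_iff[OF V t c] cov_deriv_in_chart_def by (rule has_vector_derivative_Un)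
qed

lemma christoffel_along_tendsto:
  assumes G: "geodesic_on N I \<gamma> V" and t: "t \<in> I" and c: "c \<in> atlas N" "\<gamma> t \<in> fst c"
  shows "((\<lambda>s. christoffel N c (snd c (\<gamma> s)) (components N c (\<gamma> s) (V s)) u) \<longlongrightarrow>
    christoffel N c (snd c (\<gamma> t)) (components N c (\<gamma> t) (V t)) u) (at t within I)"
proof -
  have V: "has_velocity N I \<gamma> V" and cov: "has_cov_deriv_along N I \<gamma> V V 0 t"
    using G t by (auto simp: geodesic_on_def)
  let ?y = "\<lambda>s. snd c (\<gamma> s)" and ?v = "\<lambda>s. components N c (\<gamma> s) (V s)"
  have y: "?y t \<in> snd c ` fst c" using c by auto
  have ylim: "(?y \<longlongrightarrow> ?y t) (at t within I)"
    using has_vector_derivative_continuous[OF velocity_in_chart[OF V t c]] by (simp add: continuous_within)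
  have "((\<lambda>s. christoffel N c (?y s) i j) \<longlongrightarrow> christoffel N c (?y t) i j) (at t within I)" for i j
    using filterlim_compose[OF lipschitz_near_tendsto[OF christoffel_lipschitz_near[OF c(1) y]] ylim] .
  then have "((\<lambda>s. \<Sum>i\<in>Basis. \<Sum>j\<in>Basis. ((?v s \<bullet> i) * (u \<bullet> j)) *\<^sub>R christoffel N c (?y s) i j) \<longlongrightarrow>
      (\<Sum>i\<in>Basis. \<Sum>j\<in>Basis. ((?v t \<bullet> i) * (u \<bullet> j)) *\<^sub>R christoffel N c (?y t) i j)) (at t within I)"
    using cov_deriv_along_tendsto[OF V t c cov] by (intro tendsto_intros)
  moreover have "christoffel N c (?y s) (?v s) u =
      (\<Sum>i\<in>Basis. \<Sum>j\<in>Basis. ((?v s \<bullet> i) * (u \<bullet> j)) *\<^sub>R christoffel N c (?y s) i j)" if "\<gamma> s \<in> fst c" for s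
    using that c by (intro bilinear_euclidean_expansion bilinear_christoffel) auto
  moreover have "\<forall>\<^sub>F s in at t within I. \<gamma> s \<in> fst c"
    by (rule eventually_curve_in_open[OF velocity_continuous[OF V] openin_chart[OF c(1)] t c(2)])
  ultimately show ?thesis
    by (subst tendsto_cong[where g="\<lambda>s. \<Sum>i\<in>Basis. \<Sum>j\<in>Basis. ((?v s \<bullet> i) * (u \<bullet> j)) *\<^sub>R christoffel N c (?y s) i j"])
      (auto elim!: eventually_mono simp: c)
qed

text \<open>In a chart around \<open>\<gamma> x\<close> the equation for parallel fields is linear with continuous
  coefficients.\<close>

lemma parallel_field_exists_locally:
  assumes G: "geodesic_on N I \<gamma> V" and x: "x \<in> I"
  shows "\<exists>d>0. \<forall>a b. a \<le> x \<and> x \<le> b \<and> b - a < d \<and> {a..b} \<subseteq> I \<longrightarrow>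
    (\<forall>w. \<exists>X. X a = w \<and> (\<forall>t\<in>{a..b}. has_cov_deriv_along N {a..b} \<gamma> V X 0 t))"
proof -
  have V: "has_velocity N I \<gamma> V" using G by (auto simp: geodesic_on_def)
  let ?c = "pref_chart N (\<gamma> x)"
  note c = pref_chart[OF velocity_points[OF V x]]
  define A where "A s u = - christoffel N ?c (snd ?c (\<gamma> s)) (components N ?c (\<gamma> s) (V s)) u" for s u
  have linA: "linear (A s)" if "\<gamma> s \<in> fst ?c" for s
    unfolding A_def using bilinear_christoffel[OF c(1)] that
    by (intro linear_compose_neg) (auto simp: bilinear_def)
  have Alim: "((\<lambda>s. A s u) \<longlongrightarrow> A t u) (at t within I)" if "t \<in> I" "\<gamma> t \<in> fst ?c" for t u
    unfolding A_def by (intro tendsto_minus christoffel_along_tendsto[OF G that(1) c(1) that(2)])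
  define M where "M = (\<Sum>b\<in>(Basis::'e set). norm (A x b)) + 1"
  have M: "M > 0" by (auto simp: M_def intro!: add_nonneg_pos sum_nonneg)
  have "((\<lambda>s. \<Sum>b\<in>(Basis::'e set). norm (A s b)) \<longlongrightarrow> (\<Sum>b\<in>(Basis::'e set). norm (A x b))) (at x within I)"
    by (intro tendsto_intros Alim[OF x c(2)])
  then have "\<forall>\<^sub>F s in at x within I. (\<Sum>b\<in>(Basis::'e set). norm (A s b)) < M"
    by (rule order_tendstoD) (simp add: M_def)
  moreover have "\<forall>\<^sub>F s in at x within I. \<gamma> s \<in> fst ?c"
    by (rule eventually_curve_in_open[OF velocity_continuous[OF V] openin_chart[OF c(1)] x c(2)])
  ultimately have "\<forall>\<^sub>F s in at x within I. (\<Sum>b\<in>(Basis::'e set). norm (A s b)) < M \<and> \<gamma> s \<in> fst ?c"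
    by eventually_elim simp
  then obtain d where d: "d > 0"
    "\<forall>s\<in>I. s \<noteq> x \<and> dist s x < d \<longrightarrow> (\<Sum>b\<in>(Basis::'e set). norm (A s b)) < M \<and> \<gamma> s \<in> fst ?c"
    unfolding eventually_at by (elim exE conjE)
  then have near: "(\<Sum>b\<in>(Basis::'e set). norm (A s b)) < M \<and> \<gamma> s \<in> fst ?c"
    if "s \<in> I" "dist s x < d" for s
    using that c by (cases "s = x") (auto simp: M_def)
  \<comment> \<open>The second bound makes the Picard operator a contraction with constant \<open>1 / 2\<close>.\<close>
  define d' where "d' = min d (1 / (2 * M))"
  have d': "d' > 0" using d(1) M by (simp add: d'_def)
  have "\<exists>X. X a = w \<and> (\<forall>t\<in>{a..b}. has_cov_deriv_along N {a..b} \<gamma> V X 0 t)"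
    if ab: "a \<le> x" "x \<le> b" "b - a < d'" "{a..b} \<subseteq> I" for a b w
  proof -
    have ns: "s \<in> I" "(\<Sum>b\<in>(Basis::'e set). norm (A s b)) \<le> M" "\<gamma> s \<in> fst ?c" if "s \<in> {a..b}" for s
    proof -
      show I: "s \<in> I" using ab that by auto
      have "dist s x < d" using ab that by (auto simp: dist_real_def d'_def)
      from near[OF I this] show "(\<Sum>b\<in>(Basis::'e set). norm (A s b)) \<le> M" "\<gamma> s \<in> fst ?c" by auto
    qed
    have a: "a \<in> {a..b}" using ab by auto
    have "\<exists>Z. Z a = components N ?c (\<gamma> a) w \<and>
        (\<forall>s\<in>{a..b}. (Z has_vector_derivative A s (Z s)) (at s within {a..b}))"
    proof (rule linear_ode_short_interval[where M=M])
      show "linear (A s)" if "s \<in> {a..b}" for s using linA ns(3)[OF that] .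
      show "continuous_on {a..b} (\<lambda>s. A s v)" for v
        unfolding continuous_on_def using Alim ns ab(4) by (blast intro: tendsto_within_subset)
      show "norm (A s v) \<le> M * norm v" if s: "s \<in> {a..b}" for s v
      proof -
        have "norm (A s v) \<le> (\<Sum>b\<in>Basis. norm v * norm (A s b))"
          unfolding linear_euclidean_expansion[OF linA[OF ns(3)[OF s]], of v]
          by (rule order_trans[OF norm_sum sum_mono]) (simp add: Basis_le_norm mult_right_mono)
        also have "\<dots> = norm v * (\<Sum>b\<in>(Basis::'e set). norm (A s b))" by (simp add: sum_distrib_left)
        also have "\<dots> \<le> norm v * M" using ns(2)[OF s] by (intro mult_left_mono) auto
        finally show ?thesis by (simp add: mult.commute)
      qed
      have "M * (b - a) \<le> M * (1 / (2 * M))"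
        using ab M by (intro mult_left_mono) (auto simp: d'_def)
      then show "M * (b - a) \<le> 1 / 2" using M by simp
    qed (use ab M in auto)
    then obtain Z where Z: "Z a = components N ?c (\<gamma> a) w"
      "\<And>s. s \<in> {a..b} \<Longrightarrow> (Z has_vector_derivative A s (Z s)) (at s within {a..b})" by blast
    define X where "X s = vector_of_components N ?c (\<gamma> s) (Z s)" for s
    have XZ: "components N ?c (\<gamma> s) (X s) = Z s" if "s \<in> {a..b}" for s
      unfolding X_def by (rule components_vector_of_components[OF c(1) ns(3)[OF that]])
    have "has_cov_deriv_along N {a..b} \<gamma> V X 0 t" if t: "t \<in> {a..b}" for t
      unfolding cov_deriv_along_iff[OF has_velocity_subset[OF V ab(4)] t c(1) ns(3)[OF t]]
        cov_deriv_in_chart_def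
    proof (rule has_vector_derivative_transform[OF t])
      show "(Z has_vector_derivative components N ?c (\<gamma> t) 0 - christoffel N ?c (snd ?c (\<gamma> t))
          (components N ?c (\<gamma> t) (V t)) (components N ?c (\<gamma> t) (X t))) (at t within {a..b})"
        using Z(2)[OF t] linear_0[OF linear_components[OF c(1) ns(3)[OF t]]] by (simp add: A_def XZ[OF t])
    qed (rule XZ)
    moreover have "X a = w"
      unfolding X_def Z(1) by (rule vector_of_components_components[OF c(1) ns(3)[OF a]])
    ultimately show ?thesis by blast
  qed
  note * = this
  show ?thesis by (intro exI[of _ d'] conjI[OF d'] allI impI, elim conjE, rule *)
qed

end

text \<open>A fixed geodesic, parametrized by the unit interval, with its velocity field.\<close>

locale geodesic = riemannian N for N :: "('a, 'e::euclidean_space) riem" +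
  fixes \<gamma> :: "real \<Rightarrow> 'a" and V :: "real \<Rightarrow> 'e"
  assumes geodesic: "geodesic_on N {0..1} \<gamma> V"
begin

lemma velocity: "has_velocity N {0..1} \<gamma> V"
  using geodesic by (simp add: geodesic_on_def)

text \<open>Parallel fields with respect to the given velocity field \<open>V\<close>; that no other velocity field has
  to be considered is \<open>parallel_along_iff\<close> below.\<close>

abbreviation parallel :: "(real \<Rightarrow> 'e) \<Rightarrow> bool" where
  "parallel X \<equiv> \<forall>t\<in>{0..1}. has_cov_deriv_along N {0..1} \<gamma> V X 0 t"

lemma parallel_velocity: "parallel V"
  using geodesic by (simp add: geodesic_on_def)

lemma parallel_along_iff: "parallel_along N {0..1} \<gamma> X \<longleftrightarrow> parallel X"
proof
  assume "parallel_along N {0..1} \<gamma> X"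
  then obtain V' where V': "has_velocity N {0..1} \<gamma> V'"
    "\<And>t. t \<in> {0..1} \<Longrightarrow> has_cov_deriv_along N {0..1} \<gamma> V' X 0 t"
    unfolding parallel_along_def by blast
  show "parallel X"
  proof
    fix t :: real assume t: "t \<in> {0..1}"
    have "V' t = V t"
    proof (rule vector_derivative_unique_within)
      show "at t within {0..1} \<noteq> bot" using t by (simp add: trivial_limit_within islimpt_Icc)
    qed (use velocity V' t in \<open>auto simp: has_velocity_def\<close>)
    with V'(2)[OF t] show "has_cov_deriv_along N {0..1} \<gamma> V X 0 t"
      using t by (auto intro: cov_deriv_along_cong)
  qed
next
  assume "parallel X"
  then show "parallel_along N {0..1} \<gamma> X" using velocity unfolding parallel_along_def by blast
qed

lemma parallel_linear: "parallel X \<Longrightarrow> parallel Y \<Longrightarrow> parallel (\<lambda>s. r *\<^sub>R X s + k *\<^sub>R Y s)"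
  using cov_deriv_along_linear[OF velocity, of _ X 0 Y 0 r k] by auto

lemma parallel_metric:
  assumes "parallel X" "parallel Y" and st: "s \<in> {0..1}" "t \<in> {0..1}"
  shows "metric N (\<gamma> s) (X s) (Y s) = metric N (\<gamma> t) (X t) (Y t)"
proof -
  have "((\<lambda>s. metric N (\<gamma> s) (X s) (Y s)) has_real_derivative 0) (at r within {0..1})"
    if r: "r \<in> {0..1}" for r
  proof -
    have b: "bilinear (metric N (\<gamma> r))" using velocity_points[OF velocity r] by (rule metric_bilinear)
    from has_derivative_metric_along[OF velocity r, of X 0 Y 0] assms(1,2) r
    show ?thesis by (simp add: bilinear_lzero[OF b] bilinear_rzero[OF b])
  qed
  then obtain k where "\<And>r. r \<in> {0..1} \<Longrightarrow> metric N (\<gamma> r) (X r) (Y r) = k"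
    using has_field_derivative_zero_constant[of "{0..1::real}" "\<lambda>s. metric N (\<gamma> s) (X s) (Y s)"] by auto
  with st show ?thesis by simp
qed

text \<open>The difference of two parallel fields has constant length.\<close>

lemma parallel_unique:
  assumes "parallel X" "parallel Y" and st: "s \<in> {0..1}" "t \<in> {0..1}" and eq: "X s = Y s"
  shows "X t = Y t"
proof (rule ccontr)
  assume "X t \<noteq> Y t"
  then have "0 < metric N (\<gamma> t) (X t - Y t) (X t - Y t)"
    using metric_pos[OF velocity_points[OF velocity st(2)]] by simp
  moreover have "parallel (\<lambda>s. X s - Y s)" using parallel_linear[OF assms(1,2), of 1 "- 1"] by simp
  from parallel_metric[OF this this st]
  have "metric N (\<gamma> t) (X t - Y t) (X t - Y t) = 0"
    using bilinear_lzero[OF metric_bilinear[OF velocity_points[OF velocity st(1)]]] eq by simp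
  ultimately show False by simp
qed

lemma parallel_exists_from_start: obtains X where "parallel X" "X 0 = w"
proof -
  let ?P = "\<lambda>a b. a \<le> b \<longrightarrow> {a..b} \<subseteq> {0..1} \<longrightarrow>
    (\<forall>w. \<exists>X. X a = w \<and> (\<forall>t\<in>{a..b}. has_cov_deriv_along N {a..b} \<gamma> V X 0 t))"
  have "?P 0 1"
  proof (rule Bolzano[of 0 1 ?P])
    fix a b c :: real assume P: "?P a b" "?P b c" and le: "a \<le> b" "b \<le> c"
    show "?P a c"
    proof (intro impI allI)
      fix w assume sub: "{a..c} \<subseteq> {0..1}"
      then have sub': "{a..b} \<subseteq> {0..1}" "{b..c} \<subseteq> {0..1}" using le by auto
      from P(1) le(1) sub'(1) obtain X where X: "X a = w"
        "\<And>t. t \<in> {a..b} \<Longrightarrow> has_cov_deriv_along N {a..b} \<gamma> V X 0 t" by blast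
      from P(2) le(2) sub'(2) obtain Y where Y: "Y b = X b"
        "\<And>t. t \<in> {b..c} \<Longrightarrow> has_cov_deriv_along N {b..c} \<gamma> V Y 0 t" by blast
      define Z where "Z s = (if s \<le> b then X s else Y s)" for s
      have ZX: "X s = Z s" if "s \<in> {a..b}" for s using that by (simp add: Z_def)
      have ZY: "Y s = Z s" if "s \<in> {b..c}" for s using that Y(1) by (auto simp: Z_def)
      have un: "{a..c} = {a..b} \<union> {b..c}" using le by auto
      have "has_cov_deriv_along N ({a..b} \<union> {b..c}) \<gamma> V Z 0 t" if t: "t \<in> {a..b} \<union> {b..c}" for t
      proof (rule cov_deriv_along_Un[OF has_velocity_subset[OF velocity] t])
        show "has_cov_deriv_along N {a..b} \<gamma> V Z 0 t" if "t \<in> {a..b}"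
          by (rule cov_deriv_along_cong[where \<gamma>=\<gamma> and V=V and \<gamma>'=\<gamma> and V'=V, OF that X(2)[OF that] refl refl ZX])
        show "has_cov_deriv_along N {b..c} \<gamma> V Z 0 t" if "t \<in> {b..c}"
          by (rule cov_deriv_along_cong[where \<gamma>=\<gamma> and V=V and \<gamma>'=\<gamma> and V'=V, OF that Y(2)[OF that] refl refl ZY])
      qed (use sub' in auto)
      moreover have "Z a = w" using X(1) le by (simp add: Z_def)
      ultimately show "\<exists>X. X a = w \<and> (\<forall>t\<in>{a..c}. has_cov_deriv_along N {a..c} \<gamma> V X 0 t)"
        unfolding un by blast
    qed
  next
    fix x :: real assume "0 \<le> x" "x \<le> 1"
    then have "x \<in> {0..1}" by simp
    from parallel_field_exists_locally[OF geodesic this]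
    obtain d where d: "d > 0" "\<forall>a b. a \<le> x \<and> x \<le> b \<and> b - a < d \<and> {a..b} \<subseteq> {0..1} \<longrightarrow>
      (\<forall>w. \<exists>X. X a = w \<and> (\<forall>t\<in>{a..b}. has_cov_deriv_along N {a..b} \<gamma> V X 0 t))"
      by (elim exE conjE)
    show "\<exists>d>0. \<forall>a b. a \<le> x \<and> x \<le> b \<and> b - a < d \<longrightarrow> ?P a b"
    proof (intro exI[of _ d] conjI[OF d(1)] allI impI)
      fix a b w assume *: "a \<le> x \<and> x \<le> b \<and> b - a < d" "{a..b} \<subseteq> {0..1}"
      show "\<exists>X. X a = w \<and> (\<forall>t\<in>{a..b}. has_cov_deriv_along N {a..b} \<gamma> V X 0 t)"
        using d(2)[THEN spec[of _ a], THEN spec[of _ b]] * by blast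
    qed
  qed simp
  then have "\<exists>X. X 0 = w \<and> parallel X" by simp
  then show thesis using that by (elim exE conjE)
qed

lemma parallel_transport_eq:
  assumes "parallel X" "\<alpha> \<in> {0..1}" "\<beta> \<in> {0..1}"
  shows "parallel_transport N \<gamma> \<alpha> \<beta> (X \<alpha>) = X \<beta>"
  unfolding parallel_transport_def parallel_along_iff
proof (rule the_equality)
  show "\<exists>Y. parallel Y \<and> Y \<alpha> = X \<alpha> \<and> Y \<beta> = X \<beta>" using assms(1) by (intro exI[of _ X] conjI refl)
  fix w assume "\<exists>Y. parallel Y \<and> Y \<alpha> = X \<alpha> \<and> Y \<beta> = w"
  then obtain Y where Y: "parallel Y" "Y \<alpha> = X \<alpha>" "Y \<beta> = w" by (elim exE conjE)
  from parallel_unique[OF Y(1) assms(1) assms(2,3) Y(2)] Y(3) show "w = X \<beta>" by simp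
qed

lemma linear_parallel_transport_from_start: "linear (parallel_transport N \<gamma> 0 1)"
proof -
  have *: "parallel_transport N \<gamma> 0 1 (r *\<^sub>R u + k *\<^sub>R v) =
      r *\<^sub>R parallel_transport N \<gamma> 0 1 u + k *\<^sub>R parallel_transport N \<gamma> 0 1 v" for r k u v
  proof -
    obtain X where X: "parallel X" "X 0 = u" by (rule parallel_exists_from_start)
    obtain Y where Y: "parallel Y" "Y 0 = v" by (rule parallel_exists_from_start)
    show ?thesis
      using parallel_transport_eq[OF X(1), of 0 1] parallel_transport_eq[OF Y(1), of 0 1]
        parallel_transport_eq[OF parallel_linear[OF X(1) Y(1), of r k], of 0 1] X(2) Y(2) by simp
  qed
  show ?thesis
    using *[of 1 _ 1] *[of _ _ 0] by (intro linearI) simp_all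
qed

text \<open>Every end value is attained, since transport is linear and, preserving the metric, injective.\<close>

lemma parallel_exists_to_end: obtains X where "parallel X" "X 1 = w"
proof -
  let ?P = "parallel_transport N \<gamma> 0 1"
  have "inj ?P"
  proof (rule injI)
    fix u v assume eq: "?P u = ?P v"
    obtain X where X: "parallel X" "X 0 = u" by (rule parallel_exists_from_start)
    obtain Y where Y: "parallel Y" "Y 0 = v" by (rule parallel_exists_from_start)
    have "X 1 = Y 1"
      using eq X(2) Y(2) parallel_transport_eq[OF X(1), of 0 1] parallel_transport_eq[OF Y(1), of 0 1] by simp
    then show "u = v" using parallel_unique[OF X(1) Y(1), of 1 0] X(2) Y(2) by simp
  qed
  then have "surj ?P" using linear_injective_imp_surjective[OF linear_parallel_transport_from_start] by simp
  then obtain u where u: "w = ?P u" by (rule surjE)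
  obtain X where X: "parallel X" "X 0 = u" by (rule parallel_exists_from_start)
  have "X 1 = w" using parallel_transport_eq[OF X(1), of 0 1] u X(2) by simp
  with X(1) show thesis by (rule that)
qed

lemma linear_parallel_transport_to_start: "linear (parallel_transport N \<gamma> 1 0)"
proof -
  have *: "parallel_transport N \<gamma> 1 0 (r *\<^sub>R u + k *\<^sub>R v) =
      r *\<^sub>R parallel_transport N \<gamma> 1 0 u + k *\<^sub>R parallel_transport N \<gamma> 1 0 v" for r k u v
  proof -
    obtain X where X: "parallel X" "X 1 = u" by (rule parallel_exists_to_end)
    obtain Y where Y: "parallel Y" "Y 1 = v" by (rule parallel_exists_to_end)
    show ?thesis
      using parallel_transport_eq[OF X(1), of 1 0] parallel_transport_eq[OF Y(1), of 1 0]
        parallel_transport_eq[OF parallel_linear[OF X(1) Y(1), of r k], of 1 0] X(2) Y(2) by simp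
  qed
  show ?thesis
    using *[of 1 _ 1] *[of _ _ 0] by (intro linearI) simp_all
qed

text \<open>Parallel transport back to the start is adjoint to transport to the end.\<close>

lemma metric_parallel_transport:
  assumes Y: "parallel Y"
  shows "metric N (\<gamma> 0) (parallel_transport N \<gamma> 1 0 w) (Y 0) = metric N (\<gamma> 1) w (Y 1)"
proof -
  obtain X where X: "parallel X" "X 1 = w" by (rule parallel_exists_to_end)
  show ?thesis
    using parallel_metric[OF X(1) Y, of 0 1] parallel_transport_eq[OF X(1), of 1 0] X(2) by simp
qed

end

section \<open>The cubic remainder estimate\<close>

theorem theorem2p4:
  fixes N :: "('a, 'e::euclidean_space) riem"
    and U :: "'a set" and f :: "'a \<Rightarrow> real"
    and gradf :: "'a \<Rightarrow> 'e" and Hessf :: "'a \<Rightarrow> 'e \<Rightarrow> 'e"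
    and x :: 'a and \<Delta>x :: 'e and L :: real
  assumes "riemannian_manifold N"
    and "geodesically_convex N U"
    and "is_gradient_on N U f gradf"
    and "is_hessian_on N U gradf Hessf"
    and "x \<in> U"
    and lipschitz:
      "\<And>v. v \<in> exp_dom N x \<Longrightarrow> exp_map N x v \<in> U \<Longrightarrow>
        (let \<gamma> = (\<lambda>t. exp_map N x (t *\<^sub>R v)) in
         opnorm N x (\<lambda>w. parallel_transport N \<gamma> 1 0
                            (Hessf (exp_map N x v) (parallel_transport N \<gamma> 0 1 w))
                          - Hessf x w)
           \<le> L * tnorm N x v)"
    and "\<Delta>x \<in> exp_dom N x" and "exp_map N x \<Delta>x \<in> U"
  shows "\<bar>f (exp_map N x \<Delta>x) - f x - metric N x (gradf x) \<Delta>x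
           - 1/2 * metric N x (Hessf x \<Delta>x) \<Delta>x\<bar> \<le> L / 6 * tnorm N x \<Delta>x ^ 3"
proof -
  interpret riemannian N by unfold_locales (rule assms(1))
  obtain \<gamma> V where G: "geodesic_on N {0..1} \<gamma> V" and init: "\<gamma> 0 = x" "V 0 = \<Delta>x"
    using assms(7) unfolding exp_dom_def by blast
  interpret \<gamma>: geodesic N \<gamma> V by unfold_locales (rule G)
  note V = \<gamma>.velocity
  have exp: "exp_map N x (s *\<^sub>R \<Delta>x) = \<gamma> s" "s *\<^sub>R \<Delta>x \<in> exp_dom N x" if "s \<in> {0..1}" for s
    using exp_map_geodesic[OF G that] by (simp_all add: init)
  have \<gamma>U: "\<gamma> s \<in> U" if s: "s \<in> {0..1}" for s
    using assms(2,5,7,8) s exp(1)[OF s] unfolding geodesically_convex_def by metis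
  then have img: "\<gamma> ` {0..1} \<subseteq> U" by auto
  have points: "\<gamma> s \<in> points N" if "s \<in> {0..1}" for s by (rule velocity_points[OF V that])
  have x: "x \<in> points N" using points[of 0] init by simp
  note bil = metric_bilinear[OF x]
  define \<phi>' where "\<phi>' t = metric N (\<gamma> t) (gradf (\<gamma> t)) (V t)" for t
  define \<phi>'' where "\<phi>'' t = metric N (\<gamma> t) (Hessf (\<gamma> t) (V t)) (V t)" for t
  define n where "n = tnorm N x \<Delta>x"
  have n: "0 \<le> n" unfolding n_def by (rule tnorm_nonneg[OF x])
  have "\<bar>f (\<gamma> 1) - f (\<gamma> 0) - \<phi>' 0 - 1 / 2 * \<phi>'' 0\<bar> \<le> (L * n ^ 3) / 6"
  proof (rule taylor2_lipschitz[where \<phi>="\<lambda>t. f (\<gamma> t)" and \<phi>'=\<phi>'])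
    fix s :: real assume s: "s \<in> {0..1}"
    show "((\<lambda>t. f (\<gamma> t)) has_real_derivative \<phi>' s) (at s within {0..1})"
      unfolding \<phi>'_def by (rule has_derivative_along_gradient[OF V s img assms(3)])
    show "(\<phi>' has_real_derivative \<phi>'' s) (at s within {0..1})"
      using has_derivative_metric_along[OF V s cov_deriv_along_hessian[OF V s img assms(4)]
          \<gamma>.parallel_velocity[rule_format, OF s]]
      unfolding \<phi>'_def[abs_def] \<phi>''_def
      by (simp add: bilinear_rzero[OF metric_bilinear[OF points[OF s]]])
    \<comment> \<open>The Lipschitz hypothesis for \<open>s \<Delta>x\<close> is about transport along the geodesic \<open>\<gamma>\<^sub>s\<close>, which is \<open>\<gamma>\<close> run
      through up to time \<open>s\<close>. Along it, \<open>V\<close> is parallel also without the velocity factor \<open>s\<close>,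
      so that it transports \<open>\<Delta>x\<close> to \<open>V s\<close> also if \<open>s = 0\<close>.\<close>
    define \<gamma>\<^sub>s where "\<gamma>\<^sub>s = (\<lambda>t. exp_map N x (t *\<^sub>R (s *\<^sub>R \<Delta>x)))"
    have \<gamma>\<^sub>s: "\<gamma> (s * t) = \<gamma>\<^sub>s t" if "t \<in> {0..1}" for t
      using exp(1)[of "t * s"] s that by (auto simp: \<gamma>\<^sub>s_def mult.commute mult_le_one)
    interpret s: geodesic N \<gamma>\<^sub>s "\<lambda>t. s *\<^sub>R V (s * t)"
      by unfold_locales (rule geodesic_on_cong[OF geodesic_reparametrize[OF G s] \<gamma>\<^sub>s])
    have par: "s.parallel (\<lambda>t. V (s * t))"
    proof
      fix t :: real assume t: "t \<in> {0..1}"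
      have "s * t \<in> {0..1}" using s t by (auto intro: mult_le_one)
      then have "has_cov_deriv_along N {0..1} \<gamma> V V 0 (s * t)" by (rule \<gamma>.parallel_velocity[rule_format])
      from cov_deriv_along_reparametrize[OF V s t this]
      have "has_cov_deriv_along N {0..1} (\<lambda>t. \<gamma> (s * t)) (\<lambda>t. s *\<^sub>R V (s * t)) (\<lambda>t. V (s * t)) 0 t" by simp
      then show "has_cov_deriv_along N {0..1} \<gamma>\<^sub>s (\<lambda>t. s *\<^sub>R V (s * t)) (\<lambda>t. V (s * t)) 0 t"
        by (rule cov_deriv_along_cong[OF t _ \<gamma>\<^sub>s]) simp_all
    qed
    have ends: "\<gamma>\<^sub>s 0 = x" "\<gamma>\<^sub>s 1 = \<gamma> s" using \<gamma>\<^sub>s[of 0] \<gamma>\<^sub>s[of 1] init by auto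
    define T where "T w = parallel_transport N \<gamma>\<^sub>s 1 0 (Hessf (\<gamma> s) (parallel_transport N \<gamma>\<^sub>s 0 1 w)) - Hessf x w" for w
    have "linear T"
      unfolding T_def[abs_def]
      using linear_compose[OF linear_compose[OF s.linear_parallel_transport_from_start
            linear_hessian[OF assms(4) \<gamma>U[OF s] points[OF s]]] s.linear_parallel_transport_to_start]
      by (intro linear_compose_sub linear_hessian[OF assms(4,5) x]) (simp add: o_def)
    have "opnorm N x T \<le> L * tnorm N x (s *\<^sub>R \<Delta>x)"
      using lipschitz[OF exp(2)[OF s]] \<gamma>U[OF s] exp(1)[OF s]
      unfolding T_def[abs_def] \<gamma>\<^sub>s_def Let_def by simp
    then have op: "opnorm N x T \<le> L * (s * n)"
      using s by (simp add: tnorm_scaleR[OF x] n_def)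
    have "parallel_transport N \<gamma>\<^sub>s 0 1 \<Delta>x = V s"
      using s.parallel_transport_eq[OF par, of 0 1] init by simp
    then have "metric N x (T \<Delta>x) \<Delta>x = \<phi>'' s - \<phi>'' 0"
      using s.metric_parallel_transport[OF par] ends init
      by (simp add: T_def bilinear_lsub[OF bil] \<phi>''_def)
    then have "\<bar>\<phi>'' s - \<phi>'' 0\<bar> \<le> tnorm N x (T \<Delta>x) * n"
      using metric_cauchy_schwarz[OF x, of "T \<Delta>x" \<Delta>x] by (simp add: n_def)
    also have "\<dots> \<le> (opnorm N x T * n) * n"
      using tnorm_le_opnorm[OF x \<open>linear T\<close>, of \<Delta>x] n by (intro mult_right_mono) (auto simp: n_def)
    also have "\<dots> \<le> (L * (s * n) * n) * n" using op n by (intro mult_right_mono)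
    also have "\<dots> = L * n ^ 3 * s" by (simp add: power3_eq_cube)
    finally show "\<bar>\<phi>'' s - \<phi>'' 0\<bar> \<le> L * n ^ 3 * s" .
  qed
  moreover have "\<gamma> 1 = exp_map N x \<Delta>x" using exp(1)[of 1] by simp
  ultimately show ?thesis by (simp add: \<phi>'_def \<phi>''_def init n_def)
qed

end
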